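(* Let $(\mathcal C,\otimes,\mathbf I,c)$ be a symmetric strict monoidal category. Let $(H,\mu,\nu,\Delta,\varepsilon)$ be an object of $\mathcal C$ endowed with a unital associative algebra structure $(\mu,\nu)$ and a counital coassociative coalgebra structure $(\Delta,\varepsilon)$ (not assumed compatible with each other), and let $R:\mathbf I\to H\otimes H$ be a weak R-matrix for $H$. For a left $H$-module $(M,\lambda)$ put $$\delta^R:=c_{H,M}\circ(\mathrm{Id}_H\otimes\lambda)\circ(R\otimes \mathrm{Id}_M):M\to M\otimes H.$$ Then: 1. For any left $H$-module $(M,\lambda)$, the data $(M,\lambda,\delta^R)$ form a left-right Yetter-Drinfel'd module over $H$. 2. For any two left $H$-modules $(M,\lambda_M)$ and $(N,\lambda_N)$ (regarded also as Yetter-Drinfel'd modules as in 1, so that $\delta_N=\delta^R_N$), the morphism $$c^R_{M,N}:=c_{M,N}\circ(\lambda_M\otimes\lambda_N)\circ(\mathrm{Id}_H\otimes c_{H,M}\otimes \mathrm{Id}_N)\circ(R\otimes \mathrm{Id}_{M\otimes N})$$ coincides with $$c^{YD}_{M,N}:=(\mathrm{Id}_N\otimes\lambda_M)\circ(\delta_N\otimes \mathrm{Id}_M)\circ c_{M,N},$$ and, for $N=M$, it defines a braiding for the object $M$ in $\mathcal C$. 3. The category ${}_H\mathbf{Mod}$ of left $H$-modules can be seen as a full subcategory of the category ${}_H\mathbf{YD}^H$ of left-right Yetter-Drinfel'd modules over $H$ via the inclusion $$i_R:{}_H\mathbf{Mod}\hookrightarrow{}_H\mathbf{YD}^H,\qquad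 (M,\lambda)\mapsto(M,\lambda,\delta^R)$$ (acting identically on morphisms). 4. If $H$ is a bialgebra in $\mathcal C$ and $R$ is a strong R-matrix, then the functor $i_R$ is braided monoidal, where ${}_H\mathbf{Mod}$ carries the braiding $c^R$ and ${}_H\mathbf{YD}^H$ carries the braiding $c^{YD}$ (with the monoidal structures specified in the context).
   Context: Conventions. All monoidal categories are strict. A symmetric category has a braiding $c$ with $c_{V,W}\circ c_{W,V}=\mathrm{Id}$. Braidings that are not $c$ itself are not required to be invertible: a braiding on a monoidal category is a natural family $c_{V,W}:V\otimes W\to W\otimes V$ with $c_{V,W\otimes U}=(\mathrm{Id}_W\otimes c_{V,U})(c_{V,W}\otimes\mathrm{Id}_U)$ and $c_{V\otimes W,U}=(c_{V,U}\otimes\mathrm{Id}_W)(\mathrm{Id}_V\otimes c_{W,U})$. A braiding for an object $V$ is a morphism $\sigma:V\otimes V\to V\otimes V$ (not necessarily invertible) with $(\sigma\otimes \mathrm{Id})(\mathrm{Id}\otimes\sigma)(\sigma\otimes\mathrm{Id})=(\mathrm{Id}\otimes\sigma)(\sigma\otimes\mathrm{Id})(\mathrm{Id}\otimes\sigma)$. Notation: $c^2:=\mathrm{Id}_H\otimes c_{H,H}\otimes \mathrm{Id}_H$; $\mu_{H\otimes H}:=(\mu\otimes\mu)\circ c^2$; $\mu^{op}:=\mu\circ c_{H,H}$; $\Delta^{op}:=c_{H,H}\circ\Delta$. A weak R-matrix for $H$ is a morphism $R:\mathbf I\to H\otimes H$ such that (1) $(\Delta\otimes\mathrm{Id}_H)\circ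 R=(\mathrm{Id}_{H\otimes H}\otimes\mu)\circ c^2\circ(R\otimes R)$; (2) $(\varepsilon\otimes\mathrm{Id}_H)\circ R=\nu$; (3) $\mu_{H\otimes H}\circ(R\otimes\Delta)=\mu_{H\otimes H}\circ(\Delta^{op}\otimes R)$. A strong R-matrix is a weak R-matrix satisfying in addition (1') $(\mathrm{Id}_H\otimes\Delta)\circ R=(\mu^{op}\otimes\mathrm{Id}_{H\otimes H})\circ c^2\circ(R\otimes R)$; (2') $(\mathrm{Id}_H\otimes\varepsilon)\circ R=\nu$. A left-right Yetter-Drinfel'd (YD) module over $H$ (which need only be an algebra and a coalgebra) is an object $M$ with a left $H$-module structure $\lambda:H\otimes M\to M$ and a right $H$-comodule structure $\delta:M\to M\otimes H$ such that $$(\mathrm{Id}_M\otimes\mu)(\delta\otimes\mathrm{Id}_H)c_{H,M}(\mathrm{Id}_H\otimes\lambda)(\Delta\otimes\mathrm{Id}_M)=(\lambda\otimes\mu)(\mathrm{Id}_H\otimes c_{H,M}\otimes\mathrm{Id}_H)(\Delta\otimes\delta).$$ Morphisms of ${}_H\mathbf{YD}^H$ are the morphisms of $\mathcal C$ which are simultaneously $H$-module and $H$-comodule morphisms. When $H$ is a bialgebra, ${}_H\mathbf{Mod}$ is monoidal with $\lambda_{M\otimes N}:=(\lambda_M\otimes\lambda_N)(\mathrm{Id}_H\otimes c_{H,M}\otimes\mathrm{Id}_N)(\Delta\otimes\mathrm{Id}_{M\otimes N})$ and $\lambda_{\mathbf I}:=\varepsilon$; and ${}_H\mathbf{YD}^H$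 is monoidal with the same module structures and comodule structures $\delta_{M\otimes N}:=(\mathrm{Id}_{M\otimes N}\otimes\mu^{op})(\mathrm{Id}_M\otimes c_{H,N}\otimes\mathrm{Id}_H)(\delta_M\otimes\delta_N)$ and $\delta_{\mathbf I}:=\nu$. *)

theory Defs
  imports Main
begin

record ('o, 'a) category =
  Obj :: "'o set"
  Arr :: "'a set"
  Dom :: "'a \<Rightarrow> 'o"
  Cod :: "'a \<Rightarrow> 'o"
  Ident :: "'o \<Rightarrow> 'a"  ("Id\<index>")
  Comp :: "'a \<Rightarrow> 'a \<Rightarrow> 'a"  (infixr "\<cdot>\<index>" 65)

record ('o, 'a) monoidal_category = "('o, 'a) category" +
  TensorO :: "'o \<Rightarrow> 'o \<Rightarrow> 'o"  (infixr "\<otimes>\<^sub>o\<index>" 75)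
  TensorA :: "'a \<Rightarrow> 'a \<Rightarrow> 'a"  (infixr "\<otimes>\<index>" 75)
  UnitO :: "'o"  ("\<one>\<index>")

definition Hom :: "('o, 'a, 'm) category_scheme \<Rightarrow> 'o \<Rightarrow> 'o \<Rightarrow> 'a set"  ("hom\<index>")
  where "hom\<^bsub>C\<^esub> A B = {f \<in> Arr C. Dom C f = A \<and> Cod C f = B}"

locale category =
  fixes C :: "('o, 'a, 'm) category_scheme" (structure)
  assumes Dom_Obj: "f \<in> Arr C \<Longrightarrow> Dom C f \<in> Obj C"
    and Cod_Obj: "f \<in> Arr C \<Longrightarrow> Cod C f \<in> Obj C"
    and Id_hom: "A \<in> Obj C \<Longrightarrow> Id A \<in> hom A A"
    and Comp_hom: "f \<in> hom A B \<Longrightarrow> g \<in> hom B D \<Longrightarrow> g \<cdot> f \<in> hom A D"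
    and Comp_assoc: "f \<in> hom A B \<Longrightarrow> g \<in> hom B D \<Longrightarrow> h \<in> hom D E \<Longrightarrow> (h \<cdot> g) \<cdot> f = h \<cdot> (g \<cdot> f)"
    and Comp_Id: "f \<in> hom A B \<Longrightarrow> f \<cdot> Id A = f"
    and Id_Comp: "f \<in> hom A B \<Longrightarrow> Id B \<cdot> f = f"

locale strict_monoidal_category = category C
  for C :: "('o, 'a, 'm) monoidal_category_scheme" (structure) +
  assumes UnitO_Obj: "\<one> \<in> Obj C"
    and TensorO_Obj: "A \<in> Obj C \<Longrightarrow> B \<in> Obj C \<Longrightarrow> A \<otimes>\<^sub>o B \<in> Obj C"
    and TensorA_hom: "f \<in> hom A B \<Longrightarrow> g \<in> hom A' B' \<Longrightarrow> f \<otimes> g \<in> hom (A \<otimes>\<^sub>o A') (B \<otimes>\<^sub>o B')"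
    and TensorA_Id: "A \<in> Obj C \<Longrightarrow> B \<in> Obj C \<Longrightarrow> Id A \<otimes> Id B = Id (A \<otimes>\<^sub>o B)"
    and TensorA_Comp:
      "f \<in> hom A B \<Longrightarrow> g \<in> hom B D \<Longrightarrow> f' \<in> hom A' B' \<Longrightarrow> g' \<in> hom B' D' \<Longrightarrow>
        (g \<cdot> f) \<otimes> (g' \<cdot> f') = (g \<otimes> g') \<cdot> (f \<otimes> f')"
    and TensorO_assoc:
      "A \<in> Obj C \<Longrightarrow> B \<in> Obj C \<Longrightarrow> D \<in> Obj C \<Longrightarrow> (A \<otimes>\<^sub>o B) \<otimes>\<^sub>o D = A \<otimes>\<^sub>o (B \<otimes>\<^sub>o D)"
    and TensorA_assoc:
      "f \<in> Arr C \<Longrightarrow> g \<in> Arr C \<Longrightarrow> h \<in> Arr C \<Longrightarrow> (f \<otimes> g) \<otimes> h = f \<otimes> (g \<otimes> h)"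
    and UnitO_left: "A \<in> Obj C \<Longrightarrow> \<one> \<otimes>\<^sub>o A = A"
    and UnitO_right: "A \<in> Obj C \<Longrightarrow> A \<otimes>\<^sub>o \<one> = A"
    and UnitA_left: "f \<in> Arr C \<Longrightarrow> Id \<one> \<otimes> f = f"
    and UnitA_right: "f \<in> Arr C \<Longrightarrow> f \<otimes> Id \<one> = f"

text \<open>
  Braidings are not required to be invertible, and \<open>c V \<one> = Id V = c \<one> V\<close> is not imposed; it follows
  from the other axioms when \<open>c\<close> is invertible, e.g. symmetric.
\<close>

locale braided_category = strict_monoidal_category C
  for C :: "('o, 'a, 'm) monoidal_category_scheme" (structure) +
  fixes c :: "'o \<Rightarrow> 'o \<Rightarrow> 'a"
  assumes braid_hom: "A \<in> Obj C \<Longrightarrow> B \<in> Obj C \<Longrightarrow> c A B \<in> hom (A \<otimes>\<^sub>o B) (B \<otimes>\<^sub>o A)"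
    and braid_natural:
      "f \<in> hom A A' \<Longrightarrow> g \<in> hom B B' \<Longrightarrow> c A' B' \<cdot> (f \<otimes> g) = (g \<otimes> f) \<cdot> c A B"
    and braid_tensor_right:
      "V \<in> Obj C \<Longrightarrow> W \<in> Obj C \<Longrightarrow> U \<in> Obj C \<Longrightarrow>
        c V (W \<otimes>\<^sub>o U) = (Id W \<otimes> c V U) \<cdot> (c V W \<otimes> Id U)"
    and braid_tensor_left:
      "V \<in> Obj C \<Longrightarrow> W \<in> Obj C \<Longrightarrow> U \<in> Obj C \<Longrightarrow>
        c (V \<otimes>\<^sub>o W) U = (c V U \<otimes> Id W) \<cdot> (Id V \<otimes> c W U)"

locale symmetric_category = braided_category C c
  for C :: "('o, 'a, 'm) monoidal_category_scheme" (structure)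
    and c :: "'o \<Rightarrow> 'o \<Rightarrow> 'a" +
  assumes braid_symmetric:
    "V \<in> Obj C \<Longrightarrow> W \<in> Obj C \<Longrightarrow> c V W \<cdot> c W V = Id (W \<otimes>\<^sub>o V)"

locale cat_functor = source: category C + target: category D
  for C :: "('o, 'a, 'm) category_scheme"
    and D :: "('p, 'b, 'n) category_scheme" +
  fixes Fo :: "'o \<Rightarrow> 'p" and Fa :: "'a \<Rightarrow> 'b"
  assumes Fo_Obj: "A \<in> Obj C \<Longrightarrow> Fo A \<in> Obj D"
    and Fa_hom: "f \<in> hom\<^bsub>C\<^esub> A B \<Longrightarrow> Fa f \<in> hom\<^bsub>D\<^esub> (Fo A) (Fo B)"
    and Fa_Id: "A \<in> Obj C \<Longrightarrow> Fa (Id\<^bsub>C\<^esub> A) = Id\<^bsub>D\<^esub> (Fo A)"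
    and Fa_Comp: "f \<in> hom\<^bsub>C\<^esub> A B \<Longrightarrow> g \<in> hom\<^bsub>C\<^esub> B E \<Longrightarrow> Fa (g \<cdot>\<^bsub>C\<^esub> f) = Fa g \<cdot>\<^bsub>D\<^esub> Fa f"

text \<open>Functors that identify the source with a full subcategory of the target.\<close>

locale full_subcategory_inclusion = cat_functor C D Fo Fa
  for C :: "('o, 'a, 'm) category_scheme"
    and D :: "('p, 'b, 'n) category_scheme"
    and Fo :: "'o \<Rightarrow> 'p" and Fa :: "'a \<Rightarrow> 'b" +
  assumes Fo_inj: "inj_on Fo (Obj C)"
    and fully_faithful:
      "A \<in> Obj C \<Longrightarrow> B \<in> Obj C \<Longrightarrow> bij_betw Fa (hom\<^bsub>C\<^esub> A B) (hom\<^bsub>D\<^esub> (Fo A) (Fo B))"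

text \<open>Monoidal functors are strict, so compatibility with the braidings needs no coherence maps.\<close>

locale braided_monoidal_functor =
  cat_functor C D Fo Fa + source: braided_category C c + target: braided_category D d
  for C :: "('o, 'a, 'm) monoidal_category_scheme" and c :: "'o \<Rightarrow> 'o \<Rightarrow> 'a"
    and D :: "('p, 'b, 'n) monoidal_category_scheme" and d :: "'p \<Rightarrow> 'p \<Rightarrow> 'b"
    and Fo :: "'o \<Rightarrow> 'p" and Fa :: "'a \<Rightarrow> 'b" +
  assumes Fo_UnitO: "Fo \<one>\<^bsub>C\<^esub> = \<one>\<^bsub>D\<^esub>"
    and Fo_TensorO:
      "A \<in> Obj C \<Longrightarrow> B \<in> Obj C \<Longrightarrow> Fo (A \<otimes>\<^sub>o\<^bsub>C\<^esub> B) = Fo A \<otimes>\<^sub>o\<^bsub>D\<^esub> Fo B"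
    and Fa_TensorA:
      "f \<in> Arr C \<Longrightarrow> g \<in> Arr C \<Longrightarrow> Fa (f \<otimes>\<^bsub>C\<^esub> g) = Fa f \<otimes>\<^bsub>D\<^esub> Fa g"
    and Fa_braid: "A \<in> Obj C \<Longrightarrow> B \<in> Obj C \<Longrightarrow> Fa (c A B) = d (Fo A) (Fo B)"

text \<open>
  The category of C-objects with extra structure: an object is a pair of a C-object and a
  structure on it, a morphism is a C-morphism satisfying \<open>mor\<close>, tagged with its structured source
  and target.  The tensor fields are data only; that they form a monoidal structure is not implied.
\<close>

definition structured_category ::
  "('o, 'a, 'm) monoidal_category_scheme \<Rightarrow> ('o \<times> 's) set \<Rightarrow>
   ('o \<times> 's \<Rightarrow> 'a \<Rightarrow> 'o \<times> 's \<Rightarrow> bool) \<Rightarrow> ('o \<times> 's \<Rightarrow> 'o \<times> 's \<Rightarrow> 'o \<times> 's) \<Rightarrow> 'o \<times> 's \<Rightarrow>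
   ('o \<times> 's, ('o \<times> 's) \<times> 'a \<times> ('o \<times> 's)) monoidal_category"
  where "structured_category C S mor tens unt = \<lparr>
    Obj = S,
    Arr = {(X, f, Y). X \<in> S \<and> Y \<in> S \<and> f \<in> hom\<^bsub>C\<^esub> (fst X) (fst Y) \<and> mor X f Y},
    Dom = (\<lambda>(X, f, Y). X),
    Cod = (\<lambda>(X, f, Y). Y),
    Ident = (\<lambda>X. (X, Id\<^bsub>C\<^esub> (fst X), X)),
    Comp = (\<lambda>(Y', g, Z) (X, f, Y). (X, g \<cdot>\<^bsub>C\<^esub> f, Z)),
    TensorO = tens,
    TensorA = (\<lambda>(X, f, Y) (X', f', Y'). (tens X X', f \<otimes>\<^bsub>C\<^esub> f', tens Y Y')),
    UnitO = unt \<rparr>"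

text \<open>
  Composition \<open>\<cdot>\<close> binds weaker than both tensor products; all of them associate to the right.
  The constants below receive as arguments exactly those fixed parameters they depend on.
\<close>

context
  fixes C :: "('o, 'a, 'm) monoidal_category_scheme" (structure)
    and c :: "'o \<Rightarrow> 'o \<Rightarrow> 'a"
    and H :: 'o and \<mu> \<nu> \<Delta> \<epsilon> :: 'a
begin

definition braiding_for_object :: "'o \<Rightarrow> 'a \<Rightarrow> bool"
  where "braiding_for_object V \<sigma> \<longleftrightarrow>
    \<sigma> \<in> hom (V \<otimes>\<^sub>o V) (V \<otimes>\<^sub>o V) \<and>
    (\<sigma> \<otimes> Id V) \<cdot> (Id V \<otimes> \<sigma>) \<cdot> (\<sigma> \<otimes> Id V) = (Id V \<otimes> \<sigma>) \<cdot> (\<sigma> \<otimes> Id V) \<cdot> (Id V \<otimes> \<sigma>)"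

definition unital_algebra :: bool
  where "unital_algebra \<longleftrightarrow>
    H \<in> Obj C \<and> \<mu> \<in> hom (H \<otimes>\<^sub>o H) H \<and> \<nu> \<in> hom \<one> H \<and>
    \<mu> \<cdot> (\<mu> \<otimes> Id H) = \<mu> \<cdot> (Id H \<otimes> \<mu>) \<and>
    \<mu> \<cdot> (\<nu> \<otimes> Id H) = Id H \<and>
    \<mu> \<cdot> (Id H \<otimes> \<nu>) = Id H"

definition counital_coalgebra :: bool
  where "counital_coalgebra \<longleftrightarrow>
    H \<in> Obj C \<and> \<Delta> \<in> hom H (H \<otimes>\<^sub>o H) \<and> \<epsilon> \<in> hom H \<one> \<and>
    (\<Delta> \<otimes> Id H) \<cdot> \<Delta> = (Id H \<otimes> \<Delta>) \<cdot> \<Delta> \<and>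
    (\<epsilon> \<otimes> Id H) \<cdot> \<Delta> = Id H \<and>
    (Id H \<otimes> \<epsilon>) \<cdot> \<Delta> = Id H"

definition c_sq :: 'a
  where "c_sq = Id H \<otimes> c H H \<otimes> Id H"

definition mult_HH :: 'a
  where "mult_HH = (\<mu> \<otimes> \<mu>) \<cdot> c_sq"

definition mult_op :: 'a
  where "mult_op = \<mu> \<cdot> c H H"

definition comult_op :: 'a
  where "comult_op = c H H \<cdot> \<Delta>"

definition bialgebra :: bool
  where "bialgebra \<longleftrightarrow>
    unital_algebra \<and> counital_coalgebra \<and>
    \<Delta> \<cdot> \<mu> = mult_HH \<cdot> (\<Delta> \<otimes> \<Delta>) \<and>
    \<Delta> \<cdot> \<nu> = \<nu> \<otimes> \<nu> \<and>
    \<epsilon> \<cdot> \<mu> = \<epsilon> \<otimes> \<epsilon> \<and>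
    \<epsilon> \<cdot> \<nu> = Id \<one>"

definition weak_R_matrix :: "'a \<Rightarrow> bool"
  where "weak_R_matrix R \<longleftrightarrow>
    R \<in> hom \<one> (H \<otimes>\<^sub>o H) \<and>
    (\<Delta> \<otimes> Id H) \<cdot> R = (Id (H \<otimes>\<^sub>o H) \<otimes> \<mu>) \<cdot> c_sq \<cdot> (R \<otimes> R) \<and>
    (\<epsilon> \<otimes> Id H) \<cdot> R = \<nu> \<and>
    mult_HH \<cdot> (R \<otimes> \<Delta>) = mult_HH \<cdot> (comult_op \<otimes> R)"

definition strong_R_matrix :: "'a \<Rightarrow> bool"
  where "strong_R_matrix R \<longleftrightarrow>
    weak_R_matrix R \<and>
    (Id H \<otimes> \<Delta>) \<cdot> R = (mult_op \<otimes> Id (H \<otimes>\<^sub>o H)) \<cdot> c_sq \<cdot> (R \<otimes> R) \<and>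
    (Id H \<otimes> \<epsilon>) \<cdot> R = \<nu>"

definition left_module :: "'o \<Rightarrow> 'a \<Rightarrow> bool"
  where "left_module M l\<^sub>M \<longleftrightarrow>
    M \<in> Obj C \<and> l\<^sub>M \<in> hom (H \<otimes>\<^sub>o M) M \<and>
    l\<^sub>M \<cdot> (\<mu> \<otimes> Id M) = l\<^sub>M \<cdot> (Id H \<otimes> l\<^sub>M) \<and>
    l\<^sub>M \<cdot> (\<nu> \<otimes> Id M) = Id M"

definition right_comodule :: "'o \<Rightarrow> 'a \<Rightarrow> bool"
  where "right_comodule M \<delta>\<^sub>M \<longleftrightarrow>
    M \<in> Obj C \<and> \<delta>\<^sub>M \<in> hom M (M \<otimes>\<^sub>o H) \<and>
    (\<delta>\<^sub>M \<otimes> Id H) \<cdot> \<delta>\<^sub>M = (Id M \<otimes> \<Delta>) \<cdot> \<delta>\<^sub>M \<and>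
    (Id M \<otimes> \<epsilon>) \<cdot> \<delta>\<^sub>M = Id M"

definition YD_module :: "'o \<Rightarrow> 'a \<Rightarrow> 'a \<Rightarrow> bool"
  where "YD_module M l\<^sub>M \<delta>\<^sub>M \<longleftrightarrow>
    left_module M l\<^sub>M \<and> right_comodule M \<delta>\<^sub>M \<and>
    (Id M \<otimes> \<mu>) \<cdot> (\<delta>\<^sub>M \<otimes> Id H) \<cdot> c H M \<cdot> (Id H \<otimes> l\<^sub>M) \<cdot> (\<Delta> \<otimes> Id M)
      = (l\<^sub>M \<otimes> \<mu>) \<cdot> (Id H \<otimes> c H M \<otimes> Id H) \<cdot> (\<Delta> \<otimes> \<delta>\<^sub>M)"

definition module_hom :: "'a \<Rightarrow> 'a \<Rightarrow> 'a \<Rightarrow> bool"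
  where "module_hom l\<^sub>M f l\<^sub>N \<longleftrightarrow> f \<cdot> l\<^sub>M = l\<^sub>N \<cdot> (Id H \<otimes> f)"

definition comodule_hom :: "'a \<Rightarrow> 'a \<Rightarrow> 'a \<Rightarrow> bool"
  where "comodule_hom \<delta>\<^sub>M f \<delta>\<^sub>N \<longleftrightarrow> \<delta>\<^sub>N \<cdot> f = (f \<otimes> Id H) \<cdot> \<delta>\<^sub>M"

definition tensor_action :: "'o \<times> 'a \<Rightarrow> 'o \<times> 'a \<Rightarrow> 'a"
  where "tensor_action = (\<lambda>(M, l\<^sub>M) (N, l\<^sub>N).
    (l\<^sub>M \<otimes> l\<^sub>N) \<cdot> (Id H \<otimes> c H M \<otimes> Id N) \<cdot> (\<Delta> \<otimes> Id (M \<otimes>\<^sub>o N)))"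

definition tensor_coaction :: "'o \<times> 'a \<Rightarrow> 'o \<times> 'a \<Rightarrow> 'a"
  where "tensor_coaction = (\<lambda>(M, \<delta>\<^sub>M) (N, \<delta>\<^sub>N).
    (Id (M \<otimes>\<^sub>o N) \<otimes> mult_op) \<cdot> (Id M \<otimes> c H N \<otimes> Id H) \<cdot> (\<delta>\<^sub>M \<otimes> \<delta>\<^sub>N))"

definition Mod :: "('o \<times> 'a, ('o \<times> 'a) \<times> 'a \<times> ('o \<times> 'a)) monoidal_category"
  where "Mod = structured_category C
    {(M, l\<^sub>M). left_module M l\<^sub>M}
    (\<lambda>(M, l\<^sub>M) f (N, l\<^sub>N). module_hom l\<^sub>M f l\<^sub>N)
    (\<lambda>(M, l\<^sub>M) (N, l\<^sub>N). (M \<otimes>\<^sub>o N, tensor_action (M, l\<^sub>M) (N, l\<^sub>N)))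
    (\<one>, \<epsilon>)"

definition YD :: "('o \<times> 'a \<times> 'a, ('o \<times> 'a \<times> 'a) \<times> 'a \<times> ('o \<times> 'a \<times> 'a)) monoidal_category"
  where "YD = structured_category C
    {(M, l\<^sub>M, \<delta>\<^sub>M). YD_module M l\<^sub>M \<delta>\<^sub>M}
    (\<lambda>(M, l\<^sub>M, \<delta>\<^sub>M) f (N, l\<^sub>N, \<delta>\<^sub>N). module_hom l\<^sub>M f l\<^sub>N \<and> comodule_hom \<delta>\<^sub>M f \<delta>\<^sub>N)
    (\<lambda>(M, l\<^sub>M, \<delta>\<^sub>M) (N, l\<^sub>N, \<delta>\<^sub>N).
      (M \<otimes>\<^sub>o N, tensor_action (M, l\<^sub>M) (N, l\<^sub>N), tensor_coaction (M, \<delta>\<^sub>M) (N, \<delta>\<^sub>N)))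
    (\<one>, \<epsilon>, \<nu>)"

definition coaction_R :: "'a \<Rightarrow> 'o \<Rightarrow> 'a \<Rightarrow> 'a"
  where "coaction_R R M l\<^sub>M = c H M \<cdot> (Id H \<otimes> l\<^sub>M) \<cdot> (R \<otimes> Id M)"

definition braid_R :: "'a \<Rightarrow> 'o \<times> 'a \<Rightarrow> 'o \<times> 'a \<Rightarrow> 'a"
  where "braid_R R = (\<lambda>(M, l\<^sub>M) (N, l\<^sub>N).
    c M N \<cdot> (l\<^sub>M \<otimes> l\<^sub>N) \<cdot> (Id H \<otimes> c H M \<otimes> Id N) \<cdot> (R \<otimes> Id (M \<otimes>\<^sub>o N)))"

definition braid_YD :: "'o \<times> 'a \<times> 'a \<Rightarrow> 'o \<times> 'a \<times> 'a \<Rightarrow> 'a"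
  where "braid_YD = (\<lambda>(M, l\<^sub>M, \<delta>\<^sub>M) (N, l\<^sub>N, \<delta>\<^sub>N).
    (Id N \<otimes> l\<^sub>M) \<cdot> (\<delta>\<^sub>N \<otimes> Id M) \<cdot> c M N)"

text \<open>Morphisms of \<open>Mod\<close> and \<open>YD\<close> carry their source and target, so the families above are tagged.\<close>

definition braiding_Mod ::
    "'a \<Rightarrow> 'o \<times> 'a \<Rightarrow> 'o \<times> 'a \<Rightarrow> ('o \<times> 'a) \<times> 'a \<times> ('o \<times> 'a)"
  where "braiding_Mod R X Y = (X \<otimes>\<^sub>o\<^bsub>Mod\<^esub> Y, braid_R R X Y, Y \<otimes>\<^sub>o\<^bsub>Mod\<^esub> X)"

definition braiding_YD ::
    "'o \<times> 'a \<times> 'a \<Rightarrow> 'o \<times> 'a \<times> 'a \<Rightarrow> ('o \<times> 'a \<times> 'a) \<times> 'a \<times> ('o \<times> 'a \<times> 'a)"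
  where "braiding_YD X Y = (X \<otimes>\<^sub>o\<^bsub>YD\<^esub> Y, braid_YD X Y, Y \<otimes>\<^sub>o\<^bsub>YD\<^esub> X)"

definition i_obj :: "'a \<Rightarrow> 'o \<times> 'a \<Rightarrow> 'o \<times> 'a \<times> 'a"
  where "i_obj R = (\<lambda>(M, l\<^sub>M). (M, l\<^sub>M, coaction_R R M l\<^sub>M))"

definition i_arr ::
    "'a \<Rightarrow> ('o \<times> 'a) \<times> 'a \<times> ('o \<times> 'a) \<Rightarrow> ('o \<times> 'a \<times> 'a) \<times> 'a \<times> ('o \<times> 'a \<times> 'a)"
  where "i_arr R = (\<lambda>(X, f, Y). (i_obj R X, f, i_obj R Y))"

end

end

theory Submission
  imports Defs "HOL-Library.Multiset"
begin

text \<open>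
  For ordinary modules the theorem is a handful of computations with elements.  Write
  \<open>R = r \<otimes> s\<close>, \<open>\<Delta>(h) = h\<^sub>1 \<otimes> h\<^sub>2\<close> and \<open>\<delta>(m) = m\<^sub>0 \<otimes> m\<^sub>1\<close>.  The coaction defined by \<open>R\<close> is
  \<open>m \<mapsto> s m \<otimes> r\<close>.  It is coassociative because \<open>\<Delta>\<close>, applied to the first leg of \<open>R\<close>, yields two copies
  of \<open>R\<close> with their second legs multiplied, and it satisfies the Yetter-Drinfel'd condition because
  \<open>R\<close> intertwines \<open>\<Delta>\<close> and its opposite (\<open>coaR_comodule\<close>, \<open>YD_module_R\<close>).  The arrow \<open>c\<^sup>Y\<^sup>D\<close> is
  \<open>m \<otimes> n \<mapsto> n\<^sub>0 \<otimes> n\<^sub>1 m\<close>, which becomes \<open>s n \<otimes> r m\<close> for this coaction, that is \<open>c\<^sup>R\<close>; and \<open>c\<^sup>Y\<^sup>D\<close> solves the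
  Yang-Baxter equation on every Yetter-Drinfel'd module (\<open>braid_R_eq_braid_YD\<close>, \<open>braid_YD_YB\<close>).
  As the coaction is made from \<open>R\<close> and the action alone, module homomorphisms respect it, whence
  the inclusion of categories is full (\<open>module_hom_comodule_hom\<close>).

  Over a bialgebra, Yetter-Drinfel'd modules are closed under tensor products and \<open>c\<^sup>Y\<^sup>D\<close> is a braiding
  on their category (\<open>tensor_YD_module\<close>, \<open>YD_braided\<close>).  The formula for \<open>\<Delta>\<close> on the second leg of a
  strong \<open>R\<close> says that the coaction of \<open>R\<close> on \<open>M \<otimes> N\<close> is the tensor product of the coactions on \<open>M\<close>
  and \<open>N\<close> (\<open>coaR_tensor\<close>).  So the inclusion is strictly monoidal, and since it is faithful and
  carries \<open>c\<^sup>R\<close> to \<open>c\<^sup>Y\<^sup>D\<close>, the braiding axioms for \<open>c\<^sup>R\<close> follow from those for \<open>c\<^sup>Y\<^sup>D\<close>.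

  Objects of a symmetric monoidal category have no elements, so computations with elements are
  given a meaning first.  A net is a list of arrows, called boxes, that are connected by named wires;
  the names play the role of the variables of Sweedler's notation.  The net is evaluated by
  routing wires with the symmetry.  Coherence of the symmetry (\<open>wiring_trans\<close>) implies that the
  value depends only on which box feeds which and not on the order of the boxes
  (\<open>net_eq_mset\<close>), and that a part of a net may be replaced by another one with the same value
  (\<open>net_eq_inside\<close>).  Every composite of tensor products of structure maps, crossings and identities
  is the value of a net (\<open>net_eq_iff\<close>), and crossings become invisible there.  The
  identities above are then proved as on paper, one axiom at a time (\<open>net_eq_step\<close>).
\<close>

type_synonym 'o wires = "(nat \<times> 'o) list"
type_synonym ('o, 'a) box = "'a \<times> 'o wires \<times> 'o wires"

section \<open>Arrows of a strict monoidal category\<close>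

context category
begin

lemma in_hom: "f \<in> hom A B \<longleftrightarrow> f \<in> Arr C \<and> Dom C f = A \<and> Cod C f = B"
  by (auto simp: Hom_def)

lemma Id_Arr [simp]: "A \<in> Obj C \<Longrightarrow> Id A \<in> Arr C"
  and Dom_Id [simp]: "A \<in> Obj C \<Longrightarrow> Dom C (Id A) = A"
  and Cod_Id [simp]: "A \<in> Obj C \<Longrightarrow> Cod C (Id A) = A"
  using Id_hom by (auto simp: in_hom)

lemma Comp_Arr [simp]: "f \<in> Arr C \<Longrightarrow> g \<in> Arr C \<Longrightarrow> Dom C g = Cod C f \<Longrightarrow> g \<cdot> f \<in> Arr C"
  and Dom_Comp [simp]: "f \<in> Arr C \<Longrightarrow> g \<in> Arr C \<Longrightarrow> Dom C g = Cod C f \<Longrightarrow> Dom C (g \<cdot> f) = Dom C f"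
  and Cod_Comp [simp]: "f \<in> Arr C \<Longrightarrow> g \<in> Arr C \<Longrightarrow> Dom C g = Cod C f \<Longrightarrow> Cod C (g \<cdot> f) = Cod C g"
  using Comp_hom[of f "Dom C f" "Cod C f" g "Cod C g"] by (auto simp: in_hom)

lemma comp_assoc:
  "f \<in> Arr C \<Longrightarrow> g \<in> Arr C \<Longrightarrow> h \<in> Arr C \<Longrightarrow> Dom C g = Cod C f \<Longrightarrow> Dom C h = Cod C g \<Longrightarrow>
    (h \<cdot> g) \<cdot> f = h \<cdot> (g \<cdot> f)"
  using Comp_assoc[of f "Dom C f" "Cod C f" g "Cod C g" h "Cod C h"] by (auto simp: in_hom)

lemma comp_Id [simp]: "f \<in> Arr C \<Longrightarrow> Dom C f = A \<Longrightarrow> f \<cdot> Id A = f"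
  and Id_comp [simp]: "f \<in> Arr C \<Longrightarrow> Cod C f = A \<Longrightarrow> Id A \<cdot> f = f"
  using Comp_Id[of f A "Cod C f"] Id_Comp[of f "Dom C f" A] by (auto simp: in_hom)

end

context strict_monoidal_category
begin

declare UnitO_Obj [simp] TensorO_Obj [simp] UnitO_left [simp] UnitO_right [simp]
  UnitA_left [simp] UnitA_right [simp] Dom_Obj [simp] Cod_Obj [simp]
  TensorO_assoc [simp] TensorA_assoc [simp]

lemma TensorA_Arr [simp]: "f \<in> Arr C \<Longrightarrow> g \<in> Arr C \<Longrightarrow> f \<otimes> g \<in> Arr C"
  and Dom_TensorA [simp]: "f \<in> Arr C \<Longrightarrow> g \<in> Arr C \<Longrightarrow> Dom C (f \<otimes> g) = Dom C f \<otimes>\<^sub>o Dom C g"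
  and Cod_TensorA [simp]: "f \<in> Arr C \<Longrightarrow> g \<in> Arr C \<Longrightarrow> Cod C (f \<otimes> g) = Cod C f \<otimes>\<^sub>o Cod C g"
  using TensorA_hom[of f "Dom C f" "Cod C f" g "Dom C g" "Cod C g"] by (auto simp: in_hom)

lemma interchange:
  "f \<in> Arr C \<Longrightarrow> g \<in> Arr C \<Longrightarrow> f' \<in> Arr C \<Longrightarrow> g' \<in> Arr C \<Longrightarrow>
    Dom C g = Cod C f \<Longrightarrow> Dom C g' = Cod C f' \<Longrightarrow>
    (g \<otimes> g') \<cdot> (f \<otimes> f') = (g \<cdot> f) \<otimes> (g' \<cdot> f')"
  using TensorA_Comp[of f "Dom C f" "Cod C f" g "Cod C g" f' "Dom C f'" "Cod C f'" g' "Cod C g'"]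
  by (auto simp: in_hom)

lemma interchange':
  "f \<in> Arr C \<Longrightarrow> g \<in> Arr C \<Longrightarrow> f' \<in> Arr C \<Longrightarrow> g' \<in> Arr C \<Longrightarrow> k \<in> Arr C \<Longrightarrow>
    Dom C g = Cod C f \<Longrightarrow> Dom C g' = Cod C f' \<Longrightarrow> Cod C k = Dom C f \<otimes>\<^sub>o Dom C f' \<Longrightarrow>
    (g \<otimes> g') \<cdot> ((f \<otimes> f') \<cdot> k) = ((g \<cdot> f) \<otimes> (g' \<cdot> f')) \<cdot> k"
  by (subst comp_assoc[symmetric]) (simp_all add: interchange)

end

context symmetric_category
begin

lemma braid_Arr [simp]: "A \<in> Obj C \<Longrightarrow> B \<in> Obj C \<Longrightarrow> c A B \<in> Arr C"
  and Dom_braid [simp]: "A \<in> Obj C \<Longrightarrow> B \<in> Obj C \<Longrightarrow> Dom C (c A B) = A \<otimes>\<^sub>o B"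
  and Cod_braid [simp]: "A \<in> Obj C \<Longrightarrow> B \<in> Obj C \<Longrightarrow> Cod C (c A B) = B \<otimes>\<^sub>o A"
  using braid_hom[of A B] by (auto simp: in_hom)

declare braid_symmetric [simp]

lemma braid_nat:
  "f \<in> Arr C \<Longrightarrow> g \<in> Arr C \<Longrightarrow> A = Cod C f \<Longrightarrow> B = Cod C g \<Longrightarrow>
    c A B \<cdot> (f \<otimes> g) = (g \<otimes> f) \<cdot> c (Dom C f) (Dom C g)"
  using braid_natural[of f "Dom C f" "Cod C f" g "Dom C g" "Cod C g"] by (auto simp: in_hom)

text \<open>
  The hexagon at \<open>\<one> \<otimes>\<^sub>o \<one> = \<one>\<close> makes \<open>c V \<one>\<close> idempotent, and an invertible idempotent is an identity.
\<close>
lemma braid_unit_right [simp]: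
  assumes V: "V \<in> Obj C"
  shows "c V \<one> = Id V"
proof -
  have idem: "c V \<one> = c V \<one> \<cdot> c V \<one>"
    using braid_tensor_right[of V "\<one>" "\<one>"] V by simp
  have "Id V = c \<one> V \<cdot> c V \<one>"
    using braid_symmetric[of "\<one>" V] V by simp
  also have "\<dots> = c \<one> V \<cdot> (c V \<one> \<cdot> c V \<one>)"
    using idem by simp
  also have "\<dots> = (c \<one> V \<cdot> c V \<one>) \<cdot> c V \<one>"
    using V by (simp add: comp_assoc del: braid_symmetric)
  also have "\<dots> = c V \<one>"
    using V by simp
  finally show ?thesis by simp
qed

lemma braid_unit_left [simp]:
  assumes V: "V \<in> Obj C"
  shows "c \<one> V = Id V"
  using braid_symmetric[of "\<one>" V] V by simp

section \<open>Permuting wires by the symmetry\<close>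

text \<open>
  A wire is an object with a number; the numbers distinguish wires that carry the same object.
  The value of \<open>tens\<close> on a single wire avoids a trailing unit object, so that it agrees with the tensor
  products written in the definitions without any rewriting.
\<close>
primrec tens :: "'o wires \<Rightarrow> 'o" where
  "tens [] = \<one>"
| "tens (w # ws) = (if ws = [] then snd w else snd w \<otimes>\<^sub>o tens ws)"

abbreviation objs :: "'o wires \<Rightarrow> bool" where
  "objs ws \<equiv> \<forall>w\<in>set ws. snd w \<in> Obj C"

lemma objs_diff [simp]: "\<forall>w\<in>A. snd w \<in> Obj C \<Longrightarrow> \<forall>w\<in>A - B. snd w \<in> Obj C"
  by blast

lemma tens_Obj [simp]: "objs ws \<Longrightarrow> tens ws \<in> Obj C"
  by (induction ws) auto

lemma tens_Cons: "objs (w # ws) \<Longrightarrow> tens (w # ws) = snd w \<otimes>\<^sub>o tens ws"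
  by auto

lemma tens_append: "objs ws \<Longrightarrow> objs vs \<Longrightarrow> tens (ws @ vs) = tens ws \<otimes>\<^sub>o tens vs"
proof (induction ws)
  case (Cons w ws)
  then have "objs (w # (ws @ vs))" by auto
  with Cons show ?case by (simp del: tens.simps(2) add: tens_Cons)
qed simp

lemma Id_tens_Cons: "objs (w # ws) \<Longrightarrow> Id (tens (w # ws)) = Id (snd w) \<otimes> Id (tens ws)"
  by (simp del: tens.simps(2) add: tens_Cons TensorA_Id)

lemma Id_tens_append: "objs ws \<Longrightarrow> objs vs \<Longrightarrow> Id (tens (ws @ vs)) = Id (tens ws) \<otimes> Id (tens vs)"
  by (simp add: tens_append TensorA_Id)

text \<open>
  The arrow that pulls one wire to the front, crossing the wires before it one at a time.  The
  arrow realizing an arbitrary rearrangement is built from it by sorting the target order from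
  the left; that this arrow depends only on the two orders is coherence for the symmetry.
\<close>
primrec bring :: "nat \<times> 'o \<Rightarrow> 'o wires \<Rightarrow> 'a" where
  "bring w [] = Id \<one>"
| "bring w (v # ws) = (if v = w then Id (tens (v # ws))
     else (c (snd v) (snd w) \<otimes> Id (tens (removeAll w ws))) \<cdot> (Id (snd v) \<otimes> bring w ws))"

primrec wiring :: "'o wires \<Rightarrow> 'o wires \<Rightarrow> 'a" where
  "wiring ws [] = Id \<one>"
| "wiring ws (w # vs) = (Id (snd w) \<otimes> wiring (removeAll w ws) vs) \<cdot> bring w ws"

declare tens.simps(2) [simp del]

lemma bring_typed:
  assumes "w \<in> set ws" "distinct ws" "objs ws"
  shows "bring w ws \<in> Arr C \<and> Dom C (bring w ws) = tens ws
    \<and> Cod C (bring w ws) = snd w \<otimes>\<^sub>o tens (removeAll w ws)"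
  using assms
proof (induction ws)
  case (Cons v ws)
  show ?case
  proof (cases "v = w")
    case True
    with Cons.prems show ?thesis by (simp add: tens_Cons)
  next
    case False
    with Cons.prems have "snd w \<in> Obj C" by auto
    with False Cons show ?thesis by (simp add: tens_Cons)
  qed
qed simp

lemmas bring_Arr [simp] = bring_typed[THEN conjunct1]
lemmas Dom_bring [simp] = bring_typed[THEN conjunct2, THEN conjunct1]
lemmas Cod_bring [simp] = bring_typed[THEN conjunct2, THEN conjunct2]

lemma slide:
  "f \<in> Arr C \<Longrightarrow> g \<in> Arr C \<Longrightarrow> Dom C f = A \<Longrightarrow> Cod C f = A' \<Longrightarrow> Dom C g = B \<Longrightarrow> Cod C g = B' \<Longrightarrow>
   (Id A' \<otimes> g) \<cdot> (f \<otimes> Id B) = (f \<otimes> Id B') \<cdot> (Id A \<otimes> g)"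
  by (auto simp: interchange)

lemma removeAll_commute: "removeAll x (removeAll y zs) = removeAll y (removeAll x zs)"
  by (induction zs) auto

text \<open>
  Naturality of the symmetry with respect to the symmetry itself, read through the hexagon.
\<close>
lemma braid_YB:
  assumes "U \<in> Obj C" "V \<in> Obj C" "W \<in> Obj C"
  shows "(c V W \<otimes> Id U) \<cdot> ((Id V \<otimes> c U W) \<cdot> (c U V \<otimes> Id W))
    = (Id W \<otimes> c U V) \<cdot> ((c U W \<otimes> Id V) \<cdot> (Id U \<otimes> c V W))"
proof -
  have "(Id W \<otimes> c U V) \<cdot> ((c U W \<otimes> Id V) \<cdot> (Id U \<otimes> c V W))
     = c U (W \<otimes>\<^sub>o V) \<cdot> (Id U \<otimes> c V W)"
    using assms by (simp add: braid_tensor_right comp_assoc)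
  also have "\<dots> = (c V W \<otimes> Id U) \<cdot> c U (V \<otimes>\<^sub>o W)"
    using assms by (simp add: braid_nat)
  also have "\<dots> = (c V W \<otimes> Id U) \<cdot> ((Id V \<otimes> c U W) \<cdot> (c U V \<otimes> Id W))"
    using assms by (simp add: braid_tensor_right comp_assoc)
  finally show ?thesis by simp
qed

lemma tensor_IdR:
  "f \<in> Arr C \<Longrightarrow> g \<in> Arr C \<Longrightarrow> Dom C g = Cod C f \<Longrightarrow> A \<in> Obj C \<Longrightarrow> (g \<cdot> f) \<otimes> Id A = (g \<otimes> Id A) \<cdot> (f \<otimes> Id A)"
  by (simp add: interchange)

lemma tensor_IdL:
  "f \<in> Arr C \<Longrightarrow> g \<in> Arr C \<Longrightarrow> Dom C g = Cod C f \<Longrightarrow> A \<in> Obj C \<Longrightarrow> Id A \<otimes> (g \<cdot> f) = (Id A \<otimes> g) \<cdot> (Id A \<otimes> f)"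
  by (simp add: interchange)

text \<open>
  The core of coherence: pulling \<open>v\<close> and then \<open>w\<close> to the front, and exchanging the two, is the same
  as pulling \<open>w\<close> and then \<open>v\<close>.  If the list starts with a third wire \<open>u\<close>, all three cross each other
  and the Yang-Baxter equation for the symmetry reduces the claim to the tail; if it starts with
  \<open>w\<close>, two crossings of \<open>v\<close> and \<open>w\<close> cancel, which is where symmetry rather than a mere braiding is used.
\<close>
lemma bring_bring:
  assumes "v \<noteq> w" "v \<in> set a" "w \<in> set a" "distinct a" "objs a"
  shows "(c (snd v) (snd w) \<otimes> Id (tens (removeAll w (removeAll v a)))) \<cdot>
      ((Id (snd v) \<otimes> bring w (removeAll v a)) \<cdot> bring v a)
    = (Id (snd w) \<otimes> bring v (removeAll w a)) \<cdot> bring w a"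
  using assms
proof (induction a)
  case (Cons u a)
  have obj: "snd u \<in> Obj C" "snd v \<in> Obj C" "snd w \<in> Obj C" using Cons.prems by auto
  consider "u = v" | "u = w" | "u \<noteq> v" "u \<noteq> w" by blast
  then show ?case
  proof cases
    case 1
    then show ?thesis using Cons.prems obj by (simp add: tens_Cons TensorA_Id)
  next
    case 2
    have "(c (snd v) (snd w) \<otimes> Id (tens (removeAll v a))) \<cdot> ((c (snd w) (snd v) \<otimes> Id (tens (removeAll v a))) \<cdot> (Id (snd w) \<otimes> bring v a))
      = Id (snd w) \<otimes> bring v a"
      using Cons.prems 2 obj by (subst interchange') (simp_all add: TensorA_Id)
    then show ?thesis using 2 Cons.prems obj by (simp add: tens_Cons TensorA_Id)
  next
    case 3
    let ?U = "snd u" and ?V = "snd v" and ?W = "snd w"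
    let ?t = "tens (removeAll w (removeAll v a))"
    let ?F = "bring w (removeAll v a)" and ?G = "bring v (removeAll w a)"
    have [simp]: "removeAll v (removeAll w a) = removeAll w (removeAll v a)" by (rule removeAll_commute)
    have mem: "v \<in> set a" "w \<in> set a" "distinct a" "objs a" using 3 Cons.prems by auto
    have F: "?F \<in> Arr C" "Dom C ?F = tens (removeAll v a)" "Cod C ?F = ?W \<otimes>\<^sub>o ?t"
      using bring_typed[of w "removeAll v a"] mem Cons.prems(1) by (auto simp: distinct_removeAll)
    have G: "?G \<in> Arr C" "Dom C ?G = tens (removeAll w a)" "Cod C ?G = ?V \<otimes>\<^sub>o ?t"
      using bring_typed[of v "removeAll w a"] mem Cons.prems(1) by (auto simp: distinct_removeAll)
    have IH: "(c ?V ?W \<otimes> Id ?t) \<cdot> ((Id ?V \<otimes> ?F) \<cdot> bring v a) = (Id ?W \<otimes> ?G) \<cdot> bring w a"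
      using Cons.IH Cons.prems(1) mem by blast
    have yb: "(c ?V ?W \<otimes> Id ?U \<otimes> Id ?t) \<cdot> ((Id ?V \<otimes> c ?U ?W \<otimes> Id ?t) \<cdot> (c ?U ?V \<otimes> Id ?W \<otimes> Id ?t))
      = (Id ?W \<otimes> c ?U ?V \<otimes> Id ?t) \<cdot> ((c ?U ?W \<otimes> Id ?V \<otimes> Id ?t) \<cdot> (Id ?U \<otimes> c ?V ?W \<otimes> Id ?t))"
      using arg_cong[OF braid_YB[of ?U ?V ?W], of "\<lambda>x. x \<otimes> Id ?t"] obj mem
      by (simp add: tensor_IdR)
    have sF: "(Id ?V \<otimes> Id ?U \<otimes> ?F) \<cdot> (c ?U ?V \<otimes> Id (tens (removeAll v a)))
        = (c ?U ?V \<otimes> Id ?W \<otimes> Id ?t) \<cdot> (Id ?U \<otimes> Id ?V \<otimes> ?F)"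
      using slide[of "c ?U ?V" ?F "?U \<otimes>\<^sub>o ?V" "?V \<otimes>\<^sub>o ?U" "tens (removeAll v a)" "?W \<otimes>\<^sub>o ?t"] obj mem F G
      by (simp add: TensorA_Id[symmetric])
    have sG: "(Id ?W \<otimes> Id ?U \<otimes> ?G) \<cdot> (c ?U ?W \<otimes> Id (tens (removeAll w a)))
        = (c ?U ?W \<otimes> Id ?V \<otimes> Id ?t) \<cdot> (Id ?U \<otimes> Id ?W \<otimes> ?G)"
      using slide[of "c ?U ?W" ?G "?U \<otimes>\<^sub>o ?W" "?W \<otimes>\<^sub>o ?U" "tens (removeAll w a)" "?V \<otimes>\<^sub>o ?t"] obj mem F G
      by (simp add: TensorA_Id[symmetric])
    have "(c ?V ?W \<otimes> Id (tens (removeAll w (removeAll v (u # a))))) \<cdot>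
        ((Id ?V \<otimes> bring w (removeAll v (u # a))) \<cdot> bring v (u # a))
      = (c ?V ?W \<otimes> Id ?U \<otimes> Id ?t) \<cdot> ((Id ?V \<otimes> c ?U ?W \<otimes> Id ?t) \<cdot>
         (((Id ?V \<otimes> Id ?U \<otimes> ?F) \<cdot> (c ?U ?V \<otimes> Id (tens (removeAll v a)))) \<cdot> (Id ?U \<otimes> bring v a)))"
      using 3 obj mem F G Cons.prems(1)
      by (simp add: tens_Cons Id_tens_Cons TensorA_Id[symmetric] tensor_IdL comp_assoc)
    also have "\<dots> = ((c ?V ?W \<otimes> Id ?U \<otimes> Id ?t) \<cdot> ((Id ?V \<otimes> c ?U ?W \<otimes> Id ?t) \<cdot> (c ?U ?V \<otimes> Id ?W \<otimes> Id ?t)))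
        \<cdot> ((Id ?U \<otimes> Id ?V \<otimes> ?F) \<cdot> (Id ?U \<otimes> bring v a))"
      unfolding sF using obj mem F G Cons.prems(1) by (simp add: comp_assoc)
    also have "\<dots> = (Id ?W \<otimes> c ?U ?V \<otimes> Id ?t) \<cdot> ((c ?U ?W \<otimes> Id ?V \<otimes> Id ?t) \<cdot>
        (Id ?U \<otimes> ((c ?V ?W \<otimes> Id ?t) \<cdot> ((Id ?V \<otimes> ?F) \<cdot> bring v a))))"
      unfolding yb using obj mem F G Cons.prems(1) by (simp add: comp_assoc tensor_IdL)
    also have "\<dots> = (Id ?W \<otimes> c ?U ?V \<otimes> Id ?t) \<cdot> (((c ?U ?W \<otimes> Id ?V \<otimes> Id ?t) \<cdot> (Id ?U \<otimes> Id ?W \<otimes> ?G))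
        \<cdot> (Id ?U \<otimes> bring w a))"
      unfolding IH using obj mem F G Cons.prems(1) by (simp add: comp_assoc tensor_IdL)
    also have "\<dots> = (Id ?W \<otimes> bring v (removeAll w (u # a))) \<cdot> bring w (u # a)"
      unfolding sG[symmetric] using 3 obj mem F G Cons.prems(1)
      by (simp add: tens_Cons Id_tens_Cons TensorA_Id[symmetric] tensor_IdL comp_assoc)
    finally show ?thesis .
  qed
qed simp

declare ball_Un [simp]

lemma wiring_typed:
  assumes "distinct ws" "distinct vs" "set ws = set vs" "objs ws"
  shows "wiring ws vs \<in> Arr C \<and> Dom C (wiring ws vs) = tens ws \<and> Cod C (wiring ws vs) = tens vs"
  using assms
proof (induction vs arbitrary: ws)
  case (Cons v vs)
  have r: "distinct (removeAll v ws)" "set (removeAll v ws) = set vs" "objs (removeAll v ws)"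
    using Cons.prems by (auto simp: distinct_removeAll)
  have v: "v \<in> set ws" "snd v \<in> Obj C" "objs vs" using Cons.prems by auto
  show ?case
    using Cons.IH[OF r(1) _ r(2,3)] Cons.prems(1,2,4) bring_typed[OF v(1) Cons.prems(1) Cons.prems(4)] v by (simp add: tens_Cons)
qed simp

lemma wiring_hom:
  assumes "distinct ws" "distinct vs" "set ws = set vs" "objs ws"
  shows "wiring ws vs \<in> Arr C" "Dom C (wiring ws vs) = tens ws" "Cod C (wiring ws vs) = tens vs"
  using wiring_typed[OF assms] by auto

lemma wiring_refl:
  "distinct ws \<Longrightarrow> objs ws \<Longrightarrow> wiring ws ws = Id (tens ws)"
  by (induction ws) (simp_all add: tens_Cons TensorA_Id)

text \<open>
  Pulling a wire to the front after a rearrangement is pulling it to the front first and then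
  rearranging the others: \<open>bring_bring\<close> iterated over the target order.
\<close>
lemma bring_wiring:
  assumes "distinct a" "distinct b" "set a = set b" "objs a" "w \<in> set b"
  shows "bring w b \<cdot> wiring a b = (Id (snd w) \<otimes> wiring (removeAll w a) (removeAll w b)) \<cdot> bring w a"
  using assms
proof (induction b arbitrary: a)
  case (Cons v b)
  have v: "v \<in> set a" "w \<in> set a" "snd v \<in> Obj C" "snd w \<in> Obj C" "objs b" using Cons.prems by auto
  show ?case
  proof (cases "v = w")
    case True
    let ?B = "bring v a" and ?W = "wiring (removeAll v a) b"
    have B: "?B \<in> Arr C" "Dom C ?B = tens a" "Cod C ?B = snd v \<otimes>\<^sub>o tens (removeAll v a)"
      using bring_typed v Cons.prems by auto
    have W: "?W \<in> Arr C" "Dom C ?W = tens (removeAll v a)" "Cod C ?W = tens b"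
      using wiring_hom[of "removeAll v a" b] v Cons.prems by (auto simp: distinct_removeAll)
    show ?thesis using True v B W Cons.prems by (simp add: tens_Cons)
  next
    case False
    let ?V = "snd v" and ?W = "snd w"
    let ?av = "removeAll v a" and ?aw = "removeAll w a" and ?b' = "removeAll w b"
    let ?avw = "removeAll w (removeAll v a)"
    have comm: "removeAll v (removeAll w a) = ?avw" by (rule removeAll_commute)
    have IH: "bring w b \<cdot> wiring ?av b = (Id ?W \<otimes> wiring ?avw ?b') \<cdot> bring w ?av"
      using Cons.IH[of ?av] Cons.prems v False by (auto simp: distinct_removeAll)
    have t1: "bring v a \<in> Arr C" "Dom C (bring v a) = tens a" "Cod C (bring v a) = ?V \<otimes>\<^sub>o tens ?av"
      using bring_typed v Cons.prems by auto
    have t2: "bring w ?av \<in> Arr C" "Dom C (bring w ?av) = tens ?av" "Cod C (bring w ?av) = ?W \<otimes>\<^sub>o tens ?avw"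
      using bring_typed[of w ?av] v Cons.prems False by (auto simp: distinct_removeAll)
    have t3: "wiring ?av b \<in> Arr C" "Dom C (wiring ?av b) = tens ?av" "Cod C (wiring ?av b) = tens b"
      using wiring_hom[of ?av b] v Cons.prems by (auto simp: distinct_removeAll)
    have t4: "wiring ?avw ?b' \<in> Arr C" "Dom C (wiring ?avw ?b') = tens ?avw" "Cod C (wiring ?avw ?b') = tens ?b'"
      using wiring_hom[of ?avw ?b'] v Cons.prems by (auto simp: distinct_removeAll)
    have t5: "bring w b \<in> Arr C" "Dom C (bring w b) = tens b" "Cod C (bring w b) = ?W \<otimes>\<^sub>o tens ?b'"
      using bring_typed[of w b] v Cons.prems False by auto
    have t6: "bring w a \<in> Arr C" "Dom C (bring w a) = tens a" "Cod C (bring w a) = ?W \<otimes>\<^sub>o tens ?aw"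
      using bring_typed v Cons.prems by auto
    have t7: "bring v ?aw \<in> Arr C" "Dom C (bring v ?aw) = tens ?aw" "Cod C (bring v ?aw) = ?V \<otimes>\<^sub>o tens ?avw"
    proof -
      have "v \<in> set ?aw" "distinct ?aw" "objs ?aw" using v Cons.prems False by (auto simp: distinct_removeAll)
      from bring_typed[OF this] show "bring v ?aw \<in> Arr C" "Dom C (bring v ?aw) = tens ?aw" "Cod C (bring v ?aw) = ?V \<otimes>\<^sub>o tens ?avw"
        unfolding comm by blast+
    qed
    note t = t1 t2 t3 t4 t5 t6 t7
    have ob: "tens ?avw \<in> Obj C" "tens ?b' \<in> Obj C" using v Cons.prems by auto
    have sl: "(c ?V ?W \<otimes> Id (tens ?b')) \<cdot> (Id ?V \<otimes> Id ?W \<otimes> wiring ?avw ?b')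
      = (Id ?W \<otimes> Id ?V \<otimes> wiring ?avw ?b') \<cdot> (c ?V ?W \<otimes> Id (tens ?avw))"
      using slide[of "c ?V ?W" "wiring ?avw ?b'" "?V \<otimes>\<^sub>o ?W" "?W \<otimes>\<^sub>o ?V" "tens ?avw" "tens ?b'"] v t
      by (simp add: TensorA_Id[symmetric])
    have "bring w (v # b) \<cdot> wiring a (v # b)
      = (c ?V ?W \<otimes> Id (tens ?b')) \<cdot> ((Id ?V \<otimes> (bring w b \<cdot> wiring ?av b)) \<cdot> bring v a)"
      using False v t ob by (simp add: comp_assoc tensor_IdL)
    also have "\<dots> = ((c ?V ?W \<otimes> Id (tens ?b')) \<cdot> (Id ?V \<otimes> Id ?W \<otimes> wiring ?avw ?b')) \<cdot>
        ((Id ?V \<otimes> bring w ?av) \<cdot> bring v a)"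
      unfolding IH using v t ob by (simp add: comp_assoc tensor_IdL)
    also have "\<dots> = (Id ?W \<otimes> Id ?V \<otimes> wiring ?avw ?b') \<cdot>
        ((c ?V ?W \<otimes> Id (tens ?avw)) \<cdot> ((Id ?V \<otimes> bring w ?av) \<cdot> bring v a))"
      unfolding sl using v t ob by (simp add: comp_assoc)
    also have "\<dots> = (Id ?W \<otimes> Id ?V \<otimes> wiring ?avw ?b') \<cdot> ((Id ?W \<otimes> bring v ?aw) \<cdot> bring w a)"
      using bring_bring[of v w a] False v Cons.prems by simp
    also have "\<dots> = (Id ?W \<otimes> wiring ?aw (removeAll w (v # b))) \<cdot> bring w a"
      using False v t ob by (simp add: comp_assoc tensor_IdL comm)
    finally show ?thesis .
  qed
qed simp

text \<open>
  Coherence: rearrangements compose, so a composite depends only on the first and the last order.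
\<close>
lemma wiring_trans:
  assumes "distinct a" "distinct b" "distinct d" "set a = set b" "set b = set d" "objs a"
  shows "wiring b d \<cdot> wiring a b = wiring a d"
  using assms
proof (induction d arbitrary: a b)
  case (Cons w d)
  have w: "w \<in> set a" "w \<in> set b" "snd w \<in> Obj C" "objs b" "objs d" using Cons.prems by auto
  let ?a = "removeAll w a" and ?b = "removeAll w b"
  have IH: "wiring ?b d \<cdot> wiring ?a ?b = wiring ?a d"
    using Cons.IH[of ?a ?b] Cons.prems by (auto simp: distinct_removeAll)
  have t1: "bring w b \<in> Arr C" "Dom C (bring w b) = tens b" "Cod C (bring w b) = snd w \<otimes>\<^sub>o tens ?b"
    using bring_typed w Cons.prems by auto
  have t2: "bring w a \<in> Arr C" "Dom C (bring w a) = tens a" "Cod C (bring w a) = snd w \<otimes>\<^sub>o tens ?a"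
    using bring_typed w Cons.prems by auto
  have t3: "wiring a b \<in> Arr C" "Dom C (wiring a b) = tens a" "Cod C (wiring a b) = tens b"
    using wiring_hom[of a b] Cons.prems by auto
  have t4: "wiring ?a ?b \<in> Arr C" "Dom C (wiring ?a ?b) = tens ?a" "Cod C (wiring ?a ?b) = tens ?b"
    using wiring_hom[of ?a ?b] Cons.prems by (auto simp: distinct_removeAll)
  have t5: "wiring ?b d \<in> Arr C" "Dom C (wiring ?b d) = tens ?b" "Cod C (wiring ?b d) = tens d"
    using wiring_hom[of ?b d] Cons.prems w by (auto simp: distinct_removeAll)
  note t = t1 t2 t3 t4 t5
  have "wiring b (w # d) \<cdot> wiring a b = (Id (snd w) \<otimes> wiring ?b d) \<cdot> (bring w b \<cdot> wiring a b)"
    using w t by (simp add: comp_assoc)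
  also have "\<dots> = (Id (snd w) \<otimes> (wiring ?b d \<cdot> wiring ?a ?b)) \<cdot> bring w a"
    using bring_wiring[of a b w] w t Cons.prems by (simp add: comp_assoc tensor_IdL)
  finally show ?case using IH by simp
qed simp

lemma bring_append:
  assumes "w \<in> set a" "distinct a" "objs (a @ r)" "set a \<inter> set r = {}"
  shows "bring w (a @ r) = bring w a \<otimes> Id (tens r)"
  using assms
proof (induction a)
  case (Cons v a)
  then have o: "snd v \<in> Obj C" "snd w \<in> Obj C" "objs a" "objs r" "objs (a @ r)" "objs (removeAll w a)" by auto
  show ?case
  proof (cases "v = w")
    case True
    then show ?thesis using Cons.prems o by (simp add: tens_Cons tens_append TensorA_Id[symmetric])
  next
    case False
    have wr: "w \<notin> set r" using Cons.prems by auto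
    have t: "bring w a \<in> Arr C" "Dom C (bring w a) = tens a" "Cod C (bring w a) = snd w \<otimes>\<^sub>o tens (removeAll w a)"
      using bring_typed[of w a] Cons.prems o False by auto
    show ?thesis using Cons False o t wr
      by (simp add: tens_append TensorA_Id[symmetric] tensor_IdR)
  qed
qed simp

lemma removeAll_outside: "w \<notin> set r \<Longrightarrow> removeAll w (a @ r) = removeAll w a @ r"
  by simp

lemma wiring_append:
  assumes "distinct a" "distinct b" "set a = set b" "objs a"
    and "distinct a'" "distinct b'" "set a' = set b'" "objs a'" "set a \<inter> set a' = {}"
  shows "wiring (a @ a') (b @ b') = wiring a b \<otimes> wiring a' b'"
  using assms
proof (induction b arbitrary: a)
  case Nil
  then show ?case using wiring_hom[of a' b'] by simp
next
  case (Cons w b)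
  let ?a = "removeAll w a"
  have w: "w \<in> set a" "snd w \<in> Obj C" "objs b" "w \<notin> set a'" "objs b'" using Cons.prems by auto
  have t1: "bring w a \<in> Arr C" "Dom C (bring w a) = tens a" "Cod C (bring w a) = snd w \<otimes>\<^sub>o tens ?a"
    using bring_typed w Cons.prems by auto
  have t2: "wiring ?a b \<in> Arr C" "Dom C (wiring ?a b) = tens ?a" "Cod C (wiring ?a b) = tens b"
    using wiring_hom[of ?a b] Cons.prems by (auto simp: distinct_removeAll)
  have t3: "wiring a' b' \<in> Arr C" "Dom C (wiring a' b') = tens a'" "Cod C (wiring a' b') = tens b'"
    using wiring_hom[of a' b'] Cons.prems by auto
  have "wiring (?a @ a') (b @ b') = wiring ?a b \<otimes> wiring a' b'"
    using Cons.prems by (intro Cons.IH) (auto simp: distinct_removeAll)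
  then have "wiring (a @ a') (w # b @ b')
    = (Id (snd w) \<otimes> wiring ?a b \<otimes> wiring a' b') \<cdot> (bring w a \<otimes> Id (tens a'))"
    using bring_append[of w a a'] w Cons.prems by (auto simp: removeAll_outside)
  also have "\<dots> = ((Id (snd w) \<otimes> wiring ?a b) \<otimes> wiring a' b') \<cdot> (bring w a \<otimes> Id (tens a'))"
    using w t1 t2 t3 by simp
  also have "\<dots> = wiring a (w # b) \<otimes> wiring a' b'"
    using w t1 t2 t3 Cons.prems by (subst interchange) auto
  finally show ?case by simp
qed

lemma bring_past:
  assumes "w \<notin> set a" "w \<notin> set b" "distinct b" "objs (a @ w # b)"
  shows "bring w (a @ w # b) = c (tens a) (snd w) \<otimes> Id (tens b)"
  using assms
proof (induction a)
  case Nil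
  then show ?case by (simp add: tens_Cons TensorA_Id)
next
  case (Cons v a)
  have o: "snd v \<in> Obj C" "snd w \<in> Obj C" "objs a" "objs b" "v \<noteq> w" using Cons.prems by auto
  have "bring w ((v # a) @ w # b) = (c (snd v) (snd w) \<otimes> Id (tens a) \<otimes> Id (tens b)) \<cdot>
      (Id (snd v) \<otimes> c (tens a) (snd w) \<otimes> Id (tens b))"
    using Cons o by (simp add: Id_tens_append)
  also have "\<dots> = c (tens (v # a)) (snd w) \<otimes> Id (tens b)"
    using o by (simp add: tens_Cons braid_tensor_left tensor_IdR)
  finally show ?case .
qed

lemma wiring_braid:
  assumes "distinct (a @ b)" "objs (a @ b)"
  shows "wiring (a @ b) (b @ a) = c (tens a) (tens b)"
  using assms
proof (induction b)
  case Nil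
  then show ?case by (simp add: wiring_refl)
next
  case (Cons w b)
  have w: "snd w \<in> Obj C" "objs a" "objs b" "w \<notin> set a" "w \<notin> set b" using Cons.prems by auto
  have "wiring (a @ w # b) (w # b @ a) = (Id (snd w) \<otimes> c (tens a) (tens b)) \<cdot> (c (tens a) (snd w) \<otimes> Id (tens b))"
    using Cons w by (simp add: bring_past)
  also have "\<dots> = c (tens a) (tens (w # b))"
    using w by (simp add: braid_tensor_right tens_Cons)
  finally show ?case by simp
qed

section \<open>Nets of boxes and wires\<close>

text \<open>
  A box is an arrow with named input and output wires.  A net is a list of boxes that are fired one
  after the other on a stock of wires; a box consumes its inputs and puts its outputs in front.
\<close>
abbreviation inputs :: "('o, 'a) box \<Rightarrow> 'o wires" where
  "inputs b \<equiv> fst (snd b)"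
abbreviation outputs :: "('o, 'a) box \<Rightarrow> 'o wires" where
  "outputs b \<equiv> snd (snd b)"
abbreviation all_outputs :: "('o, 'a) box list \<Rightarrow> 'o wires" where
  "all_outputs bs \<equiv> concat (map outputs bs)"
abbreviation (input) others :: "'o wires \<Rightarrow> 'o wires \<Rightarrow> 'o wires" where
  "others vs ws \<equiv> filter (\<lambda>w. w \<notin> set vs) ws"
abbreviation (input) fire where
  "fire b ws \<equiv> outputs b @ others (inputs b) ws"

definition box_typed :: "('o, 'a) box \<Rightarrow> bool" where
  "box_typed b \<longleftrightarrow> objs (inputs b) \<and> objs (outputs b) \<and> fst b \<in> Arr C \<and>
     Dom C (fst b) = tens (inputs b) \<and> Cod C (fst b) = tens (outputs b)"

primrec after :: "'o wires \<Rightarrow> ('o, 'a) box list \<Rightarrow> 'o wires" where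
  "after ws [] = ws"
| "after ws (b # bs) = after (fire b ws) bs"

primrec runnable :: "'o wires \<Rightarrow> ('o, 'a) box list \<Rightarrow> bool" where
  "runnable ws [] = True"
| "runnable ws (b # bs) = (box_typed b \<and> distinct (inputs b) \<and> set (inputs b) \<subseteq> set ws \<and> runnable (fire b ws) bs)"

text \<open>
  The arrow computed by a net.  Each box is applied after its inputs have been routed to the front,
  and in the end the remaining wires are put into the prescribed order \<open>vs\<close>.
\<close>
primrec net :: "'o wires \<Rightarrow> ('o, 'a) box list \<Rightarrow> 'o wires \<Rightarrow> 'a" where
  "net ws [] vs = wiring ws vs"
| "net ws (b # bs) vs = net (fire b ws) bs vs \<cdot>
     ((fst b \<otimes> Id (tens (others (inputs b) ws))) \<cdot> wiring ws (inputs b @ others (inputs b) ws))"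

text \<open>
  No wire name is ever introduced twice, not even after the wire has been consumed.  This is what
  later allows boxes to be reordered by looking at names only.
\<close>
definition well_formed :: "'o wires \<Rightarrow> ('o, 'a) box list \<Rightarrow> 'o wires \<Rightarrow> bool" where
  "well_formed ws bs vs \<longleftrightarrow> objs ws \<and> distinct (ws @ all_outputs bs) \<and> runnable ws bs \<and>
     distinct vs \<and> set (after ws bs) = set vs"

lemma after_append: "after ws (bs @ bs') = after (after ws bs) bs'"
  by (induction bs arbitrary: ws) auto

lemma runnable_append: "runnable ws (bs @ bs') \<longleftrightarrow> runnable ws bs \<and> runnable (after ws bs) bs'"
  by (induction bs arbitrary: ws) auto

lemma set_after_cong: "set ws = set vs \<Longrightarrow> set (after ws bs) = set (after vs bs)"
proof (induction bs arbitrary: ws vs)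
  case (Cons b bs)
  show ?case using Cons.IH[of "fire b ws" "fire b vs"] Cons.prems by simp
qed simp

lemma runnable_mono: "set ws \<subseteq> set vs \<Longrightarrow> runnable ws bs \<Longrightarrow> runnable vs bs"
proof (induction bs arbitrary: ws vs)
  case (Cons b bs)
  have "set (fire b ws) \<subseteq> set (fire b vs)" using Cons.prems by auto
  with Cons.IH[of "fire b ws" "fire b vs"] Cons.prems show ?case by auto
qed simp

lemma runnable_cong: "set ws = set vs \<Longrightarrow> runnable ws bs \<longleftrightarrow> runnable vs bs"
  using runnable_mono by blast

lemma set_after_subset: "set (after ws bs) \<subseteq> set ws \<union> set (all_outputs bs)"
proof (induction bs arbitrary: ws)
  case (Cons b bs)
  have "set (after (fire b ws) bs) \<subseteq> set (fire b ws) \<union> set (all_outputs bs)" by (rule Cons)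
  then show ?case by auto
qed simp

lemma objs_after: "runnable ws bs \<Longrightarrow> objs ws \<Longrightarrow> objs (after ws bs)"
proof (induction bs arbitrary: ws)
  case (Cons b bs)
  have "objs (fire b ws)" using Cons.prems by (auto simp: box_typed_def)
  with Cons.IH[of "fire b ws"] Cons.prems show ?case by simp
qed simp

lemma distinct_after: "distinct (ws @ all_outputs bs) \<Longrightarrow> distinct (after ws bs)"
proof (induction bs arbitrary: ws)
  case (Cons b bs)
  have "distinct (fire b ws @ all_outputs bs)" using Cons.prems by auto
  with Cons.IH[of "fire b ws"] show ?case by simp
qed simp

lemma well_formed_objs_out: "well_formed ws bs vs \<Longrightarrow> objs vs"
  using objs_after unfolding well_formed_def by blast

lemma well_formed_D:
  assumes "well_formed ws bs vs"
  shows "objs ws" "distinct ws" "distinct (all_outputs bs)" "set ws \<inter> set (all_outputs bs) = {}"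
    "objs vs" "distinct vs" "set vs \<subseteq> set ws \<union> set (all_outputs bs)"
proof -
  show "objs ws" "distinct ws" "distinct (all_outputs bs)" "set ws \<inter> set (all_outputs bs) = {}"
      "distinct vs" "objs vs"
    using assms well_formed_objs_out[OF assms] by (simp_all add: well_formed_def)
  show "set vs \<subseteq> set ws \<union> set (all_outputs bs)"
    using assms set_after_subset[of ws bs] unfolding well_formed_def by blast
qed

lemma well_formed_ConsD:
  assumes "well_formed ws (b # bs) vs"
  shows "well_formed (fire b ws) bs vs" "box_typed b" "distinct (inputs b)" "set (inputs b) \<subseteq> set ws"
    "distinct ws" "objs ws" "set (outputs b) \<inter> set ws = {}" "distinct (outputs b)"
    "objs (outputs b)" "objs (inputs b)"
  using assms by (auto simp: well_formed_def box_typed_def)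

lemma well_formed_cong_in:
  assumes "well_formed ws bs vs" "distinct us" "set us = set ws"
  shows "well_formed us bs vs"
  using assms set_after_cong[of us ws bs] runnable_cong[of us ws bs] by (auto simp: well_formed_def)

lemma well_formed_cong_out:
  assumes "well_formed ws bs vs" "distinct us" "set us = set vs"
  shows "well_formed ws bs us"
  using assms by (auto simp: well_formed_def)

lemma well_formed_after: "objs ws \<Longrightarrow> distinct (ws @ all_outputs bs) \<Longrightarrow> runnable ws bs \<Longrightarrow> well_formed ws bs (after ws bs)"
  using distinct_after by (auto simp: well_formed_def)

lemma well_formed_appendD:
  assumes "well_formed ws (bs @ bs') vs"
  shows "well_formed ws bs (after ws bs)" "well_formed (after ws bs) bs' vs"
proof -
  show 1: "well_formed ws bs (after ws bs)"
    using assms by (intro well_formed_after) (auto simp: well_formed_def runnable_append)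
  have "objs (after ws bs)" using well_formed_objs_out[OF 1] .
  moreover have "distinct (after ws bs @ all_outputs bs')"
    using assms set_after_subset[of ws bs] 1 unfolding well_formed_def by fastforce
  ultimately show "well_formed (after ws bs) bs' vs"
    using assms by (auto simp: well_formed_def runnable_append after_append)
qed

lemma well_formed_append:
  assumes "well_formed ws bs us" "well_formed us bs' vs"
    and "set (all_outputs bs') \<inter> (set ws \<union> set (all_outputs bs)) = {}"
  shows "well_formed ws (bs @ bs') vs"
proof -
  have s: "set (after ws bs) = set us" using assms(1) by (simp add: well_formed_def)
  show ?thesis
    using assms set_after_cong[OF s] runnable_cong[OF s]
    by (auto simp: well_formed_def runnable_append after_append)
qed

lemma box_typedD:
  assumes "box_typed b"
  shows "fst b \<in> Arr C" "Dom C (fst b) = tens (inputs b)" "Cod C (fst b) = tens (outputs b)"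
  using assms by (auto simp: box_typed_def)

lemma wiring_others:
  assumes "distinct as" "distinct ws" "set as \<subseteq> set ws" "objs ws"
  shows "wiring ws (as @ others as ws) \<in> Arr C"
    "Dom C (wiring ws (as @ others as ws)) = tens ws"
    "Cod C (wiring ws (as @ others as ws)) = tens as \<otimes>\<^sub>o tens (others as ws)"
    "tens (others as ws) \<in> Obj C"
proof -
  have "distinct (as @ others as ws)" "set ws = set (as @ others as ws)"
    using assms(1-3) by auto
  note w = wiring_hom[OF assms(2) this assms(4)]
  have o: "objs as" "objs (others as ws)" using assms(3,4) by auto
  show "wiring ws (as @ others as ws) \<in> Arr C"
    "Dom C (wiring ws (as @ others as ws)) = tens ws"
    "Cod C (wiring ws (as @ others as ws)) = tens as \<otimes>\<^sub>o tens (others as ws)"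
    "tens (others as ws) \<in> Obj C"
    using w tens_append[OF o] tens_Obj[OF o(2)] by simp_all
qed

lemma net_typed:
  assumes "well_formed ws bs vs"
  shows "net ws bs vs \<in> Arr C \<and> Dom C (net ws bs vs) = tens ws \<and> Cod C (net ws bs vs) = tens vs"
  using assms
proof (induction bs arbitrary: ws)
  case Nil
  then show ?case using wiring_hom[of ws vs] by (auto simp: well_formed_def)
next
  case (Cons b bs)
  note d = well_formed_ConsD[OF Cons.prems] and b = box_typedD[OF well_formed_ConsD(2)[OF Cons.prems]]
  note w = wiring_others[OF d(3,5,4,6)]
  have t: "tens (fire b ws) = tens (outputs b) \<otimes>\<^sub>o tens (others (inputs b) ws)"
    by (rule tens_append) (use d(6,9) in \<open>simp_all\<close>)
  show ?case using Cons.IH[OF d(1)] w b t by simp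
qed

lemmas net_hom = net_typed[THEN conjunct1] net_typed[THEN conjunct2, THEN conjunct1]
  net_typed[THEN conjunct2, THEN conjunct2]

lemma wiring_keep:
  assumes "distinct as" "distinct ws" "distinct us" "set us = set ws" "set as \<subseteq> set ws" "objs ws"
  shows "wiring us (as @ others as us) \<cdot> wiring ws us
      = (Id (tens as) \<otimes> wiring (others as ws) (others as us)) \<cdot> wiring ws (as @ others as ws)"
proof -
  let ?w = "as @ others as ws" and ?u = "as @ others as us"
  have w: "distinct ?w" "set ?w = set ws" and u: "distinct ?u" "set ?u = set ws"
    using assms(1-5) by auto
  have r: "distinct (others as ws)" "distinct (others as us)" "set (others as ws) = set (others as us)"
    "objs (others as ws)" "set as \<inter> set (others as ws) = {}" "objs as"
    using assms by auto
  have ow: "objs ?w" using w(2) assms(6) by simp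
  have "wiring us ?u \<cdot> wiring ws us = wiring ws ?u"
    using assms(2-4,6) u by (intro wiring_trans) simp_all
  also have "\<dots> = wiring ?w ?u \<cdot> wiring ws ?w"
    using assms(2,6) u w by (intro wiring_trans[symmetric]) simp_all
  also have "wiring ?w ?u = wiring as as \<otimes> wiring (others as ws) (others as us)"
    using assms(1) r by (intro wiring_append) simp_all
  also have "wiring as as = Id (tens as)" using assms(1) r(6) by (rule wiring_refl)
  finally show ?thesis .
qed

text \<open>
  The order in which the input wires are listed is immaterial up to the rearrangement of the inputs:
  a rearrangement of the idle wires slides past every box.
\<close>
lemma net_wiring_in:
  assumes "well_formed ws bs vs" "distinct us" "set us = set ws"
  shows "net us bs vs \<cdot> wiring ws us = net ws bs vs"
  using assms
proof (induction bs arbitrary: ws us)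
  case Nil
  then show ?case by (auto simp: well_formed_def intro!: wiring_trans)
next
  case (Cons b bs)
  note d = well_formed_ConsD[OF Cons.prems(1)] and b = box_typedD[OF well_formed_ConsD(2)[OF Cons.prems(1)]]
  let ?i = "inputs b" and ?ou = "outputs b"
  let ?rw = "others ?i ws" and ?ru = "others ?i us"
  have o: "objs us" "objs ?rw" "objs ?ru" "objs ?ou" "objs ?i" "distinct ?rw" "distinct ?ru" "set ?ru = set ?rw"
    "distinct ?i" "distinct ?ou" "set ?ou \<inter> set ?rw = {}" "set ?i \<inter> set ?rw = {}"
    "distinct ws" "objs ws" "distinct us" "set us = set ws" "set ?i \<subseteq> set ws"
    using d Cons.prems by auto
  have iu: "set ?i \<subseteq> set us" using o(16,17) by simp
  have wu: "well_formed (fire b us) bs vs"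
    using well_formed_ConsD(1)[OF well_formed_cong_in[OF Cons.prems]] .
  let ?N = "net (fire b us) bs vs"
  note N = net_hom[OF wu]
  have IH: "?N \<cdot> wiring (fire b ws) (fire b us) = net (fire b ws) bs vs"
    by (rule Cons.IH[OF d(1)]; use o(7,8,10,11) in auto)
  have wr: "wiring ?rw ?ru \<in> Arr C" "Dom C (wiring ?rw ?ru) = tens ?rw" "Cod C (wiring ?rw ?ru) = tens ?ru"
    by (rule wiring_hom; use o(2,6-8) in simp)+
  note w1 = wiring_others[OF d(3) o(15) iu o(1)] and w2 = wiring_others[OF d(3,5,4,6)]
  have w3: "wiring ws us \<in> Arr C" "Dom C (wiring ws us) = tens ws" "Cod C (wiring ws us) = tens us"
    by (rule wiring_hom; use o(13-16) in simp)+
  have e1: "wiring us (?i @ ?ru) \<cdot> wiring ws us = (Id (tens ?i) \<otimes> wiring ?rw ?ru) \<cdot> wiring ws (?i @ ?rw)"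
    by (rule wiring_keep) (use o(9,13-17) in simp_all)
  have e2: "wiring (fire b ws) (fire b us) = Id (tens ?ou) \<otimes> wiring ?rw ?ru"
    using wiring_append[of ?ou ?ou ?rw ?ru] wiring_refl[of ?ou] o(2,4,6,7,8,10,11) by simp
  have sl: "(fst b \<otimes> Id (tens ?ru)) \<cdot> (Id (tens ?i) \<otimes> wiring ?rw ?ru)
     = (Id (tens ?ou) \<otimes> wiring ?rw ?ru) \<cdot> (fst b \<otimes> Id (tens ?rw))"
    using slide[OF b(1) wr(1) b(2,3) wr(2,3)] by simp
  have ob: "tens ?i \<in> Obj C" "tens ?ou \<in> Obj C" "tens ?rw \<in> Obj C" "tens ?ru \<in> Obj C"
    by (rule tens_Obj, fact)+
  have t: "tens (?i @ ?ru) = tens ?i \<otimes>\<^sub>o tens ?ru" "tens (?i @ ?rw) = tens ?i \<otimes>\<^sub>o tens ?rw"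
    "tens (?ou @ ?ru) = tens ?ou \<otimes>\<^sub>o tens ?ru" "tens (?ou @ ?rw) = tens ?ou \<otimes>\<^sub>o tens ?rw"
    by (rule tens_append; fact)+
  note typing = N[unfolded t] w1 w2 w3 wr b ob
  have "net us (b # bs) vs \<cdot> wiring ws us
     = ?N \<cdot> ((fst b \<otimes> Id (tens ?ru)) \<cdot> (wiring us (?i @ ?ru) \<cdot> wiring ws us))"
    using typing by (simp add: comp_assoc)
  also have "\<dots> = ?N \<cdot> (((fst b \<otimes> Id (tens ?ru)) \<cdot> (Id (tens ?i) \<otimes> wiring ?rw ?ru)) \<cdot> wiring ws (?i @ ?rw))"
    unfolding e1 using typing by (simp add: comp_assoc)
  also have "\<dots> = (?N \<cdot> wiring (fire b ws) (fire b us)) \<cdot> ((fst b \<otimes> Id (tens ?rw)) \<cdot> wiring ws (?i @ ?rw))"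
    unfolding sl e2 using typing by (simp add: comp_assoc)
  finally show ?case unfolding IH by simp
qed

lemma net_append:
  assumes "well_formed ws bs us" "well_formed us bs' vs" "well_formed ws (bs @ bs') vs"
  shows "net us bs' vs \<cdot> net ws bs us = net ws (bs @ bs') vs"
  using assms
proof (induction bs arbitrary: ws)
  case Nil
  have "well_formed ws bs' vs" "distinct us" "set us = set ws" using Nil by (simp_all add: well_formed_def)
  from net_wiring_in[OF this] show ?case by simp
next
  case (Cons b bs)
  note d = well_formed_ConsD[OF Cons.prems(1)] and b = box_typedD[OF well_formed_ConsD(2)[OF Cons.prems(1)]]
  let ?i = "inputs b" and ?ou = "outputs b"
  let ?rw = "others ?i ws"
  have d3: "well_formed (fire b ws) (bs @ bs') vs" using well_formed_ConsD(1)[of ws b "bs @ bs'" vs] Cons.prems by simp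
  have IH: "net us bs' vs \<cdot> net (fire b ws) bs us = net (fire b ws) (bs @ bs') vs"
    by (rule Cons.IH[OF d(1) Cons.prems(2) d3])
  note w2 = wiring_others[OF d(3,5,4,6)]
  have t: "tens (fire b ws) = tens ?ou \<otimes>\<^sub>o tens ?rw"
    by (rule tens_append) (use d(6,9) in \<open>simp_all\<close>)
  show ?case
    using net_hom[OF d(1), unfolded t] net_hom[OF Cons.prems(2)] w2 b
    by (simp add: IH[symmetric] comp_assoc)
qed

lemma after_frame:
  assumes "runnable ws bs" "set rs \<inter> (set ws \<union> set (all_outputs bs)) = {}"
  shows "set (after (ws @ rs) bs) = set (after ws bs) \<union> set rs"
  using assms
proof (induction bs arbitrary: ws)
  case (Cons b bs)
  have "set (fire b (ws @ rs)) = set (fire b ws @ rs)" using Cons.prems by auto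
  from set_after_cong[OF this, of bs]
  have "set (after (ws @ rs) (b # bs)) = set (after (fire b ws @ rs) bs)" by simp
  also have "\<dots> = set (after (fire b ws) bs) \<union> set rs"
    using Cons.prems by (intro Cons.IH) auto
  finally show ?case by simp
qed simp

lemma well_formed_frame:
  assumes "well_formed ws bs vs" "distinct rs" "objs rs" "set rs \<inter> (set ws \<union> set (all_outputs bs)) = {}"
  shows "well_formed (ws @ rs) bs (vs @ rs)"
proof -
  have "runnable (ws @ rs) bs" using runnable_mono[of ws "ws @ rs" bs] assms by (auto simp: well_formed_def)
  moreover have "set rs \<inter> set vs = {}" using assms set_after_subset[of ws bs] by (auto simp: well_formed_def)
  ultimately show ?thesis using assms after_frame[of ws bs rs] by (auto simp: well_formed_def)
qed

lemma net_frame: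
  assumes "well_formed ws bs vs" "distinct rs" "objs rs" "set rs \<inter> (set ws \<union> set (all_outputs bs)) = {}"
  shows "net (ws @ rs) bs (vs @ rs) = net ws bs vs \<otimes> Id (tens rs)"
  using assms
proof (induction bs arbitrary: ws)
  case Nil
  then have "wiring (ws @ rs) (vs @ rs) = wiring ws vs \<otimes> wiring rs rs"
    by (intro wiring_append) (auto simp: well_formed_def)
  then show ?case using Nil by (simp add: wiring_refl)
next
  case (Cons b bs)
  note d = well_formed_ConsD[OF Cons.prems(1)] and b = box_typedD[OF well_formed_ConsD(2)[OF Cons.prems(1)]]
  let ?i = "inputs b" and ?ou = "outputs b"
  let ?rw = "others ?i ws"
  have o: "others ?i rs = rs"
    using Cons.prems(4) d(4) by (simp add: filter_id_conv) blast
  have IH: "net (fire b ws @ rs) bs (vs @ rs) = net (fire b ws) bs vs \<otimes> Id (tens rs)"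
    using Cons.prems by (intro Cons.IH[OF d(1)]) auto
  note w2 = wiring_others[OF d(3,5,4,6)]
  have ob: "objs ?rw" "objs ?i" "objs ?ou" using d(6,9,10) by auto
  have t: "tens (fire b ws) = tens ?ou \<otimes>\<^sub>o tens ?rw"
    by (rule tens_append) (use ob in \<open>simp_all\<close>)
  have wi: "wiring (ws @ rs) (?i @ ?rw @ rs) = wiring ws (?i @ ?rw) \<otimes> Id (tens rs)"
  proof -
    have "wiring (ws @ rs) ((?i @ ?rw) @ rs) = wiring ws (?i @ ?rw) \<otimes> wiring rs rs"
      by (rule wiring_append) (use d Cons.prems in auto)
    then show ?thesis using Cons.prems by (simp add: wiring_refl)
  qed
  have "net (ws @ rs) (b # bs) (vs @ rs)
     = (net (fire b ws) bs vs \<otimes> Id (tens rs)) \<cdot> ((fst b \<otimes> Id (tens ?rw) \<otimes> Id (tens rs)) \<cdot> (wiring ws (?i @ ?rw) \<otimes> Id (tens rs)))"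
    using IH ob Cons.prems(3) by (simp add: o wi Id_tens_append)
  also have "\<dots> = net ws (b # bs) vs \<otimes> Id (tens rs)"
    using net_hom[OF d(1), unfolded t] w2 b Cons.prems(3) by (simp add: tensor_IdR)
  finally show ?case .
qed

lemma net_wiring_out:
  assumes "well_formed ws bs vs" "distinct us" "set us = set vs"
  shows "wiring vs us \<cdot> net ws bs vs = net ws bs us"
proof -
  have w: "well_formed vs [] us" using well_formed_objs_out[OF assms(1)] assms by (auto simp: well_formed_def)
  have "net vs [] us \<cdot> net ws bs vs = net ws (bs @ []) us"
    by (rule net_append[OF assms(1) w]) (use well_formed_cong_out[OF assms] in simp)
  then show ?thesis by simp
qed

text \<open>
  Idle wires on the left are moved to the right by the symmetry, whose naturality carries them
  past the net, and two crossings cancel.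
\<close>
lemma net_frame_left:
  assumes "well_formed ws bs vs" "distinct rs" "objs rs" "set rs \<inter> (set ws \<union> set (all_outputs bs)) = {}"
  shows "net (rs @ ws) bs (rs @ vs) = Id (tens rs) \<otimes> net ws bs vs"
proof -
  note f = well_formed_frame[OF assms]
  have vs: "objs vs" "distinct vs" "set vs \<inter> set rs = {}"
    using well_formed_objs_out[OF assms(1)] f by (auto simp: well_formed_def)
  have ws: "objs ws" "distinct ws" "set ws \<inter> set rs = {}" using f by (auto simp: well_formed_def)
  have f1: "well_formed (ws @ rs) bs (rs @ vs)" by (rule well_formed_cong_out[OF f]) (use vs assms in auto)
  have f2: "well_formed (rs @ ws) bs (rs @ vs)" by (rule well_formed_cong_in[OF f1]) (use ws assms in auto)
  note N = net_hom[OF assms(1)]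
  have "net (rs @ ws) bs (rs @ vs) = net (ws @ rs) bs (rs @ vs) \<cdot> wiring (rs @ ws) (ws @ rs)"
    by (rule net_wiring_in[OF f2, symmetric]) (use ws assms in auto)
  also have "net (ws @ rs) bs (rs @ vs) = wiring (vs @ rs) (rs @ vs) \<cdot> net (ws @ rs) bs (vs @ rs)"
    by (rule net_wiring_out[OF f, symmetric]) (use vs assms in auto)
  also have "wiring (vs @ rs) (rs @ vs) = c (tens vs) (tens rs)"
    by (rule wiring_braid) (use vs assms in auto)
  also have "wiring (rs @ ws) (ws @ rs) = c (tens rs) (tens ws)"
    by (rule wiring_braid) (use ws assms in auto)
  also have "net (ws @ rs) bs (vs @ rs) = net ws bs vs \<otimes> Id (tens rs)"
    by (rule net_frame[OF assms])
  also have "c (tens vs) (tens rs) \<cdot> (net ws bs vs \<otimes> Id (tens rs))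
      = (Id (tens rs) \<otimes> net ws bs vs) \<cdot> c (tens ws) (tens rs)"
    using N assms(3) by (simp add: braid_nat)
  also have "((Id (tens rs) \<otimes> net ws bs vs) \<cdot> c (tens ws) (tens rs)) \<cdot> c (tens rs) (tens ws)
      = Id (tens rs) \<otimes> net ws bs vs"
    using N assms(3) ws vs by (simp add: comp_assoc)
  finally show ?thesis .
qed

lemma well_formed_tensor:
  assumes "well_formed ws bs vs" "well_formed ws' bs' vs'"
    and "set (ws @ all_outputs bs) \<inter> set (ws' @ all_outputs bs') = {}"
  shows "well_formed (ws @ ws') (bs @ bs') (vs @ vs')"
proof -
  have vs: "objs vs" "distinct vs" "set vs \<subseteq> set (ws @ all_outputs bs)"
    using well_formed_objs_out[OF assms(1)] assms(1) set_after_subset[of ws bs] by (auto simp: well_formed_def)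
  have "well_formed (ws @ ws') bs (vs @ ws')"
    by (rule well_formed_frame[OF assms(1)]) (use assms in \<open>auto simp: well_formed_def\<close>)
  moreover have f: "well_formed (ws' @ vs) bs' (vs' @ vs)"
    by (rule well_formed_frame[OF assms(2)]) (use assms vs in auto)
  have "well_formed (vs @ ws') bs' (vs @ vs')"
    by (rule well_formed_cong_in[OF well_formed_cong_out[OF f]]) (use f in \<open>auto simp: well_formed_def\<close>)
  ultimately show ?thesis
    by (rule well_formed_append) (use assms in \<open>auto simp: well_formed_def\<close>)
qed

lemma net_tensor:
  assumes "well_formed ws bs vs" "well_formed ws' bs' vs'"
    and "set (ws @ all_outputs bs) \<inter> set (ws' @ all_outputs bs') = {}"
  shows "net (ws @ ws') (bs @ bs') (vs @ vs') = net ws bs vs \<otimes> net ws' bs' vs'"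
proof -
  have vs: "objs vs" "distinct vs" "set vs \<subseteq> set (ws @ all_outputs bs)"
    using well_formed_objs_out[OF assms(1)] assms(1) set_after_subset[of ws bs] by (auto simp: well_formed_def)
  have ws': "objs ws'" "distinct ws'" using assms(2) by (auto simp: well_formed_def)
  have f1: "well_formed (ws @ ws') bs (vs @ ws')"
    by (rule well_formed_frame[OF assms(1)]) (use assms in \<open>auto simp: well_formed_def\<close>)
  have f: "well_formed (ws' @ vs) bs' (vs' @ vs)"
    by (rule well_formed_frame[OF assms(2)]) (use assms vs in auto)
  have f2: "well_formed (vs @ ws') bs' (vs @ vs')"
    by (rule well_formed_cong_in[OF well_formed_cong_out[OF f]]) (use f in \<open>auto simp: well_formed_def\<close>)
  have "net (ws @ ws') (bs @ bs') (vs @ vs') = net (vs @ ws') bs' (vs @ vs') \<cdot> net (ws @ ws') bs (vs @ ws')"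
    by (rule net_append[OF f1 f2 well_formed_tensor[OF assms], symmetric])
  also have "net (vs @ ws') bs' (vs @ vs') = Id (tens vs) \<otimes> net ws' bs' vs'"
    by (rule net_frame_left[OF assms(2)]) (use assms vs in auto)
  also have "net (ws @ ws') bs (vs @ ws') = net ws bs vs \<otimes> Id (tens ws')"
    by (rule net_frame[OF assms(1)]) (use assms ws' in auto)
  also have "(Id (tens vs) \<otimes> net ws' bs' vs') \<cdot> (net ws bs vs \<otimes> Id (tens ws')) = net ws bs vs \<otimes> net ws' bs' vs'"
    using net_hom[OF assms(1)] net_hom[OF assms(2)] vs ws' by (simp add: interchange)
  finally show ?thesis .
qed

lemma net_single:
  assumes "box_typed (f, ws, vs)" "distinct ws" "distinct vs" 
  shows "net ws [(f, ws, vs)] vs = f"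
proof -
  have "objs ws" "objs vs" using assms by (auto simp: box_typed_def)
  moreover have "others ws ws = []" by simp
  ultimately show ?thesis using assms box_typedD[OF assms(1)]
    by (simp add: wiring_refl del: filter_False)
qed

section \<open>Rewriting inside a net\<close>

text \<open>
  Two nets with the same input and output wires are identified if they compute the same arrow.
  The nets come last so that chains of such identities can be written with \<open>also\<close>.
\<close>
definition net_eq :: "'o wires \<Rightarrow> 'o wires \<Rightarrow> ('o, 'a) box list \<Rightarrow>
    ('o, 'a) box list \<Rightarrow> bool" where
  "net_eq ws vs bs bs' \<longleftrightarrow> well_formed ws bs vs \<and> well_formed ws bs' vs \<and> net ws bs vs = net ws bs' vs"

lemma net_eq_trans [trans]: "net_eq ws vs a b \<Longrightarrow> net_eq ws vs b d \<Longrightarrow> net_eq ws vs a d"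
  by (auto simp: net_eq_def)

lemma net_eq_sym: "net_eq ws vs a b \<Longrightarrow> net_eq ws vs b a"
  by (auto simp: net_eq_def)

text \<open>
  A net that contains \<open>l\<close> as a consecutive part factors through \<open>l\<close> tensored with the identity of the
  wires that are idle meanwhile.  Hence \<open>l\<close> may be replaced by anything that computes the same arrow.
\<close>
lemma net_at:
  assumes wf: "well_formed ws (p @ l @ q) vs" and l: "well_formed us l us'" and us: "set us \<subseteq> set (after ws p)"
  defines "r \<equiv> others us (after ws p)"
  shows "well_formed (us' @ r) q vs" "net ws (p @ l @ q) vs
     = net (us' @ r) q vs \<cdot> ((net us l us' \<otimes> Id (tens r)) \<cdot> net ws p (us @ r))"
proof -
  note s1 = well_formed_appendD[OF wf]
  note s2 = well_formed_appendD[OF s1(2)]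
  have r: "distinct r" "set (us @ r) = set (after ws p)" "set us \<inter> set r = {}" "distinct (us @ r)"
    using us s1(2) l by (auto simp: r_def well_formed_def)
  have or: "objs r" using s1(2) r(2) by (auto simp: well_formed_def)
  have disj: "set r \<inter> (set us \<union> set (all_outputs l)) = {}"
    using s1(2) r by (auto simp: well_formed_def)
  have wp: "well_formed ws p (us @ r)" by (rule well_formed_cong_out[OF s1(1) r(4) r(2)])
  have wlq: "well_formed (us @ r) (l @ q) vs" by (rule well_formed_cong_in[OF s1(2) r(4) r(2)])
  have wl: "well_formed (us @ r) l (us' @ r)" by (rule well_formed_frame[OF l r(1) or disj])
  then have "set (after (us @ r) l) = set (us' @ r)" "distinct (us' @ r)" by (auto simp: well_formed_def)
  then show wq: "well_formed (us' @ r) q vs"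
    using well_formed_cong_in[OF well_formed_appendD(2)[OF wlq]] by auto
  have "net ws (p @ l @ q) vs = net (us @ r) (l @ q) vs \<cdot> net ws p (us @ r)"
    by (rule net_append[OF wp wlq wf, symmetric])
  also have "net (us @ r) (l @ q) vs = net (us' @ r) q vs \<cdot> net (us @ r) l (us' @ r)"
    by (rule net_append[OF wl wq wlq, symmetric])
  also have "net (us @ r) l (us' @ r) = net us l us' \<otimes> Id (tens r)"
    by (rule net_frame[OF l r(1) or disj])
  also have "(net (us' @ r) q vs \<cdot> (net us l us' \<otimes> Id (tens r))) \<cdot> net ws p (us @ r)
     = net (us' @ r) q vs \<cdot> ((net us l us' \<otimes> Id (tens r)) \<cdot> net ws p (us @ r))"
    using net_hom[OF wp] net_hom[OF wq] net_hom[OF l] or l well_formed_objs_out[OF l]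
    by (simp add: comp_assoc tens_append well_formed_def)
  finally show "net ws (p @ l @ q) vs
     = net (us' @ r) q vs \<cdot> ((net us l us' \<otimes> Id (tens r)) \<cdot> net ws p (us @ r))" .
qed

lemma net_eq_inside:
  assumes loc: "net_eq us us' l l'" and wf: "well_formed ws (p @ l @ q) vs" and us: "set us \<subseteq> set (after ws p)"
    and fresh: "distinct (ws @ all_outputs (p @ l' @ q))"
  shows "net_eq ws vs (p @ l @ q) (p @ l' @ q)"
proof -
  let ?r = "others us (after ws p)"
  have l: "well_formed us l us'" and l': "well_formed us l' us'" and eq: "net us l us' = net us l' us'"
    using loc by (auto simp: net_eq_def)
  note s1 = well_formed_appendD[OF wf]
  have dp: "distinct (after ws p)" "set (after ws p) \<subseteq> set ws \<union> set (all_outputs p)"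
    using s1 set_after_subset by (auto simp: well_formed_def)
  have r: "distinct (us @ ?r)" "set (us @ ?r) = set (after ws p)"
    using us dp l by (auto simp: well_formed_def)
  have "objs ?r" using well_formed_D(1)[OF s1(2)] by simp
  have fr: "(set ws \<union> set (all_outputs p)) \<inter> (set (all_outputs l') \<union> set (all_outputs q)) = {}"
    "set (all_outputs l') \<inter> set (all_outputs q) = {}"
    using fresh by (simp_all del: set_concat) blast
  have au: "set (after ws p) \<inter> (set (all_outputs l') \<union> set (all_outputs q)) = {}"
    using fr(1) dp(2) by blast
  have "set ?r \<inter> (set us \<union> set (all_outputs l')) = {}"
    using r(1) au unfolding r(2)[symmetric] by (simp del: set_concat) blast
  with \<open>objs ?r\<close> have wl': "well_formed (us @ ?r) l' (us' @ ?r)"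
    using r(1) by (intro well_formed_frame[OF l']) (simp_all del: set_concat)
  have "well_formed ws p (us @ ?r)" by (rule well_formed_cong_out[OF s1(1) r])
  moreover have "well_formed (us @ ?r) (l' @ q) vs"
    by (rule well_formed_append[OF wl' net_at(1)[OF wf l us]])
      (use fr au r(2) in \<open>simp del: set_concat, blast\<close>)
  ultimately have wf': "well_formed ws (p @ l' @ q) vs"
    by (rule well_formed_append) (use fr in \<open>simp del: set_concat, blast\<close>)
  show ?thesis
    using net_at(2)[OF wf l us] net_at(2)[OF wf' l' us] wf wf' eq by (simp add: net_eq_def)
qed

text \<open>
  Both orders compute \<open>f \<otimes> g\<close>; this is the interchange law.
\<close>
lemma net_eq_swap2:
  assumes f: "box_typed (f, as, vs)" and g: "box_typed (g, as', vs')"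
    and d: "distinct (as @ as' @ vs @ vs')"
  shows "net_eq (as @ as') (vs @ vs') [(f, as, vs), (g, as', vs')] [(g, as', vs'), (f, as, vs)]"
proof -
  have o: "objs as" "objs vs" "objs as'" "objs vs'" using f g by (auto simp: box_typed_def)
  have dd: "distinct as" "distinct as'" "distinct vs" "distinct vs'"
    "set as \<inter> set as' = {}" "set as \<inter> set vs = {}" "set as \<inter> set vs' = {}"
    "set as' \<inter> set vs = {}" "set as' \<inter> set vs' = {}" "set vs \<inter> set vs' = {}"
    "set as' \<inter> set as = {}" "set vs \<inter> set as = {}" "set vs' \<inter> set as = {}"
    "set vs \<inter> set as' = {}" "set vs' \<inter> set as' = {}" "set vs' \<inter> set vs = {}"
    using d by auto
  have wf: "well_formed as [(f, as, vs)] vs" and wg: "well_formed as' [(g, as', vs')] vs'"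
    using f g dd o by (auto simp: well_formed_def)
  have n1: "net (as @ as') ([(f, as, vs)] @ [(g, as', vs')]) (vs @ vs') = f \<otimes> g"
    and w1: "well_formed (as @ as') ([(f, as, vs)] @ [(g, as', vs')]) (vs @ vs')"
    using net_tensor[OF wf wg] well_formed_tensor[OF wf wg] dd net_single[OF f] net_single[OF g]
    by (simp_all add: Int_Un_distrib Int_Un_distrib2)
  have wg': "well_formed (as @ as') [(g, as', vs')] (as @ vs')"
    using well_formed_cong_in[OF well_formed_cong_out[OF well_formed_frame[OF wg, of as]], of "as @ vs'" "as @ as'"] dd o
    by (simp add: Int_Un_distrib Un_commute)
  have wf': "well_formed (as @ vs') [(f, as, vs)] (vs @ vs')"
    using well_formed_frame[OF wf, of vs'] dd o by (simp add: Int_Un_distrib)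
  have w2: "well_formed (as @ as') ([(g, as', vs')] @ [(f, as, vs)]) (vs @ vs')"
    by (rule well_formed_append[OF wg' wf']) (use dd in \<open>simp add: Int_Un_distrib\<close>)
  have "net (as @ as') ([(g, as', vs')] @ [(f, as, vs)]) (vs @ vs')
    = net (as @ vs') [(f, as, vs)] (vs @ vs') \<cdot> net (as @ as') [(g, as', vs')] (as @ vs')"
    by (rule net_append[OF wg' wf' w2, symmetric])
  also have "net (as @ as') [(g, as', vs')] (as @ vs') = Id (tens as) \<otimes> g"
    using net_frame_left[OF wg, of as] net_single[OF g] dd o by (simp add: Int_Un_distrib)
  also have "net (as @ vs') [(f, as, vs)] (vs @ vs') = f \<otimes> Id (tens vs')"
    using net_frame[OF wf, of vs'] net_single[OF f] dd o by (simp add: Int_Un_distrib)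
  also have "(f \<otimes> Id (tens vs')) \<cdot> (Id (tens as) \<otimes> g) = f \<otimes> g"
    using box_typedD[OF f] box_typedD[OF g] o by (simp add: interchange)
  finally show ?thesis using n1 w1 w2 by (simp add: net_eq_def)
qed

lemma net_eq_swap:
  assumes wf: "well_formed ws (a # b # q) vs" and b: "set (inputs b) \<subseteq> set ws"
  shows "net_eq ws vs (a # b # q) (b # a # q)"
proof -
  obtain f i j where a': "a = (f, i, j)" by (cases a)
  obtain g i' j' where b': "b = (g, i', j')" by (cases b)
  have d: "distinct (ws @ j @ j' @ all_outputs q)" "distinct i" "distinct i'" "set i \<subseteq> set ws" "set i' \<subseteq> set ws"
    "set i' \<subseteq> set j \<union> (set ws - set i)" "box_typed a" "box_typed b"
    using wf b by (auto simp: well_formed_def a' b')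
  then have ii: "set i \<inter> set i' = {}" by auto
  have loc: "net_eq (i @ i') (j @ j') [a, b] [b, a]"
    unfolding a' b' by (rule net_eq_swap2) (use d ii in \<open>auto simp: a' b'\<close>)
  have fr: "distinct (ws @ all_outputs ([] @ [b, a] @ q))"
    using d(1) by (simp add: a' b' del: set_concat) blast
  have us: "set (i @ i') \<subseteq> set (after ws [])" using d(4,5) by simp
  have "well_formed ws ([] @ [a, b] @ q) vs" using wf by simp
  from net_eq_inside[OF loc this us fr] show ?thesis by simp
qed

lemma set_available:
  assumes "runnable ws (p @ b # q)"
  shows "set (inputs b) \<subseteq> set ws \<union> set (all_outputs p)"
  using assms set_after_subset[of ws p] by (auto simp: runnable_append)

lemma net_eq_Cons:
  assumes "net_eq (fire b ws) vs bs bs'" "well_formed ws (b # bs) vs" "distinct (ws @ all_outputs (b # bs'))"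
  shows "net_eq ws vs (b # bs) (b # bs')"
  using assms by (auto simp: net_eq_def well_formed_def)

lemma net_eq_refl: "well_formed ws bs vs \<Longrightarrow> net_eq ws vs bs bs"
  by (simp add: net_eq_def)

text \<open>
  A wire name that has been consumed never returns.  An input of \<open>b\<close> that is present at the start is
  therefore left alone by all boxes in \<open>p\<close>, and \<open>b\<close> can be exchanged with each of them.
\<close>
lemma net_eq_move_front:
  assumes "well_formed ws (p @ b # q) vs" "set (inputs b) \<subseteq> set ws"
  shows "net_eq ws vs (p @ b # q) (b # p @ q)"
  using assms
proof (induction p arbitrary: ws)
  case Nil
  then show ?case by (simp add: net_eq_refl)
next
  case (Cons a p)
  have d: "distinct (ws @ outputs a @ all_outputs p @ outputs b @ all_outputs q)"
    using Cons.prems by (auto simp: well_formed_def)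
  have w: "well_formed (fire a ws) (p @ b # q) vs" using well_formed_ConsD(1)[of ws a "p @ b # q" vs] Cons.prems by simp
  have "set (inputs b) \<subseteq> set (fire a ws) \<union> set (all_outputs p)"
    using w by (intro set_available) (auto simp: well_formed_def)
  then have "set (inputs b) \<subseteq> set (fire a ws)" using Cons.prems(2) d by auto
  from Cons.IH[OF w this] have "net_eq (fire a ws) vs (p @ b # q) (b # p @ q)" .
  then have 1: "net_eq ws vs (a # p @ b # q) (a # b # p @ q)"
    by (rule net_eq_Cons) (use Cons.prems d in auto)
  then have "well_formed ws (a # b # p @ q) vs" by (simp add: net_eq_def)
  from net_eq_swap[OF this Cons.prems(2)] 1 show ?case by (auto intro: net_eq_trans)
qed

text \<open>
  A net is determined by its multiset of boxes: the wire names already record which box feeds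
  which.  Interchange and naturality of the symmetry are thereby absorbed into the notation.
\<close>
lemma net_eq_mset:
  assumes "well_formed ws bs vs" "well_formed ws bs' vs" "mset bs = mset bs'"
  shows "net_eq ws vs bs bs'"
  using assms
proof (induction bs arbitrary: ws bs')
  case Nil
  then show ?case by (auto simp: net_eq_refl)
next
  case (Cons b bs)
  have "b \<in> set bs'" using Cons.prems(3) by (metis list.set_intros(1) set_mset_mset)
  then obtain p q where bs': "bs' = p @ b # q" by (meson split_list)
  have m: "mset bs = mset (p @ q)" using Cons.prems(3) bs' by simp
  have "set (inputs b) \<subseteq> set ws" using well_formed_ConsD(4)[OF Cons.prems(1)] .
  then have 1: "net_eq ws vs bs' (b # p @ q)"
    using net_eq_move_front[of ws p b q vs] Cons.prems(2) bs' by simp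
  then have w: "well_formed ws (b # p @ q) vs" by (simp add: net_eq_def)
  have "net_eq (fire b ws) vs bs (p @ q)"
    by (rule Cons.IH[OF well_formed_ConsD(1)[OF Cons.prems(1)] well_formed_ConsD(1)[OF w] m])
  then have "net_eq ws vs (b # bs) (b # p @ q)"
    by (rule net_eq_Cons) (use Cons.prems w in \<open>auto simp: well_formed_def\<close>)
  then show ?case using net_eq_trans net_eq_sym[OF 1] by blast
qed

end

section \<open>Composite arrows as layered diagrams\<close>

text \<open>
  Composite arrows such as \<open>(Id M \<otimes> \<mu>) \<cdot> (d \<otimes> Id H)\<close> are layers stacked on each other, every layer being
  a tensor product of boxes, crossings and identities.  A layered diagram records this shape
  together with wire names, and \<open>diagram_val\<close> returns exactly the composite that was written down;
  as in a composite, the layer applied first stands last.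
\<close>
datatype ('o, 'a) factor =
    Box 'a "'o wires" "'o wires"
  | Cross "'o wires" "'o wires"
  | Wires "'o wires"

primrec factor_in :: "('o, 'a) factor \<Rightarrow> 'o wires" where
  "factor_in (Box f as bs) = as"
| "factor_in (Cross as bs) = as @ bs"
| "factor_in (Wires as) = as"

primrec factor_out :: "('o, 'a) factor \<Rightarrow> 'o wires" where
  "factor_out (Box f as bs) = bs"
| "factor_out (Cross as bs) = bs @ as"
| "factor_out (Wires as) = as"

primrec factor_boxes :: "('o, 'a) factor \<Rightarrow> ('o, 'a) box list" where
  "factor_boxes (Box f as bs) = [(f, as, bs)]"
| "factor_boxes (Cross as bs) = []"
| "factor_boxes (Wires as) = []"

abbreviation "layer_in l \<equiv> concat (map factor_in l)"
abbreviation "layer_out l \<equiv> concat (map factor_out l)"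
abbreviation "layer_boxes l \<equiv> concat (map factor_boxes l)"

primrec diagram_in :: "('o, 'a) factor list list \<Rightarrow> 'o wires" where
  "diagram_in [] = []"
| "diagram_in (l # ls) = (if ls = [] then layer_in l else diagram_in ls)"

primrec diagram_out :: "('o, 'a) factor list list \<Rightarrow> 'o wires" where
  "diagram_out [] = []"
| "diagram_out (l # ls) = layer_out l"

primrec diagram_boxes :: "('o, 'a) factor list list \<Rightarrow> ('o, 'a) box list" where
  "diagram_boxes [] = []"
| "diagram_boxes (l # ls) = diagram_boxes ls @ layer_boxes l"

context symmetric_category
begin

primrec factor_val :: "('o, 'a) factor \<Rightarrow> 'a" where
  "factor_val (Box f as bs) = f"
| "factor_val (Cross as bs) = c (tens as) (tens bs)"
| "factor_val (Wires as) = Id (tens as)"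

primrec factor_ok :: "('o, 'a) factor \<Rightarrow> bool" where
  "factor_ok (Box f as bs) = box_typed (f, as, bs)"
| "factor_ok (Cross as bs) = (objs as \<and> objs bs)"
| "factor_ok (Wires as) = objs as"

primrec layer_val :: "('o, 'a) factor list \<Rightarrow> 'a" where
  "layer_val [] = Id \<one>"
| "layer_val (x # l) = (if l = [] then factor_val x else factor_val x \<otimes> layer_val l)"

primrec diagram_val :: "('o, 'a) factor list list \<Rightarrow> 'a" where
  "diagram_val [] = Id \<one>"
| "diagram_val (l # ls) = (if ls = [] then layer_val l else layer_val l \<cdot> diagram_val ls)"

primrec diagram_ok :: "('o, 'a) factor list list \<Rightarrow> bool" where
  "diagram_ok [] = False"
| "diagram_ok (l # ls) = (list_all factor_ok l \<and> (ls \<noteq> [] \<longrightarrow> diagram_ok ls \<and> diagram_out ls = layer_in l))"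

lemma factor_net:
  assumes "factor_ok x" "distinct (factor_in x @ all_outputs (factor_boxes x))"
  shows "well_formed (factor_in x) (factor_boxes x) (factor_out x) \<and>
    net (factor_in x) (factor_boxes x) (factor_out x) = factor_val x"
proof (cases x)
  case (Box f as bs)
  then have "objs as" using assms by (simp add: box_typed_def)
  with Box show ?thesis using assms net_single[of f as bs] by (auto simp: well_formed_def)
next
  case (Cross as bs)
  then show ?thesis using assms wiring_braid[of as bs] by (auto simp: well_formed_def)
next
  case (Wires as)
  then show ?thesis using assms wiring_refl[of as] by (auto simp: well_formed_def)
qed

lemma layer_net:
  assumes "list_all factor_ok l" "distinct (layer_in l @ all_outputs (layer_boxes l))"
  shows "well_formed (layer_in l) (layer_boxes l) (layer_out l) \<and>
    net (layer_in l) (layer_boxes l) (layer_out l) = layer_val l"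
  using assms
proof (induction l)
  case Nil
  then show ?case by (simp add: well_formed_def)
next
  case (Cons x l)
  have d: "distinct (factor_in x @ all_outputs (factor_boxes x))"
    "distinct (layer_in l @ all_outputs (layer_boxes l))"
    "set (factor_in x @ all_outputs (factor_boxes x)) \<inter> set (layer_in l @ all_outputs (layer_boxes l)) = {}"
    using Cons.prems(2) by (simp_all del: set_concat) blast+
  have x: "factor_ok x" and l: "list_all factor_ok l" using Cons.prems(1) by simp_all
  note F = factor_net[OF x d(1)] and L = Cons.IH[OF l d(2)]
  note w = well_formed_tensor[OF F[THEN conjunct1] L[THEN conjunct1] d(3)]
    and n = net_tensor[OF F[THEN conjunct1] L[THEN conjunct1] d(3)]
  show ?case
  proof (cases "l = []")
    case True
    then show ?thesis using F by simp
  next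
    case False
    then show ?thesis using w n F L by simp
  qed
qed

lemma diagram_net:
  assumes "diagram_ok d" "distinct (diagram_in d @ all_outputs (diagram_boxes d))"
  shows "well_formed (diagram_in d) (diagram_boxes d) (diagram_out d) \<and>
    net (diagram_in d) (diagram_boxes d) (diagram_out d) = diagram_val d"
  using assms
proof (induction d)
  case (Cons l d)
  show ?case
  proof (cases "d = []")
    case True
    then show ?thesis using Cons.prems layer_net[of l] by simp
  next
    case False
    have p: "list_all factor_ok l" "diagram_ok d" "diagram_out d = layer_in l"
      using Cons.prems(1) False by simp_all
    have d: "distinct (diagram_in d @ all_outputs (diagram_boxes d))"
      "set (all_outputs (layer_boxes l)) \<inter> (set (diagram_in d) \<union> set (all_outputs (diagram_boxes d))) = {}"
      "distinct (all_outputs (layer_boxes l))"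
      using Cons.prems(2) False by (simp_all del: set_concat) blast+
    note D = Cons.IH[OF p(2) d(1)]
    note wd = well_formed_D[OF D[THEN conjunct1], unfolded p(3)]
    have "distinct (layer_in l @ all_outputs (layer_boxes l))"
      using wd(6,7) d(2,3) by (simp del: set_concat) blast
    note L = layer_net[OF p(1) this]
    have w: "well_formed (diagram_in d) (diagram_boxes d @ layer_boxes l) (layer_out l)"
      by (rule well_formed_append[OF D[THEN conjunct1, unfolded p(3)] L[THEN conjunct1] d(2)])
    show ?thesis
      using net_append[OF D[THEN conjunct1, unfolded p(3)] L[THEN conjunct1] w] w D L False p(3) by simp
  qed
qed simp

definition draws :: "('o, 'a) factor list list \<Rightarrow> 'o wires \<Rightarrow>
    ('o, 'a) box list \<Rightarrow> 'o wires \<Rightarrow> bool" where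
  "draws d ws bs vs \<longleftrightarrow> diagram_ok d \<and> distinct (diagram_in d @ all_outputs (diagram_boxes d)) \<and>
     diagram_in d = ws \<and> diagram_boxes d = bs \<and> diagram_out d = vs"

text \<open>
  The bridge between composites and nets.  Crossings leave no trace in the list of boxes, since
  they only change the order in which wires are listed.
\<close>
lemma net_eq_iff:
  assumes "draws d ws bs vs" "draws d' ws bs' vs"
  shows "net_eq ws vs bs bs' \<longleftrightarrow> diagram_val d = diagram_val d'"
  using diagram_net[of d] diagram_net[of d'] assms by (auto simp: draws_def net_eq_def)

lemmas net_eqI = net_eq_iff[THEN iffD2]
lemmas net_eqD = net_eq_iff[THEN iffD1, rotated 2]

lemma mset_all_outputs_cong:
  assumes "mset bs = mset bs'"
  shows "mset (all_outputs bs) = mset (all_outputs bs')"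
proof -
  have "mset (map outputs bs) = mset (map outputs bs')" using assms by simp
  then have "mset (map (mset \<circ> outputs) bs) = mset (map (mset \<circ> outputs) bs')"
    using assms by simp
  then show ?thesis by (simp add: mset_concat sum_mset_sum_list[symmetric] comp_def)
qed

text \<open>
  One step of a computation with nets: reorder the boxes until \<open>l\<close> is consecutive, replace it by
  \<open>l'\<close>, and reorder again.  The boxes \<open>p\<close> are those that have to fire before \<open>l\<close>.
\<close>
lemma net_eq_step:
  assumes loc: "net_eq us us' l l'" and wf: "well_formed ws bs vs" and wf': "well_formed ws bs' vs"
    and wfl: "well_formed ws (p @ l @ q) vs" and us: "set us \<subseteq> set (after ws p)"
    and m: "mset bs = mset (p @ l @ q)" and m': "mset bs' = mset (p @ l' @ q)"
  shows "net_eq ws vs bs bs'"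
proof -
  have "mset (ws @ all_outputs bs') = mset (ws @ all_outputs (p @ l' @ q))"
    using mset_all_outputs_cong[OF m'] by simp
  then have fresh: "distinct (ws @ all_outputs (p @ l' @ q))"
    using wf' mset_eq_imp_distinct_iff unfolding well_formed_def by blast
  note inside = net_eq_inside[OF loc wfl us fresh]
  have "well_formed ws (p @ l' @ q) vs" using inside by (simp add: net_eq_def)
  from net_eq_mset[OF this wf' m'[symmetric]]
  show ?thesis using net_eq_trans[OF net_eq_mset[OF wf wfl m]] net_eq_trans[OF inside] by blast
qed

lemmas well_formed_simps = well_formed_def box_typed_def in_hom
lemmas draws_simps = draws_def box_typed_def in_hom

end

section \<open>Structure maps as rewriting rules\<close>

locale algebra_coalgebra = symmetric_category C c
  for C :: "('o, 'a, 'm) monoidal_category_scheme" (structure)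
    and c :: "'o \<Rightarrow> 'o \<Rightarrow> 'a" +
  fixes H :: 'o and \<mu> \<nu> \<Delta> \<epsilon> :: 'a
  assumes algebra: "unital_algebra C H \<mu> \<nu>"
    and coalgebra: "counital_coalgebra C H \<Delta> \<epsilon>"
begin

lemma H_typed [simp]: "H \<in> Obj C"
    "\<mu> \<in> Arr C" "Dom C \<mu> = H \<otimes>\<^sub>o H" "Cod C \<mu> = H"
    "\<nu> \<in> Arr C" "Dom C \<nu> = \<one>" "Cod C \<nu> = H"
    "\<Delta> \<in> Arr C" "Dom C \<Delta> = H" "Cod C \<Delta> = H \<otimes>\<^sub>o H"
    "\<epsilon> \<in> Arr C" "Dom C \<epsilon> = H" "Cod C \<epsilon> = \<one>"
  using algebra coalgebra by (simp_all add: unital_algebra_def counital_coalgebra_def in_hom)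

lemma mult_assoc: "\<mu> \<cdot> (\<mu> \<otimes> Id H) = \<mu> \<cdot> (Id H \<otimes> \<mu>)"
  and comult_coassoc: "(\<Delta> \<otimes> Id H) \<cdot> \<Delta> = (Id H \<otimes> \<Delta>) \<cdot> \<Delta>"
  using algebra coalgebra by (simp_all add: unital_algebra_def counital_coalgebra_def)

abbreviation "modl \<equiv> left_module C H \<mu> \<nu>"
abbreviation "comodr \<equiv> right_comodule C H \<Delta> \<epsilon>"
abbreviation "ydm \<equiv> YD_module C c H \<mu> \<nu> \<Delta> \<epsilon>"
abbreviation "brYD \<equiv> braid_YD C c"

lemma left_module_typed:
  assumes "modl M l"
  shows "M \<in> Obj C" "l \<in> Arr C" "Dom C l = H \<otimes>\<^sub>o M" "Cod C l = M"
  using assms by (auto simp: left_module_def in_hom)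

lemma right_comodule_typed:
  assumes "comodr M d"
  shows "M \<in> Obj C" "d \<in> Arr C" "Dom C d = M" "Cod C d = M \<otimes>\<^sub>o H"
  using assms by (auto simp: right_comodule_def in_hom)

text \<open>
  Boxes for the structure maps, with the inputs named before the outputs.  In Sweedler's notation
  \<open>comul x y z\<close> reads \<open>x\<^sub>1 = y, x\<^sub>2 = z\<close>, while \<open>act l M x m n\<close> reads \<open>x \<cdot> m = n\<close> and \<open>coact d M m n x\<close>
  reads \<open>m\<^sub>0 = n, m\<^sub>1 = x\<close>.  An identity box \<open>idle\<close> renames a wire; it stands for what remains
  after a unit or counit has been cancelled.
\<close>
abbreviation "mul x y z \<equiv> (\<mu>, [(x :: nat, H), (y :: nat, H)], [(z :: nat, H)])"
abbreviation "comul x y z \<equiv> (\<Delta>, [(x :: nat, H)], [(y :: nat, H), (z :: nat, H)])"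
abbreviation "unit x \<equiv> (\<nu>, [] :: 'o wires, [(x :: nat, H)])"
abbreviation "counit x \<equiv> (\<epsilon>, [(x :: nat, H)], [] :: 'o wires)"
abbreviation "act l M x m n \<equiv> (l :: 'a, [(x :: nat, H), (m :: nat, M)], [(n :: nat, M)])"
abbreviation "coact d M m n x \<equiv> (d :: 'a, [(m :: nat, M)], [(n :: nat, M), (x :: nat, H)])"
abbreviation "idle M m n \<equiv> (Id M, [(m :: nat, M)], [(n :: nat, M)])"

lemma net_eq_mult_assoc:
  assumes "distinct [x, y, z, a, b, w]"
  shows "net_eq [(x, H), (y, H), (z, H)] [(w, H)] [mul x y a, mul a z w] [mul y z b, mul x b w]"
  by (rule net_eqI[of
      "[[Box \<mu> [(a, H), (z, H)] [(w, H)]], [Box \<mu> [(x, H), (y, H)] [(a, H)], Wires [(z, H)]]]" _ _ _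
      "[[Box \<mu> [(x, H), (b, H)] [(w, H)]], [Wires [(x, H)], Box \<mu> [(y, H), (z, H)] [(b, H)]]]"])
    (use assms mult_assoc in \<open>auto simp: draws_simps tens.simps(2)\<close>)

lemma net_eq_comult_coassoc:
  assumes "distinct [h, x, y, z, a, b]"
  shows "net_eq [(h, H)] [(x, H), (y, H), (z, H)] [comul h a z, comul a x y] [comul h x b, comul b y z]"
  by (rule net_eqI[of
      "[[Box \<Delta> [(a, H)] [(x, H), (y, H)], Wires [(z, H)]], [Box \<Delta> [(h, H)] [(a, H), (z, H)]]]" _ _ _
      "[[Wires [(x, H)], Box \<Delta> [(b, H)] [(y, H), (z, H)]], [Box \<Delta> [(h, H)] [(x, H), (b, H)]]]"])
    (use assms comult_coassoc in \<open>auto simp: draws_simps tens.simps(2)\<close>)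

lemma net_eq_action:
  assumes M: "modl M l" and "distinct [x, y, a]" "distinct [m, k, n]"
    and "set [x, y, a] \<inter> set [m, k, n] = {}"
  shows "net_eq [(x, H), (y, H), (m, M)] [(n, M)] [mul x y a, act l M a m n] [act l M y m k, act l M x k n]"
  by (rule net_eqI[of
      "[[Box l [(a, H), (m, M)] [(n, M)]], [Box \<mu> [(x, H), (y, H)] [(a, H)], Wires [(m, M)]]]" _ _ _
      "[[Box l [(x, H), (k, M)] [(n, M)]], [Wires [(x, H)], Box l [(y, H), (m, M)] [(k, M)]]]"])
    (use assms left_module_typed[OF M] M in \<open>auto simp: draws_simps tens.simps(2) left_module_def\<close>)

lemma net_eq_action_unit:
  assumes M: "modl M l" and "distinct [m, n, u]"
  shows "net_eq [(m, M)] [(n, M)] [unit u, act l M u m n] [idle M m n]"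
  by (rule net_eqI[of
      "[[Box l [(u, H), (m, M)] [(n, M)]], [Box \<nu> [] [(u, H)], Wires [(m, M)]]]" _ _ _
      "[[Box (Id M) [(m, M)] [(n, M)]]]"])
    (use assms left_module_typed[OF M] M in \<open>auto simp: draws_simps tens.simps(2) left_module_def\<close>)

lemma net_eq_coaction:
  assumes M: "comodr M d" and "distinct [m, k, n, a, b, e]"
  shows "net_eq [(m, M)] [(n, M), (a, H), (b, H)]
     [coact d M m k b, coact d M k n a]
     [coact d M m n e, comul e a b]"
  by (rule net_eqI[of
      "[[Box d [(k, M)] [(n, M), (a, H)], Wires [(b, H)]], [Box d [(m, M)] [(k, M), (b, H)]]]" _ _ _
      "[[Wires [(n, M)], Box \<Delta> [(e, H)] [(a, H), (b, H)]], [Box d [(m, M)] [(n, M), (e, H)]]]"])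
    (use assms right_comodule_typed[OF M] M in \<open>auto simp: draws_simps tens.simps(2) right_comodule_def\<close>)

lemma net_eq_coaction_counit:
  assumes M: "comodr M d" and "distinct [m, n, a]"
  shows "net_eq [(m, M)] [(n, M)] [coact d M m n a, counit a] [idle M m n]"
  by (rule net_eqI[of
      "[[Wires [(n, M)], Box \<epsilon> [(a, H)] []], [Box d [(m, M)] [(n, M), (a, H)]]]" _ _ _
      "[[Box (Id M) [(m, M)] [(n, M)]]]"])
    (use assms right_comodule_typed[OF M] M in \<open>auto simp: draws_simps tens.simps(2) right_comodule_def\<close>)

lemma YD_module_D:
  assumes "ydm M l d"
  shows "modl M l" "comodr M d"
  using assms by (simp_all add: YD_module_def)

text \<open>
  In elements, the Yetter-Drinfel'd condition is
  \<open>(h\<^sub>2 m)\<^sub>0 \<otimes> (h\<^sub>2 m)\<^sub>1 h\<^sub>1 = h\<^sub>1 m\<^sub>0 \<otimes> h\<^sub>2 m\<^sub>1\<close>.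
\<close>
lemma net_eq_YD_iff:
  assumes t: "M \<in> Obj C" "l \<in> hom (H \<otimes>\<^sub>o M) M" "d \<in> hom M (M \<otimes>\<^sub>o H)"
    and "distinct [h, m, h1, h2, k, b, n, z]" "distinct [h, m, h1', h2', k', b', n, z]"
  shows "net_eq [(h, H), (m, M)] [(n, M), (z, H)]
     [comul h h1 h2, act l M h2 m k, coact d M k n b, mul b h1 z]
     [comul h h1' h2', coact d M m k' b', act l M h1' k' n, mul h2' b' z]
    \<longleftrightarrow> (Id M \<otimes> \<mu>) \<cdot> (d \<otimes> Id H) \<cdot> c H M \<cdot> (Id H \<otimes> l) \<cdot> (\<Delta> \<otimes> Id M)
      = (l \<otimes> \<mu>) \<cdot> (Id H \<otimes> c H M \<otimes> Id H) \<cdot> (\<Delta> \<otimes> d)"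
  by (subst net_eq_iff[of
      "[[Wires [(n, M)], Box \<mu> [(b, H), (h1, H)] [(z, H)]], [Box d [(k, M)] [(n, M), (b, H)], Wires [(h1, H)]],
        [Cross [(h1, H)] [(k, M)]], [Wires [(h1, H)], Box l [(h2, H), (m, M)] [(k, M)]],
        [Box \<Delta> [(h, H)] [(h1, H), (h2, H)], Wires [(m, M)]]]" _ _ _
      "[[Box l [(h1', H), (k', M)] [(n, M)], Box \<mu> [(h2', H), (b', H)] [(z, H)]],
        [Wires [(h1', H)], Cross [(h2', H)] [(k', M)], Wires [(b', H)]],
        [Box \<Delta> [(h, H)] [(h1', H), (h2', H)], Box d [(m, M)] [(k', M), (b', H)]]]"])
    (use assms in \<open>auto simp: draws_simps tens.simps(2)\<close>)

text \<open>
  Evaluates the bookkeeping of concrete nets: typing and freshness of wires, and comparison of lists of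
  boxes up to order.
\<close>
lemmas net_simps = well_formed_simps draws_def tens.simps(2) add_mset_commute

section \<open>Yetter-Drinfel'd modules and the Yang-Baxter equation\<close>

text \<open>
  In elements, \<open>m \<otimes> n\<close> is sent to \<open>n\<^sub>0 \<otimes> n\<^sub>1 m\<close>.
\<close>
lemma net_eq_braid_YD:
  assumes M: "ydm M lM dM" and N: "ydm N lN dN"
    and "distinct [m, n, m', n', a]"
  shows "net_eq [(m, M), (n, N)] [(n', N), (m', M)]
     [(brYD (M, lM, dM) (N, lN, dN), [(m, M), (n, N)], [(n', N), (m', M)])]
     [coact dN N n n' a, act lM M a m m']"
proof -
  note [simp] = net_simps
  note t [simp] = left_module_typed[OF YD_module_D(1)[OF M]] right_comodule_typed[OF YD_module_D(2)[OF N]]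
  show ?thesis
    by (rule net_eqI[of
      "[[Box (brYD (M, lM, dM) (N, lN, dN)) [(m, M), (n, N)] [(n', N), (m', M)]]]" _ _ _
      "[[Wires [(n', N)], Box lM [(a, H), (m, M)] [(m', M)]], [Box dN [(n, N)] [(n', N), (a, H)], Wires [(m, M)]], [Cross [(m, M)] [(n, N)]]]"])
     (use assms t in \<open>auto simp: braid_YD_def\<close>)
qed

lemma net_eq_YD:
  assumes M: "ydm M l d"
    and "distinct [h, m, h1, h2, k, b, n, z]" "distinct [h, m, h1', h2', k', b', n, z]"
  shows "net_eq [(h, H), (m, M)] [(n, M), (z, H)]
     [comul h h1 h2, act l M h2 m k, coact d M k n b, mul b h1 z]
     [comul h h1' h2', coact d M m k' b', act l M h1' k' n, mul h2' b' z]"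
  using M left_module_typed[OF YD_module_D(1)[OF M]] right_comodule_typed[OF YD_module_D(2)[OF M]]
  by (subst net_eq_YD_iff) (use assms in \<open>simp_all add: in_hom YD_module_def\<close>)

lemma braid_YD_typed:
  assumes M: "ydm M lM dM" and N: "ydm N lN dN"
  shows "brYD (M, lM, dM) (N, lN, dN) \<in> hom (M \<otimes>\<^sub>o N) (N \<otimes>\<^sub>o M)"
  using left_module_typed[OF YD_module_D(1)[OF M]] right_comodule_typed[OF YD_module_D(2)[OF N]]
  by (simp add: in_hom braid_YD_def)

text \<open>
  Apply both sides to \<open>x \<otimes> y \<otimes> z\<close>.  After coassociativity of the coaction the left side becomes
  \<open>z\<^sub>0 \<otimes> z\<^sub>1 y\<^sub>0 \<otimes> z\<^sub>2 (y\<^sub>1 x)\<close> and the right side \<open>z\<^sub>0 \<otimes> (z\<^sub>2 y)\<^sub>0 \<otimes> (z\<^sub>2 y)\<^sub>1 (z\<^sub>1 x)\<close>, and these agree by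
  the Yetter-Drinfel'd condition for \<open>y\<close>, with the component of \<open>z\<close> in \<open>H\<close> in the role of \<open>h\<close>.
  In this and all later computations, wires numbered below 10 carry modules and all other wires
  carry \<open>H\<close>.
\<close>
lemma braid_YD_YB:
  assumes M: "ydm M l d"
  shows "braiding_for_object C M (brYD (M, l, d) (M, l, d))"
proof -
  let ?s = "brYD (M, l, d) (M, l, d)"
  let ?S = "\<lambda>x y u v. (?s, [(x :: nat, M), (y :: nat, M)], [(u :: nat, M), (v :: nat, M)])"
  let ?i = "[(0 :: nat, M), (1, M), (2, M)]" and ?o = "[(7 :: nat, M), (8, M), (6, M)]"
  note mod = YD_module_D(1)[OF M] and comod = YD_module_D(2)[OF M]
  note [simp] = net_simps
  note t [simp] = left_module_typed[OF mod] right_comodule_typed[OF comod] braid_YD_typed[OF M M, unfolded in_hom]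
  have "net_eq ?i ?o
     [?S 0 1 3 4, ?S 4 2 5 6, ?S 3 5 7 8]
     [coact d M 1 3 10, act l M 10 0 4, ?S 4 2 5 6, ?S 3 5 7 8]"
    by (rule net_eq_step[OF net_eq_braid_YD[OF M M, of 0 1 4 3 10], where p = "[]" and q = "[?S 4 2 5 6, ?S 3 5 7 8]"]) auto
  also have "net_eq ?i ?o
     \<dots>
     [coact d M 1 3 10, act l M 10 0 4, coact d M 2 5 11, act l M 11 4 6, ?S 3 5 7 8]"
    by (rule net_eq_step[OF net_eq_braid_YD[OF M M, of 4 2 6 5 11],
        where p = "[coact d M 1 3 10, act l M 10 0 4]" and q = "[?S 3 5 7 8]"]) auto
  also have "net_eq ?i ?o
     \<dots>
     [coact d M 1 3 10, act l M 10 0 4, coact d M 2 5 11, act l M 11 4 6,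
      coact d M 5 7 12, act l M 12 3 8]"
    by (rule net_eq_step[OF net_eq_braid_YD[OF M M, of 3 5 8 7 12],
        where p = "[coact d M 1 3 10, act l M 10 0 4, coact d M 2 5 11, act l M 11 4 6]" and q = "[]"]) auto
  also have "net_eq ?i ?o
     \<dots>
     [coact d M 2 7 13, comul 13 12 11, coact d M 1 3 10,
      act l M 10 0 4, act l M 11 4 6, act l M 12 3 8]"
    by (rule net_eq_step[OF net_eq_coaction[OF comod, of 2 5 7 12 11 13],
        where p = "[]" and q = "[coact d M 1 3 10, act l M 10 0 4, act l M 11 4 6, act l M 12 3 8]"]) auto
  finally have lhs: "net_eq ?i ?o
     [?S 0 1 3 4, ?S 4 2 5 6, ?S 3 5 7 8]
     [coact d M 2 7 13, comul 13 12 11,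
      coact d M 1 3 10, act l M 10 0 4, act l M 11 4 6, act l M 12 3 8]" .
  have "net_eq ?i ?o
     [?S 1 2 5 4, ?S 0 5 7 3, ?S 3 4 8 6]
     [coact d M 2 5 11, act l M 11 1 4, ?S 0 5 7 3, ?S 3 4 8 6]"
    by (rule net_eq_step[OF net_eq_braid_YD[OF M M, of 1 2 4 5 11], where p = "[]" and q = "[?S 0 5 7 3, ?S 3 4 8 6]"]) auto
  also have "net_eq ?i ?o
     \<dots>
     [coact d M 2 5 11, act l M 11 1 4, coact d M 5 7 12, act l M 12 0 3, ?S 3 4 8 6]"
    by (rule net_eq_step[OF net_eq_braid_YD[OF M M, of 0 5 3 7 12],
        where p = "[coact d M 2 5 11, act l M 11 1 4]" and q = "[?S 3 4 8 6]"]) auto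
  also have "net_eq ?i ?o
     \<dots>
     [coact d M 2 5 11, act l M 11 1 4, coact d M 5 7 12, act l M 12 0 3,
      coact d M 4 8 14, act l M 14 3 6]"
    by (rule net_eq_step[OF net_eq_braid_YD[OF M M, of 3 4 6 8 14],
        where p = "[coact d M 2 5 11, act l M 11 1 4, coact d M 5 7 12, act l M 12 0 3]" and q = "[]"]) auto
  also have "net_eq ?i ?o
     \<dots>
     [coact d M 2 7 13, comul 13 12 11, act l M 11 1 4, coact d M 4 8 14,
      act l M 12 0 3, act l M 14 3 6]"
    by (rule net_eq_step[OF net_eq_coaction[OF comod, of 2 5 7 12 11 13],
        where p = "[]" and q = "[act l M 11 1 4, act l M 12 0 3, coact d M 4 8 14, act l M 14 3 6]"]) auto
  also have "net_eq ?i ?o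
     \<dots>
     [coact d M 2 7 13, comul 13 12 11, act l M 11 1 4, coact d M 4 8 14,
      mul 14 12 15, act l M 15 0 6]"
    by (rule net_eq_step[OF net_eq_sym[OF net_eq_action[OF mod, of 14 12 15 0 3 6]],
        where p = "[coact d M 2 7 13, comul 13 12 11, act l M 11 1 4, coact d M 4 8 14]" and q = "[]"]) auto
  also have "net_eq ?i ?o
     \<dots>
     [coact d M 2 7 13, comul 13 12 11, coact d M 1 3 10, act l M 12 3 8,
      mul 11 10 15, act l M 15 0 6]"
    by (rule net_eq_step[OF net_eq_YD[OF M, of 13 1 12 11 4 14 8 15 12 11 3 10],
        where p = "[coact d M 2 7 13]" and q = "[act l M 15 0 6]"]) auto
  also have "net_eq ?i ?o
     \<dots>
     [coact d M 2 7 13, comul 13 12 11,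
      coact d M 1 3 10, act l M 10 0 4, act l M 11 4 6, act l M 12 3 8]"
    by (rule net_eq_step[OF net_eq_action[OF mod, of 11 10 15 0 4 6],
        where p = "[coact d M 2 7 13, comul 13 12 11, coact d M 1 3 10, act l M 12 3 8]" and q = "[]"]) auto
  finally have rhs: "net_eq ?i ?o [?S 1 2 5 4, ?S 0 5 7 3, ?S 3 4 8 6] [coact d M 2 7 13, comul 13 12 11,
      coact d M 1 3 10, act l M 10 0 4, act l M 11 4 6, act l M 12 3 8]" .
  from net_eq_trans[OF lhs net_eq_sym[OF rhs]]
  have "diagram_val [[Box ?s [(3, M), (5, M)] [(7, M), (8, M)], Wires [(6, M)]],
      [Wires [(3, M)], Box ?s [(4, M), (2, M)] [(5, M), (6, M)]],
      [Box ?s [(0, M), (1, M)] [(3, M), (4, M)], Wires [(2, M)]]]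
    = diagram_val [[Wires [(7, M)], Box ?s [(3, M), (4, M)] [(8, M), (6, M)]],
      [Box ?s [(0, M), (5, M)] [(7, M), (3, M)], Wires [(4, M)]],
      [Wires [(0, M)], Box ?s [(1, M), (2, M)] [(5, M), (4, M)]]]"
    by (rule net_eqD) auto
  then have "(?s \<otimes> Id M) \<cdot> (Id M \<otimes> ?s) \<cdot> (?s \<otimes> Id M) = (Id M \<otimes> ?s) \<cdot> (?s \<otimes> Id M) \<cdot> (Id M \<otimes> ?s)"
    by simp
  then show ?thesis
    using t by (simp add: braiding_for_object_def in_hom)
qed

end

section \<open>Coactions from a weak R-matrix\<close>

context algebra_coalgebra
begin

abbreviation "mor f M N m n \<equiv> (f :: 'a, [(m :: nat, M)], [(n :: nat, N)])"

lemma net_eq_module_hom: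
  assumes M: "modl M lM" and N: "modl N lN"
    and f: "f \<in> hom M N" "module_hom C H lM f lN" and "distinct [h, m, k, n, k']"
  shows "net_eq [(h, H), (m, M)] [(n, N)] [act lM M h m k, mor f M N k n] [mor f M N m k', act lN N h k' n]"
  by (rule net_eqI[of
      "[[Box f [(k, M)] [(n, N)]], [Box lM [(h, H), (m, M)] [(k, M)]]]" _ _ _
      "[[Box lN [(h, H), (k', N)] [(n, N)]], [Wires [(h, H)], Box f [(m, M)] [(k', N)]]]"])
    (use assms left_module_typed[OF M] left_module_typed[OF N] in \<open>auto simp: net_simps module_hom_def\<close>)

lemma net_eq_comodule_hom:
  assumes M: "comodr M dM" and N: "comodr N dN"
    and f: "f \<in> hom M N" "comodule_hom C H dM f dN" and "distinct [m, k, n, k', a]"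
  shows "net_eq [(m, M)] [(n, N), (a, H)] [mor f M N m k, coact dN N k n a] [coact dM M m k' a, mor f M N k' n]"
  by (rule net_eqI[of
      "[[Box dN [(k, N)] [(n, N), (a, H)]], [Box f [(m, M)] [(k, N)]]]" _ _ _
      "[[Box f [(k', M)] [(n, N)], Wires [(a, H)]], [Box dM [(m, M)] [(k', M), (a, H)]]]"])
    (use assms right_comodule_typed[OF M] right_comodule_typed[OF N] in \<open>auto simp: net_simps comodule_hom_def\<close>)

end

locale weakly_quasitriangular = algebra_coalgebra C c H \<mu> \<nu> \<Delta> \<epsilon>
  for C :: "('o, 'a, 'm) monoidal_category_scheme" (structure)
    and c :: "'o \<Rightarrow> 'o \<Rightarrow> 'a" and H :: 'o and \<mu> \<nu> \<Delta> \<epsilon> :: 'a +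
  fixes R :: 'a
  assumes weak: "weak_R_matrix C c H \<mu> \<nu> \<Delta> \<epsilon> R"
begin

lemma R_typed [simp]: "R \<in> Arr C" "Dom C R = \<one>" "Cod C R = H \<otimes>\<^sub>o H"
  using weak by (simp_all add: weak_R_matrix_def in_hom)

abbreviation "rmat x y \<equiv> (R, [] :: 'o wires, [(x :: nat, H), (y :: nat, H)])"
abbreviation "coaR M l \<equiv> coaction_R C c H R M l"

lemma net_eq_R_comult:
  assumes "distinct [e, z, x1, x2, y1, y2]"
  shows "net_eq [] [(x1, H), (x2, H), (z, H)] [rmat e z, comul e x1 x2]
     [rmat x1 y1, rmat x2 y2, mul y1 y2 z]"
  by (rule net_eqI[of
      "[[Box \<Delta> [(e, H)] [(x1, H), (x2, H)], Wires [(z, H)]], [Box R [] [(e, H), (z, H)]]]" _ _ _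
      "[[Wires [(x1, H), (x2, H)], Box \<mu> [(y1, H), (y2, H)] [(z, H)]],
        [Wires [(x1, H)], Cross [(y1, H)] [(x2, H)], Wires [(y2, H)]],
        [Box R [] [(x1, H), (y1, H)], Box R [] [(x2, H), (y2, H)]]]"])
    (use assms weak in \<open>auto simp: net_simps weak_R_matrix_def c_sq_def\<close>)

lemma net_eq_R_counit:
  assumes "distinct [e, z]"
  shows "net_eq [] [(z, H)] [rmat e z, counit e] [unit z]"
  by (rule net_eqI[of
      "[[Box \<epsilon> [(e, H)] [], Wires [(z, H)]], [Box R [] [(e, H), (z, H)]]]" _ _ _
      "[[Box \<nu> [] [(z, H)]]]"])
    (use assms weak in \<open>auto simp: net_simps weak_R_matrix_def\<close>)

text \<open>
  With \<open>R\<close> written as \<open>r \<otimes> s\<close>, this is \<open>r h\<^sub>1 \<otimes> s h\<^sub>2 = h\<^sub>2 r \<otimes> h\<^sub>1 s\<close>.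
\<close>
lemma net_eq_R_intertwines:
  assumes "distinct [h, r, s, p, q, a, b]"
  shows "net_eq [(h, H)] [(a, H), (b, H)]
      [rmat r s, comul h p q, mul r p a, mul s q b]
      [comul h p q, rmat r s, mul q r a, mul p s b]"
proof -
  have op: "comult_op C c H \<Delta> \<otimes> R = (c H H \<otimes> Id (H \<otimes>\<^sub>o H)) \<cdot> (\<Delta> \<otimes> R)"
    by (simp add: comult_op_def interchange)
  have "(\<mu> \<otimes> \<mu>) \<cdot> (c_sq C c H \<cdot> (R \<otimes> \<Delta>))
      = (\<mu> \<otimes> \<mu>) \<cdot> (c_sq C c H \<cdot> ((c H H \<otimes> Id (H \<otimes>\<^sub>o H)) \<cdot> (\<Delta> \<otimes> R)))"
    using weak unfolding weak_R_matrix_def op by (simp add: mult_HH_def c_sq_def comp_assoc)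
  then show ?thesis
    by (intro net_eqI[of
      "[[Box \<mu> [(r, H), (p, H)] [(a, H)], Box \<mu> [(s, H), (q, H)] [(b, H)]],
        [Wires [(r, H)], Cross [(s, H)] [(p, H)], Wires [(q, H)]],
        [Box R [] [(r, H), (s, H)], Box \<Delta> [(h, H)] [(p, H), (q, H)]]]" _ _ _
      "[[Box \<mu> [(q, H), (r, H)] [(a, H)], Box \<mu> [(p, H), (s, H)] [(b, H)]],
        [Wires [(q, H)], Cross [(p, H)] [(r, H)], Wires [(s, H)]],
        [Cross [(p, H)] [(q, H)], Wires [(r, H), (s, H)]],
        [Box \<Delta> [(h, H)] [(p, H), (q, H)], Box R [] [(r, H), (s, H)]]]"])
      (use assms in \<open>auto simp: net_simps c_sq_def\<close>)
qed

lemma coaR_typed: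
  assumes "modl M l"
  shows "coaR M l \<in> Arr C" "Dom C (coaR M l) = M" "Cod C (coaR M l) = M \<otimes>\<^sub>o H"
  using left_module_typed[OF assms] by (simp_all add: coaction_R_def)

lemma net_eq_coaR:
  assumes M: "modl M l" and "distinct [m, n, h, k]"
  shows "net_eq [(m, M)] [(n, M), (h, H)] [coact (coaR M l) M m n h] [rmat h k, act l M k m n]"
  by (rule net_eqI[of "[[Box (coaR M l) [(m, M)] [(n, M), (h, H)]]]" _ _ _
     "[[Cross [(h, H)] [(n, M)]], [Wires [(h, H)], Box l [(k, H), (m, M)] [(n, M)]],
       [Box R [] [(h, H), (k, H)], Wires [(m, M)]]]"])
    (use assms left_module_typed[OF M] coaR_typed[OF M] in \<open>auto simp: net_simps coaction_R_def\<close>)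

text \<open>
  The coaction sends \<open>m\<close> to \<open>s m \<otimes> r\<close>.  Applying it twice produces two copies of \<open>R\<close> with their second
  legs multiplied, which by the formula for \<open>\<Delta>\<close> on the first leg is one copy of \<open>R\<close> with that leg
  split.  Counitality is the condition \<open>\<epsilon>(r) s = 1\<close>.
\<close>
lemma coaR_comodule:
  assumes M: "modl M l"
  shows "comodr M (coaR M l)"
proof -
  let ?d = "coaR M l"
  let ?i = "[(0 :: nat, M)]" and ?o = "[(3 :: nat, M), (10, H), (11, H)]"
  note [simp] = net_simps
  note t [simp] = left_module_typed[OF M] coaR_typed[OF M]
  have "net_eq ?i ?o [coact ?d M 0 2 11, coact ?d M 2 3 10] [rmat 11 12, act l M 12 0 2, coact ?d M 2 3 10]"
    by (rule net_eq_step[OF net_eq_coaR[OF M, of 0 2 11 12], where p = "[]" and q = "[coact ?d M 2 3 10]"]) auto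
  also have "net_eq ?i ?o \<dots> [rmat 11 12, act l M 12 0 2, rmat 10 13, act l M 13 2 3]"
    by (rule net_eq_step[OF net_eq_coaR[OF M, of 2 3 10 13],
        where p = "[rmat 11 12, act l M 12 0 2]" and q = "[]"]) auto
  also have "net_eq ?i ?o \<dots> [rmat 10 13, rmat 11 12, mul 13 12 14, act l M 14 0 3]"
    by (rule net_eq_step[OF net_eq_sym[OF net_eq_action[OF M, of 13 12 14 0 2 3]],
        where p = "[rmat 10 13, rmat 11 12]" and q = "[]"]) auto
  also have "net_eq ?i ?o \<dots> [rmat 15 14, comul 15 10 11, act l M 14 0 3]"
    by (rule net_eq_step[OF net_eq_sym[OF net_eq_R_comult[of 15 14 10 11 13 12]],
        where p = "[]" and q = "[act l M 14 0 3]"]) auto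
  also have "net_eq ?i ?o \<dots> [coact ?d M 0 3 15, comul 15 10 11]"
    by (rule net_eq_step[OF net_eq_sym[OF net_eq_coaR[OF M, of 0 3 15 14]],
        where p = "[]" and q = "[comul 15 10 11]"]) auto
  finally have "diagram_val [[Box ?d [(2, M)] [(3, M), (10, H)], Wires [(11, H)]], [Box ?d [(0, M)] [(2, M), (11, H)]]]
     = diagram_val [[Wires [(3, M)], Box \<Delta> [(15, H)] [(10, H), (11, H)]], [Box ?d [(0, M)] [(3, M), (15, H)]]]"
    by (rule net_eqD) auto
  then have coassoc: "(?d \<otimes> Id H) \<cdot> ?d = (Id M \<otimes> \<Delta>) \<cdot> ?d" by simp
  have "net_eq ?i [(3, M)] [coact ?d M 0 3 10, counit 10] [rmat 10 11, act l M 11 0 3, counit 10]"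
    by (rule net_eq_step[OF net_eq_coaR[OF M, of 0 3 10 11], where p = "[]" and q = "[counit 10]"]) auto
  also have "net_eq ?i [(3, M)] \<dots> [unit 11, act l M 11 0 3]"
    by (rule net_eq_step[OF net_eq_R_counit[of 10 11], where p = "[]" and q = "[act l M 11 0 3]"]) auto
  also have "net_eq ?i [(3, M)] \<dots> [idle M 0 3]"
    by (rule net_eq_action_unit[OF M]) simp
  finally have "diagram_val [[Wires [(3, M)], Box \<epsilon> [(10, H)] []], [Box ?d [(0, M)] [(3, M), (10, H)]]]
     = diagram_val [[Box (Id M) [(0, M)] [(3, M)]]]"
    by (rule net_eqD) auto
  then have "(Id M \<otimes> \<epsilon>) \<cdot> ?d = Id M" by simp
  with coassoc show ?thesis using t by (simp add: right_comodule_def in_hom)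
qed

text \<open>
  The two sides of the Yetter-Drinfel'd condition are the two sides of the intertwining property of
  \<open>R\<close>, with the second leg applied to \<open>m\<close>: \<open>(s h\<^sub>2) m \<otimes> r h\<^sub>1\<close> against \<open>(h\<^sub>1 s) m \<otimes> h\<^sub>2 r\<close>.
\<close>
theorem YD_module_R:
  assumes M: "modl M l"
  shows "ydm M l (coaR M l)"
proof -
  let ?d = "coaR M l"
  let ?i = "[(10 :: nat, H), (0, M)]" and ?o = "[(3 :: nat, M), (14, H)]"
  note [simp] = net_simps
  note t [simp] = left_module_typed[OF M] coaR_typed[OF M]
  have "net_eq ?i ?o [comul 10 11 12, act l M 12 0 2, coact ?d M 2 3 13, mul 13 11 14]
      [comul 10 11 12, act l M 12 0 2, rmat 13 15, act l M 15 2 3, mul 13 11 14]"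
    by (rule net_eq_step[OF net_eq_coaR[OF M, of 2 3 13 15],
        where p = "[comul 10 11 12, act l M 12 0 2]" and q = "[mul 13 11 14]"]) auto
  also have "net_eq ?i ?o \<dots> [comul 10 11 12, rmat 13 15, mul 15 12 16, mul 13 11 14, act l M 16 0 3]"
    by (rule net_eq_step[OF net_eq_sym[OF net_eq_action[OF M, of 15 12 16 0 2 3]],
        where p = "[comul 10 11 12, rmat 13 15]" and q = "[mul 13 11 14]"]) auto
  also have "net_eq ?i ?o \<dots> [comul 10 11 12, rmat 13 15, mul 12 13 14, mul 11 15 16, act l M 16 0 3]"
    by (rule net_eq_step[OF net_eq_R_intertwines[of 10 13 15 11 12 14 16],
        where p = "[]" and q = "[act l M 16 0 3]"]) auto
  also have "net_eq ?i ?o \<dots> [comul 10 11 12, rmat 13 15, mul 12 13 14, act l M 15 0 4, act l M 11 4 3]"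
    by (rule net_eq_step[OF net_eq_action[OF M, of 11 15 16 0 4 3],
        where p = "[comul 10 11 12, rmat 13 15, mul 12 13 14]" and q = "[]"]) auto
  also have "net_eq ?i ?o \<dots> [comul 10 11 12, coact ?d M 0 4 13, act l M 11 4 3, mul 12 13 14]"
    by (rule net_eq_step[OF net_eq_sym[OF net_eq_coaR[OF M, of 0 4 13 15]],
        where p = "[comul 10 11 12]" and q = "[act l M 11 4 3, mul 12 13 14]"]) auto
  finally have "(Id M \<otimes> \<mu>) \<cdot> (?d \<otimes> Id H) \<cdot> c H M \<cdot> (Id H \<otimes> l) \<cdot> (\<Delta> \<otimes> Id M)
      = (l \<otimes> \<mu>) \<cdot> (Id H \<otimes> c H M \<otimes> Id H) \<cdot> (\<Delta> \<otimes> ?d)"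
    by (subst (asm) net_eq_YD_iff) (use t in \<open>auto simp: in_hom\<close>)
  then show ?thesis
    using M coaR_comodule[OF M] by (simp add: YD_module_def)
qed

text \<open>
  Both send \<open>m \<otimes> n\<close> to \<open>s n \<otimes> r m\<close>.
\<close>
theorem braid_R_eq_braid_YD:
  assumes M: "modl M lM" and N: "modl N lN"
  shows "braid_R C c H R (M, lM) (N, lN)
    = brYD (M, lM, coaR M lM) (N, lN, coaR N lN)"
proof -
  let ?i = "[(0 :: nat, M), (1, N)]" and ?o = "[(3 :: nat, N), (2, M)]"
  note [simp] = net_simps
  note t [simp] = left_module_typed[OF M] left_module_typed[OF N] coaR_typed[OF N]
  have "net_eq ?i ?o [coact (coaR N lN) N 1 3 10, act lM M 10 0 2] [rmat 10 11, act lM M 10 0 2, act lN N 11 1 3]"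
    by (rule net_eq_step[OF net_eq_coaR[OF N, of 1 3 10 11], where p = "[]" and q = "[act lM M 10 0 2]"]) auto
  then have "diagram_val [[Wires [(3, N)], Box lM [(10, H), (0, M)] [(2, M)]],
       [Box (coaR N lN) [(1, N)] [(3, N), (10, H)], Wires [(0, M)]], [Cross [(0, M)] [(1, N)]]]
    = diagram_val [[Cross [(2, M)] [(3, N)]], [Box lM [(10, H), (0, M)] [(2, M)], Box lN [(11, H), (1, N)] [(3, N)]],
       [Wires [(10, H)], Cross [(11, H)] [(0, M)], Wires [(1, N)]],
       [Box R [] [(10, H), (11, H)], Wires [(0, M), (1, N)]]]"
    by (rule net_eqD) auto
  then show ?thesis by (simp add: braid_R_def braid_YD_def)
qed

text \<open>
  The coaction is built from \<open>R\<close> and the action alone, so whatever commutes with the action commutes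
  with the coaction.  This is why modules form a full subcategory.
\<close>
lemma module_hom_comodule_hom:
  assumes M: "modl M lM" and N: "modl N lN"
    and f: "f \<in> hom M N" "module_hom C H lM f lN"
  shows "comodule_hom C H (coaR M lM) f (coaR N lN)"
proof -
  let ?i = "[(0 :: nat, M)]" and ?o = "[(2 :: nat, N), (10, H)]"
  note [simp] = net_simps
  note t [simp] = left_module_typed[OF M] left_module_typed[OF N] coaR_typed[OF M] coaR_typed[OF N] f(1)[unfolded in_hom]
  have "net_eq ?i ?o [mor f M N 0 1, coact (coaR N lN) N 1 2 10]
      [mor f M N 0 1, rmat 10 11, act lN N 11 1 2]"
    by (rule net_eq_step[OF net_eq_coaR[OF N, of 1 2 10 11],
        where p = "[mor f M N 0 1]" and q = "[]"]) auto
  also have "net_eq ?i ?o \<dots>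
      [rmat 10 11, act lM M 11 0 3, mor f M N 3 2]"
    by (rule net_eq_step[OF net_eq_sym[OF net_eq_module_hom[OF M N f, of 11 0 3 2 1]],
        where p = "[rmat 10 11]" and q = "[]"]) auto
  also have "net_eq ?i ?o \<dots>
      [coact (coaR M lM) M 0 3 10, mor f M N 3 2]"
    by (rule net_eq_step[OF net_eq_sym[OF net_eq_coaR[OF M, of 0 3 10 11]],
        where p = "[]" and q = "[mor f M N 3 2]"]) auto
  finally have "diagram_val [[Box (coaR N lN) [(1, N)] [(2, N), (10, H)]], [Box f [(0, M)] [(1, N)]]]
    = diagram_val [[Box f [(3, M)] [(2, N)], Wires [(10, H)]], [Box (coaR M lM) [(0, M)] [(3, M), (10, H)]]]"
    by (rule net_eqD) auto
  then show ?thesis by (simp add: comodule_hom_def)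
qed

end

section \<open>Bialgebras and tensor products of actions and coactions\<close>

locale bialgebra_object = algebra_coalgebra C c H \<mu> \<nu> \<Delta> \<epsilon>
  for C :: "('o, 'a, 'm) monoidal_category_scheme" (structure)
    and c :: "'o \<Rightarrow> 'o \<Rightarrow> 'a" and H :: 'o and \<mu> \<nu> \<Delta> \<epsilon> :: 'a +
  assumes bialg: "bialgebra C c H \<mu> \<nu> \<Delta> \<epsilon>"
begin

abbreviation "tact \<equiv> tensor_action C c H \<Delta>"
abbreviation "tcoact \<equiv> tensor_coaction C c H \<mu>"

lemma net_eq_mult_comult:
  assumes "distinct [x, y, z, x1, x2, y1, y2, a, b]"
  shows "net_eq [(x, H), (y, H)] [(a, H), (b, H)] [mul x y z, comul z a b]
    [comul x x1 x2, comul y y1 y2, mul x1 y1 a, mul x2 y2 b]"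
  by (rule net_eqI[of
      "[[Box \<Delta> [(z, H)] [(a, H), (b, H)]], [Box \<mu> [(x, H), (y, H)] [(z, H)]]]" _ _ _
      "[[Box \<mu> [(x1, H), (y1, H)] [(a, H)], Box \<mu> [(x2, H), (y2, H)] [(b, H)]],
        [Wires [(x1, H)], Cross [(x2, H)] [(y1, H)], Wires [(y2, H)]],
        [Box \<Delta> [(x, H)] [(x1, H), (x2, H)], Box \<Delta> [(y, H)] [(y1, H), (y2, H)]]]"])
    (use assms bialg in \<open>auto simp: net_simps bialgebra_def mult_HH_def c_sq_def comp_assoc\<close>)

lemma net_eq_unit_comult:
  assumes "distinct [z, a, b]"
  shows "net_eq [] [(a, H), (b, H)] [unit z, comul z a b] [unit a, unit b]"
  by (rule net_eqI[of
      "[[Box \<Delta> [(z, H)] [(a, H), (b, H)]], [Box \<nu> [] [(z, H)]]]" _ _ _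
      "[[Box \<nu> [] [(a, H)], Box \<nu> [] [(b, H)]]]"])
    (use assms bialg in \<open>auto simp: net_simps bialgebra_def\<close>)

lemma net_eq_mult_counit:
  assumes "distinct [x, y, z]"
  shows "net_eq [(x, H), (y, H)] [] [mul x y z, counit z] [counit x, counit y]"
  by (rule net_eqI[of
      "[[Box \<epsilon> [(z, H)] []], [Box \<mu> [(x, H), (y, H)] [(z, H)]]]" _ _ _
      "[[Box \<epsilon> [(x, H)] [], Box \<epsilon> [(y, H)] []]]"])
    (use assms bialg in \<open>auto simp: net_simps bialgebra_def\<close>)

lemma net_eq_unit_mult:
  assumes "distinct [x, y, u]"
  shows "net_eq [(x, H)] [(y, H)] [unit u, mul u x y] [idle H x y]"
  by (rule net_eqI[of
      "[[Box \<mu> [(u, H), (x, H)] [(y, H)]], [Box \<nu> [] [(u, H)], Wires [(x, H)]]]" _ _ _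
      "[[Box (Id H) [(x, H)] [(y, H)]]]"])
    (use assms algebra in \<open>auto simp: net_simps unital_algebra_def\<close>)

lemma net_eq_mult_unit:
  assumes "distinct [x, y, u]"
  shows "net_eq [(x, H)] [(y, H)] [unit u, mul x u y] [idle H x y]"
  by (rule net_eqI[of
      "[[Box \<mu> [(x, H), (u, H)] [(y, H)]], [Wires [(x, H)], Box \<nu> [] [(u, H)]]]" _ _ _
      "[[Box (Id H) [(x, H)] [(y, H)]]]"])
    (use assms algebra in \<open>auto simp: net_simps unital_algebra_def\<close>)

lemma net_eq_counit_comult:
  assumes "distinct [x, y, u]"
  shows "net_eq [(x, H)] [(y, H)] [comul x u y, counit u] [idle H x y]"
  by (rule net_eqI[of
      "[[Box \<epsilon> [(u, H)] [], Wires [(y, H)]], [Box \<Delta> [(x, H)] [(u, H), (y, H)]]]" _ _ _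
      "[[Box (Id H) [(x, H)] [(y, H)]]]"])
    (use assms coalgebra in \<open>auto simp: net_simps counital_coalgebra_def\<close>)

lemma net_eq_comult_counit:
  assumes "distinct [x, y, u]"
  shows "net_eq [(x, H)] [(y, H)] [comul x y u, counit u] [idle H x y]"
  by (rule net_eqI[of
      "[[Wires [(y, H)], Box \<epsilon> [(u, H)] []], [Box \<Delta> [(x, H)] [(y, H), (u, H)]]]" _ _ _
      "[[Box (Id H) [(x, H)] [(y, H)]]]"])
    (use assms coalgebra in \<open>auto simp: net_simps counital_coalgebra_def\<close>)

lemma tact_typed:
  assumes "M \<in> Obj C" "N \<in> Obj C" "lM \<in> hom (H \<otimes>\<^sub>o M) M" "lN \<in> hom (H \<otimes>\<^sub>o N) N"
  shows "tact (M, lM) (N, lN) \<in> hom (H \<otimes>\<^sub>o M \<otimes>\<^sub>o N) (M \<otimes>\<^sub>o N)"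
  using assms by (simp add: in_hom tensor_action_def)

lemma tcoact_typed:
  assumes "M \<in> Obj C" "N \<in> Obj C" "dM \<in> hom M (M \<otimes>\<^sub>o H)" "dN \<in> hom N (N \<otimes>\<^sub>o H)"
  shows "tcoact (M, dM) (N, dN) \<in> hom (M \<otimes>\<^sub>o N) (M \<otimes>\<^sub>o N \<otimes>\<^sub>o H)"
  using assms by (simp add: in_hom tensor_coaction_def mult_op_def)

text \<open>
  The factors may consist of several wires or of none: this covers iterated tensor products, which
  occur in associativity and in the hexagons, and tensor products with the unit object.
\<close>
lemma net_eq_tact:
  assumes "lM \<in> hom (H \<otimes>\<^sub>o tens ms) (tens ms)" "lN \<in> hom (H \<otimes>\<^sub>o tens ns) (tens ns)"
    and o: "objs ms" "objs ns" "objs ms'" "objs ns'" "tens ms' = tens ms" "tens ns' = tens ns"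
    and d: "distinct ((h, H) # (a, H) # (b, H) # ms @ ns @ ms' @ ns')"
  shows "net_eq ((h, H) # ms @ ns) (ms' @ ns') [(tact (tens ms, lM) (tens ns, lN), (h, H) # ms @ ns, ms' @ ns')]
     [comul h a b, (lM, (a, H) # ms, ms'), (lN, (b, H) # ns, ns')]"
  by (rule net_eqI[of
      "[[Box (tact (tens ms, lM) (tens ns, lN)) ((h, H) # ms @ ns) (ms' @ ns')]]" _ _ _
      "[[Box lM ((a, H) # ms) ms', Box lN ((b, H) # ns) ns'],
        [Wires [(a, H)], Cross [(b, H)] ms, Wires ns],
        [Box \<Delta> [(h, H)] [(a, H), (b, H)], Wires (ms @ ns)]]"])
    (use assms tact_typed[OF tens_Obj[OF o(1)] tens_Obj[OF o(2)] assms(1,2)]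
      in \<open>auto simp: draws_simps tens_Cons tens_append tensor_action_def\<close>)

lemma tcoact_unfold:
  assumes "M \<in> Obj C" "N \<in> Obj C" "dM \<in> hom M (M \<otimes>\<^sub>o H)" "dN \<in> hom N (N \<otimes>\<^sub>o H)"
  shows "tcoact (M, dM) (N, dN) = (Id (M \<otimes>\<^sub>o N) \<otimes> \<mu>) \<cdot> (Id (M \<otimes>\<^sub>o N) \<otimes> c H H) \<cdot>
    (Id M \<otimes> c H N \<otimes> Id H) \<cdot> (dM \<otimes> dN)"
  using assms by (simp add: in_hom tensor_coaction_def mult_op_def tensor_IdL comp_assoc)

lemma net_eq_tcoact:
  assumes "dM \<in> hom (tens ms) (tens ms \<otimes>\<^sub>o H)" "dN \<in> hom (tens ns) (tens ns \<otimes>\<^sub>o H)"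
    and o: "objs ms" "objs ns" "objs ms'" "objs ns'" "tens ms' = tens ms" "tens ns' = tens ns"
    and d: "distinct ((z, H) # (a, H) # (b, H) # ms @ ns @ ms' @ ns')"
  shows "net_eq (ms @ ns) (ms' @ ns' @ [(z, H)])
     [(tcoact (tens ms, dM) (tens ns, dN), ms @ ns, ms' @ ns' @ [(z, H)])]
     [(dM, ms, ms' @ [(a, H)]), (dN, ns, ns' @ [(b, H)]), mul b a z]"
proof -
  note t = assms(1,2)[unfolded in_hom] o tcoact_typed[OF tens_Obj[OF o(1)] tens_Obj[OF o(2)] assms(1,2), unfolded in_hom]
  have 1: "draws [[Box (tcoact (tens ms, dM) (tens ns, dN)) (ms @ ns) (ms' @ ns' @ [(z, H)])]]
    (ms @ ns) [(tcoact (tens ms, dM) (tens ns, dN), ms @ ns, ms' @ ns' @ [(z, H)])] (ms' @ ns' @ [(z, H)])"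
    using t d by (simp add: draws_simps tens_Cons tens_append)
  have 2: "draws [[Wires (ms' @ ns'), Box \<mu> [(b, H), (a, H)] [(z, H)]],
        [Wires (ms' @ ns'), Cross [(a, H)] [(b, H)]],
        [Wires ms', Cross [(a, H)] ns', Wires [(b, H)]],
        [Box dM ms (ms' @ [(a, H)]), Box dN ns (ns' @ [(b, H)])]]
     (ms @ ns) [(dM, ms, ms' @ [(a, H)]), (dN, ns, ns' @ [(b, H)]), mul b a z] (ms' @ ns' @ [(z, H)])"
    using t d by (simp add: draws_simps tens_Cons tens_append)
  have "tens (ms' @ ns') = tens ms \<otimes>\<^sub>o tens ns" using o by (simp add: tens_append)
  then show ?thesis unfolding net_eq_iff[OF 1 2]
    by (simp add: o tcoact_unfold[OF tens_Obj[OF o(1)] tens_Obj[OF o(2)] assms(1,2)] tens.simps(2))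
qed

lemma net_eq_braid_YD_list:
  assumes "lM \<in> hom (H \<otimes>\<^sub>o tens ms) (tens ms)" "dN \<in> hom (tens ns) (tens ns \<otimes>\<^sub>o H)"
    and o: "objs ms" "objs ns" "objs ms'" "objs ns'" "tens ms' = tens ms" "tens ns' = tens ns"
    and d: "distinct ((a, H) # ms @ ns @ ms' @ ns')"
  shows "net_eq (ms @ ns) (ns' @ ms')
     [(braid_YD C c (tens ms, lM, dM) (tens ns, lN, dN), ms @ ns, ns' @ ms')]
     [(dN, ns, ns' @ [(a, H)]), (lM, (a, H) # ms, ms')]"
  by (rule net_eqI[of
      "[[Box (braid_YD C c (tens ms, lM, dM) (tens ns, lN, dN)) (ms @ ns) (ns' @ ms')]]" _ _ _
      "[[Wires ns', Box lM ((a, H) # ms) ms'], [Box dN ns (ns' @ [(a, H)]), Wires ms], [Cross ms ns]]"])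
    (use assms in \<open>auto simp: draws_simps tens_Cons tens_append braid_YD_def\<close>)

abbreviation "act2 l M N x m n m' n' \<equiv>
  (l :: 'a, [(x :: nat, H), (m :: nat, M), (n :: nat, N)], [(m' :: nat, M), (n' :: nat, N)])"
abbreviation "coact2 d M N m n m' n' x \<equiv>
  (d :: 'a, [(m :: nat, M), (n :: nat, N)], [(m' :: nat, M), (n' :: nat, N), (x :: nat, H)])"
abbreviation "br s M N m n n' m' \<equiv>
  (s :: 'a, [(m :: nat, M), (n :: nat, N)], [(n' :: nat, N), (m' :: nat, M)])"

lemma net_eq_tact1:
  assumes "modl M lM" "modl N lN" "distinct [h, a, b, m, n, m', n']"
  shows "net_eq [(h, H), (m, M), (n, N)] [(m', M), (n', N)] [act2 (tact (M, lM) (N, lN)) M N h m n m' n']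
     [comul h a b, act lM M a m m', act lN N b n n']"
  using net_eq_tact[of lM "[(m, M)]" lN "[(n, N)]" "[(m', M)]" "[(n', N)]" h a b]
    left_module_typed[OF assms(1)] left_module_typed[OF assms(2)] assms(3)
  by (auto simp: tens.simps(2) in_hom)

lemma net_eq_tcoact1:
  assumes "comodr M dM" "comodr N dN" "distinct [z, a, b, m, n, m', n']"
  shows "net_eq [(m, M), (n, N)] [(m', M), (n', N), (z, H)] [coact2 (tcoact (M, dM) (N, dN)) M N m n m' n' z]
     [coact dM M m m' a, coact dN N n n' b, mul b a z]"
  using net_eq_tcoact[of dM "[(m, M)]" dN "[(n, N)]" "[(m', M)]" "[(n', N)]" z a b]
    right_comodule_typed[OF assms(1)] right_comodule_typed[OF assms(2)] assms(3)
  by (auto simp: tens.simps(2) in_hom)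

end

section \<open>Tensor products of modules and Yetter-Drinfel'd modules\<close>

context bialgebra_object
begin

lemmas wire_simps = tens.simps(2) in_hom

text \<open>
  \<open>(xy)\<close> acts on \<open>m \<otimes> n\<close> through \<open>\<Delta>(xy) = \<Delta>(x) \<Delta>(y)\<close>, and \<open>1\<close> through \<open>\<Delta>(1) = 1 \<otimes> 1\<close>.
\<close>
lemma tact_left_module:
  assumes M: "modl M lM" and N: "modl N lN"
  shows "modl (M \<otimes>\<^sub>o N) (tact (M, lM) (N, lN))"
proof -
  let ?L = "tact (M, lM) (N, lN)"
  let ?i = "[(10 :: nat, H), (11, H), (0, M), (1, N)]" and ?i' = "[(0 :: nat, M), (1, N)]"
    and ?o = "[(4 :: nat, M), (5, N)]"
  note tM = left_module_typed[OF M] and tN = left_module_typed[OF N]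
  have tL: "?L \<in> hom (H \<otimes>\<^sub>o M \<otimes>\<^sub>o N) (M \<otimes>\<^sub>o N)" using tM tN by (intro tact_typed) (auto simp: in_hom)
  note [simp] = net_simps
  note t [simp] = tM tN tL[unfolded in_hom]
  have "net_eq ?i ?o [mul 10 11 12, act2 ?L M N 12 0 1 4 5]
      [mul 10 11 12, comul 12 13 14, act lM M 13 0 4, act lN N 14 1 5]"
    by (rule net_eq_step[OF net_eq_tact1[OF M N, of 12 13 14 0 1 4 5],
        where p = "[mul 10 11 12]" and q = "[]"]) auto
  also have "net_eq ?i ?o \<dots>
      [comul 10 15 16, comul 11 17 18, mul 15 17 13, mul 16 18 14, act lM M 13 0 4,
        act lN N 14 1 5]"
    by (rule net_eq_step[OF net_eq_mult_comult[of 10 11 12 15 16 17 18 13 14],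
        where p = "[]" and q = "[act lM M 13 0 4, act lN N 14 1 5]"]) auto
  also have "net_eq ?i ?o \<dots>
      [comul 10 15 16, comul 11 17 18, act lM M 17 0 2, act lM M 15 2 4, mul 16 18 14,
        act lN N 14 1 5]"
    by (rule net_eq_step[OF net_eq_action[OF M, of 15 17 13 0 2 4],
        where p = "[comul 10 15 16, comul 11 17 18, mul 16 18 14]" and q = "[act lN N 14 1 5]"]) auto
  also have "net_eq ?i ?o \<dots>
      [comul 10 15 16, comul 11 17 18, act lM M 17 0 2, act lM M 15 2 4, act lN N 18 1 3,
        act lN N 16 3 5]"
    by (rule net_eq_step[OF net_eq_action[OF N, of 16 18 14 1 3 5],
        where p = "[comul 10 15 16, comul 11 17 18, act lM M 17 0 2, act lM M 15 2 4]" and q = "[]"]) auto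
  also have "net_eq ?i ?o \<dots>
      [act2 ?L M N 11 0 1 2 3, comul 10 15 16, act lM M 15 2 4, act lN N 16 3 5]"
    by (rule net_eq_step[OF net_eq_sym[OF net_eq_tact1[OF M N, of 11 17 18 0 1 2 3]],
        where p = "[]" and q = "[comul 10 15 16, act lM M 15 2 4, act lN N 16 3 5]"]) auto
  also have "net_eq ?i ?o \<dots>
      [act2 ?L M N 11 0 1 2 3, act2 ?L M N 10 2 3 4 5]"
    by (rule net_eq_step[OF net_eq_sym[OF net_eq_tact1[OF M N, of 10 15 16 2 3 4 5]],
        where p = "[act2 ?L M N 11 0 1 2 3]" and q = "[]"]) auto
  finally have "diagram_val [[Box ?L [(12, H), (0, M), (1, N)] [(4, M), (5, N)]],
        [Box \<mu> [(10, H), (11, H)] [(12, H)], Wires [(0, M), (1, N)]]]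
    = diagram_val [[Box ?L [(10, H), (2, M), (3, N)] [(4, M), (5, N)]],
        [Wires [(10, H)], Box ?L [(11, H), (0, M), (1, N)] [(2, M), (3, N)]]]"
    by (rule net_eqD) auto
  then have assoc: "?L \<cdot> (\<mu> \<otimes> Id (M \<otimes>\<^sub>o N)) = ?L \<cdot> (Id H \<otimes> ?L)" by simp
  have "net_eq ?i' ?o [unit 10, act2 ?L M N 10 0 1 4 5]
      [unit 10, comul 10 11 12, act lM M 11 0 4, act lN N 12 1 5]"
    by (rule net_eq_step[OF net_eq_tact1[OF M N, of 10 11 12 0 1 4 5],
        where p = "[unit 10]" and q = "[]"]) auto
  also have "net_eq ?i' ?o \<dots>
      [unit 11, unit 12, act lM M 11 0 4, act lN N 12 1 5]"
    by (rule net_eq_step[OF net_eq_unit_comult[of 10 11 12],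
        where p = "[]" and q = "[act lM M 11 0 4, act lN N 12 1 5]"]) auto
  also have "net_eq ?i' ?o \<dots>
      [idle M 0 4, unit 12, act lN N 12 1 5]"
    by (rule net_eq_step[OF net_eq_action_unit[OF M, of 0 4 11],
        where p = "[]" and q = "[unit 12, act lN N 12 1 5]"]) auto
  also have "net_eq ?i' ?o \<dots>
      [idle M 0 4, idle N 1 5]"
    by (rule net_eq_step[OF net_eq_action_unit[OF N, of 1 5 12],
        where p = "[idle M 0 4]" and q = "[]"]) auto
  finally have "diagram_val [[Box ?L [(10, H), (0, M), (1, N)] [(4, M), (5, N)]],
        [Box \<nu> [] [(10, H)], Wires [(0, M), (1, N)]]]
    = diagram_val [[Box (Id M) [(0, M)] [(4, M)], Box (Id N) [(1, N)] [(5, N)]]]"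
    by (rule net_eqD) auto
  then have "?L \<cdot> (\<nu> \<otimes> Id (M \<otimes>\<^sub>o N)) = Id (M \<otimes>\<^sub>o N)" using t by (simp add: TensorA_Id)
  with assoc show ?thesis using t by (simp add: left_module_def in_hom)
qed

text \<open>
  The coaction is \<open>m \<otimes> n \<mapsto> m\<^sub>0 \<otimes> n\<^sub>0 \<otimes> n\<^sub>1 m\<^sub>1\<close>; coassociativity is again multiplicativity of \<open>\<Delta>\<close>, and
  counitality is multiplicativity of \<open>\<epsilon>\<close>.
\<close>
lemma tcoact_right_comodule:
  assumes M: "comodr M dM" and N: "comodr N dN"
  shows "comodr (M \<otimes>\<^sub>o N) (tcoact (M, dM) (N, dN))"
proof -
  let ?D = "tcoact (M, dM) (N, dN)"
  let ?i = "[(0 :: nat, M), (1, N)]" and ?o = "[(4 :: nat, M), (5, N), (11, H), (10, H)]"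
    and ?o' = "[(4 :: nat, M), (5, N)]"
  note tM = right_comodule_typed[OF M] and tN = right_comodule_typed[OF N]
  have tL: "?D \<in> hom (M \<otimes>\<^sub>o N) (M \<otimes>\<^sub>o N \<otimes>\<^sub>o H)" using tM tN by (intro tcoact_typed) (auto simp: in_hom)
  note [simp] = net_simps
  note t [simp] = tM tN tL[unfolded in_hom]
  have "net_eq ?i ?o [coact2 ?D M N 0 1 2 3 10, coact2 ?D M N 2 3 4 5 11]
      [coact dM M 0 2 12, coact dN N 1 3 13, mul 13 12 10, coact2 ?D M N 2 3 4 5 11]"
    by (rule net_eq_step[OF net_eq_tcoact1[OF M N, of 10 12 13 0 1 2 3],
        where p = "[]" and q = "[coact2 ?D M N 2 3 4 5 11]"]) auto
  also have "net_eq ?i ?o \<dots>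
      [coact dM M 0 2 12, coact dN N 1 3 13, mul 13 12 10, coact dM M 2 4 14, coact dN N 3 5 15,
        mul 15 14 11]"
    by (rule net_eq_step[OF net_eq_tcoact1[OF M N, of 11 14 15 2 3 4 5],
        where p = "[coact dM M 0 2 12, coact dN N 1 3 13, mul 13 12 10]" and q = "[]"]) auto
  also have "net_eq ?i ?o \<dots>
      [coact dM M 0 4 16, comul 16 14 12, coact dN N 1 3 13, coact dN N 3 5 15, mul 13 12 10,
        mul 15 14 11]"
    by (rule net_eq_step[OF net_eq_coaction[OF M, of 0 2 4 14 12 16],
        where p = "[]" and q = "[coact dN N 1 3 13, coact dN N 3 5 15, mul 13 12 10, mul 15 14 11]"]) auto
  also have "net_eq ?i ?o \<dots>
      [coact dM M 0 4 16, comul 16 14 12, coact dN N 1 5 17, comul 17 15 13, mul 13 12 10,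
        mul 15 14 11]"
    by (rule net_eq_step[OF net_eq_coaction[OF N, of 1 3 5 15 13 17],
        where p = "[coact dM M 0 4 16, comul 16 14 12]" and q = "[mul 13 12 10, mul 15 14 11]"]) auto
  also have "net_eq ?i ?o \<dots>
      [coact dM M 0 4 16, coact dN N 1 5 17, mul 17 16 18, comul 18 11 10]"
    by (rule net_eq_step[OF net_eq_sym[OF net_eq_mult_comult[of 17 16 18 15 13 14 12 11 10]],
        where p = "[coact dM M 0 4 16, coact dN N 1 5 17]" and q = "[]"]) auto
  also have "net_eq ?i ?o \<dots>
      [coact2 ?D M N 0 1 4 5 18, comul 18 11 10]"
    by (rule net_eq_step[OF net_eq_sym[OF net_eq_tcoact1[OF M N, of 18 16 17 0 1 4 5]],
        where p = "[]" and q = "[comul 18 11 10]"]) auto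
  finally have "diagram_val [[Box ?D [(2, M), (3, N)] [(4, M), (5, N), (11, H)], Wires [(10, H)]],
        [Box ?D [(0, M), (1, N)] [(2, M), (3, N), (10, H)]]]
    = diagram_val [[Wires [(4, M), (5, N)], Box \<Delta> [(18, H)] [(11, H), (10, H)]],
        [Box ?D [(0, M), (1, N)] [(4, M), (5, N), (18, H)]]]"
    by (rule net_eqD) auto
  then have coassoc: "(?D \<otimes> Id H) \<cdot> ?D = (Id (M \<otimes>\<^sub>o N) \<otimes> \<Delta>) \<cdot> ?D" by simp
  have "net_eq ?i ?o' [coact2 ?D M N 0 1 4 5 10, counit 10]
      [coact dM M 0 4 12, coact dN N 1 5 13, mul 13 12 10, counit 10]"
    by (rule net_eq_step[OF net_eq_tcoact1[OF M N, of 10 12 13 0 1 4 5],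
        where p = "[]" and q = "[counit 10]"]) auto
  also have "net_eq ?i ?o' \<dots>
      [coact dM M 0 4 12, coact dN N 1 5 13, counit 13, counit 12]"
    by (rule net_eq_step[OF net_eq_mult_counit[of 13 12 10],
        where p = "[coact dM M 0 4 12, coact dN N 1 5 13]" and q = "[]"]) auto
  also have "net_eq ?i ?o' \<dots>
      [idle M 0 4, coact dN N 1 5 13, counit 13]"
    by (rule net_eq_step[OF net_eq_coaction_counit[OF M, of 0 4 12],
        where p = "[]" and q = "[coact dN N 1 5 13, counit 13]"]) auto
  also have "net_eq ?i ?o' \<dots>
      [idle M 0 4, idle N 1 5]"
    by (rule net_eq_step[OF net_eq_coaction_counit[OF N, of 1 5 13],
        where p = "[idle M 0 4]" and q = "[]"]) auto
  finally have "diagram_val [[Wires [(4, M), (5, N)], Box \<epsilon> [(10, H)] []],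
        [Box ?D [(0, M), (1, N)] [(4, M), (5, N), (10, H)]]]
    = diagram_val [[Box (Id M) [(0, M)] [(4, M)], Box (Id N) [(1, N)] [(5, N)]]]"
    by (rule net_eqD) auto
  then have "(Id (M \<otimes>\<^sub>o N) \<otimes> \<epsilon>) \<cdot> ?D = Id (M \<otimes>\<^sub>o N)" using t by (simp add: TensorA_Id)
  with coassoc show ?thesis using t by (simp add: right_comodule_def in_hom)
qed

text \<open>
  Starting from \<open>(h\<^sub>2 m)\<^sub>0 \<otimes> (h\<^sub>3 n)\<^sub>0 \<otimes> (h\<^sub>3 n)\<^sub>1 (h\<^sub>2 m)\<^sub>1 h\<^sub>1\<close>, the condition for \<open>M\<close> rewrites
  \<open>(h\<^sub>2 m)\<^sub>1 h\<^sub>1\<close> and gives \<open>h\<^sub>1 m\<^sub>0 \<otimes> (h\<^sub>3 n)\<^sub>0 \<otimes> (h\<^sub>3 n)\<^sub>1 h\<^sub>2 m\<^sub>1\<close>, and the condition for \<open>N\<close> then gives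
  \<open>h\<^sub>1 m\<^sub>0 \<otimes> h\<^sub>2 n\<^sub>0 \<otimes> h\<^sub>3 n\<^sub>1 m\<^sub>1\<close>.  The reversed product in the coaction of the tensor product is what
  makes \<open>h\<^sub>1\<close> meet \<open>m\<^sub>1\<close> first.
\<close>
lemma tensor_YD_module:
  assumes M: "ydm M lM dM" and N: "ydm N lN dN"
  shows "ydm (M \<otimes>\<^sub>o N) (tact (M, lM) (N, lN)) (tcoact (M, dM) (N, dN))"
proof -
  let ?L = "tact (M, lM) (N, lN)" and ?D = "tcoact (M, dM) (N, dN)"
  let ?i = "[(10 :: nat, H), (0, M), (1, N)]" and ?o = "[(4 :: nat, M), (5, N), (18, H)]"
  note mM = YD_module_D(1)[OF M] and mN = YD_module_D(1)[OF N]
    and cM = YD_module_D(2)[OF M] and cN = YD_module_D(2)[OF N]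
  note L = tact_left_module[OF mM mN] and D = tcoact_right_comodule[OF cM cN]
  note [simp] = net_simps
  note t [simp] = left_module_typed[OF mM] left_module_typed[OF mN] right_comodule_typed[OF cM]
    right_comodule_typed[OF cN] left_module_typed(2-4)[OF L] right_comodule_typed(2-4)[OF D]
  have "net_eq ?i ?o [comul 10 11 12, act2 ?L M N 12 0 1 2 3, coact2 ?D M N 2 3 4 5 17, mul 17 11 18]
      [comul 10 11 12, comul 12 13 14, act lM M 13 0 2, act lN N 14 1 3, coact2 ?D M N 2 3 4 5 17,
        mul 17 11 18]"
    by (rule net_eq_step[OF net_eq_tact1[OF mM mN, of 12 13 14 0 1 2 3],
        where p = "[comul 10 11 12]" and q = "[coact2 ?D M N 2 3 4 5 17, mul 17 11 18]"]) auto
  also have "net_eq ?i ?o \<dots>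
      [comul 10 11 12, comul 12 13 14, act lM M 13 0 2, act lN N 14 1 3, coact dM M 2 4 19,
        coact dN N 3 5 20, mul 20 19 17, mul 17 11 18]"
    by (rule net_eq_step[OF net_eq_tcoact1[OF cM cN, of 17 19 20 2 3 4 5],
        where p = "[comul 10 11 12, comul 12 13 14, act lM M 13 0 2, act lN N 14 1 3]" and q = "[mul 17 11 18]"]) auto
  also have "net_eq ?i ?o \<dots>
      [comul 10 11 12, comul 12 13 14, act lM M 13 0 2, act lN N 14 1 3, coact dM M 2 4 19,
        coact dN N 3 5 20, mul 19 11 21, mul 20 21 18]"
    by (rule net_eq_step[OF net_eq_mult_assoc[of 20 19 11 17 21 18],
        where p = "[comul 10 11 12, comul 12 13 14, act lM M 13 0 2, act lN N 14 1 3, coact dM M 2 4 19,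
          coact dN N 3 5 20]" and q = "[]"]) auto
  also have "net_eq ?i ?o \<dots>
      [comul 10 15 14, comul 15 11 13, act lM M 13 0 2, coact dM M 2 4 19, mul 19 11 21,
        act lN N 14 1 3, coact dN N 3 5 20, mul 20 21 18]"
    by (rule net_eq_step[OF net_eq_sym[OF net_eq_comult_coassoc[of 10 11 13 14 15 12]],
        where p = "[]" and q = "[act lM M 13 0 2, act lN N 14 1 3, coact dM M 2 4 19, coact dN N 3 5 20, mul 19 11 21,
          mul 20 21 18]"]) auto
  also have "net_eq ?i ?o \<dots>
      [comul 10 15 14, comul 15 23 24, coact dM M 0 6 22, act lM M 23 6 4, mul 24 22 21,
        act lN N 14 1 3, coact dN N 3 5 20, mul 20 21 18]"
    by (rule net_eq_step[OF net_eq_YD[OF M, of 15 0 11 13 2 19 4 21 23 24 6 22],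
        where p = "[comul 10 15 14]" and q = "[act lN N 14 1 3, coact dN N 3 5 20, mul 20 21 18]"]) auto
  also have "net_eq ?i ?o \<dots>
      [comul 10 23 16, comul 16 24 14, coact dM M 0 6 22, act lM M 23 6 4, mul 24 22 21,
        act lN N 14 1 3, coact dN N 3 5 20, mul 20 21 18]"
    by (rule net_eq_step[OF net_eq_comult_coassoc[of 10 23 24 14 15 16],
        where p = "[]" and q = "[coact dM M 0 6 22, act lM M 23 6 4, mul 24 22 21, act lN N 14 1 3, coact dN N 3 5 20,
          mul 20 21 18]"]) auto
  also have "net_eq ?i ?o \<dots>
      [comul 10 23 16, comul 16 24 14, coact dM M 0 6 22, act lM M 23 6 4, act lN N 14 1 3,
        coact dN N 3 5 20, mul 20 24 25, mul 25 22 18]"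
    by (rule net_eq_step[OF net_eq_sym[OF net_eq_mult_assoc[of 20 24 22 25 21 18]],
        where p = "[comul 10 23 16, comul 16 24 14, coact dM M 0 6 22, act lM M 23 6 4, act lN N 14 1 3,
          coact dN N 3 5 20]" and q = "[]"]) auto
  also have "net_eq ?i ?o \<dots>
      [comul 10 23 16, comul 16 26 27, coact dN N 1 7 28, act lN N 26 7 5, mul 27 28 25,
        coact dM M 0 6 22, act lM M 23 6 4, mul 25 22 18]"
    by (rule net_eq_step[OF net_eq_YD[OF N, of 16 1 24 14 3 20 5 25 26 27 7 28],
        where p = "[comul 10 23 16, coact dM M 0 6 22, act lM M 23 6 4]" and q = "[mul 25 22 18]"]) auto
  also have "net_eq ?i ?o \<dots>
      [comul 10 23 16, comul 16 26 27, coact dN N 1 7 28, act lN N 26 7 5, coact dM M 0 6 22,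
        act lM M 23 6 4, mul 28 22 29, mul 27 29 18]"
    by (rule net_eq_step[OF net_eq_mult_assoc[of 27 28 22 25 29 18],
        where p = "[comul 10 23 16, comul 16 26 27, coact dN N 1 7 28, act lN N 26 7 5, coact dM M 0 6 22,
          act lM M 23 6 4]" and q = "[]"]) auto
  also have "net_eq ?i ?o \<dots>
      [comul 10 23 16, comul 16 26 27, coact2 ?D M N 0 1 6 7 29, act lM M 23 6 4, act lN N 26 7 5,
        mul 27 29 18]"
    by (rule net_eq_step[OF net_eq_sym[OF net_eq_tcoact1[OF cM cN, of 29 22 28 0 1 6 7]],
        where p = "[comul 10 23 16, comul 16 26 27]" and q = "[act lM M 23 6 4, act lN N 26 7 5, mul 27 29 18]"]) auto
  also have "net_eq ?i ?o \<dots>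
      [comul 10 30 27, comul 30 23 26, coact2 ?D M N 0 1 6 7 29, act lM M 23 6 4, act lN N 26 7 5,
        mul 27 29 18]"
    by (rule net_eq_step[OF net_eq_sym[OF net_eq_comult_coassoc[of 10 23 26 27 30 16]],
        where p = "[]" and q = "[coact2 ?D M N 0 1 6 7 29, act lM M 23 6 4, act lN N 26 7 5, mul 27 29 18]"]) auto
  also have "net_eq ?i ?o \<dots>
      [comul 10 30 27, coact2 ?D M N 0 1 6 7 29, act2 ?L M N 30 6 7 4 5, mul 27 29 18]"
    by (rule net_eq_step[OF net_eq_sym[OF net_eq_tact1[OF mM mN, of 30 23 26 6 7 4 5]],
        where p = "[comul 10 30 27, coact2 ?D M N 0 1 6 7 29]" and q = "[mul 27 29 18]"]) auto
  finally have "diagram_val [[Wires [(4, M), (5, N)], Box \<mu> [(17, H), (11, H)] [(18, H)]],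
       [Box ?D [(2, M), (3, N)] [(4, M), (5, N), (17, H)], Wires [(11, H)]],
       [Cross [(11, H)] [(2, M), (3, N)]],
       [Wires [(11, H)], Box ?L [(12, H), (0, M), (1, N)] [(2, M), (3, N)]],
       [Box \<Delta> [(10, H)] [(11, H), (12, H)], Wires [(0, M), (1, N)]]]
    = diagram_val [[Box ?L [(30, H), (6, M), (7, N)] [(4, M), (5, N)], Box \<mu> [(27, H), (29, H)] [(18, H)]],
       [Wires [(30, H)], Cross [(27, H)] [(6, M), (7, N)], Wires [(29, H)]],
       [Box \<Delta> [(10, H)] [(30, H), (27, H)], Box ?D [(0, M), (1, N)] [(6, M), (7, N), (29, H)]]]"
    by (rule net_eqD) auto
  then show ?thesis using L D by (simp add: YD_module_def)
qed

lemma unit_left_module: "modl \<one> \<epsilon>"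
proof -
  have "\<epsilon> \<cdot> (Id H \<otimes> \<epsilon>) = (\<epsilon> \<otimes> Id \<one>) \<cdot> (Id H \<otimes> \<epsilon>)" by simp
  also have "\<dots> = \<epsilon> \<otimes> \<epsilon>" by (subst interchange) simp_all
  finally show ?thesis using bialg by (simp add: left_module_def bialgebra_def in_hom)
qed

lemma unit_right_comodule: "comodr \<one> \<nu>"
proof -
  have "(\<nu> \<otimes> Id H) \<cdot> \<nu> = (\<nu> \<otimes> Id H) \<cdot> (Id \<one> \<otimes> \<nu>)" by simp
  also have "\<dots> = \<nu> \<otimes> \<nu>" by (subst interchange) simp_all
  finally show ?thesis using bialg by (simp add: right_comodule_def bialgebra_def in_hom)
qed

text \<open>
  For the trivial action and coaction both sides reduce to the identity of \<open>H\<close>.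
\<close>
lemma unit_YD_module: "ydm \<one> \<epsilon> \<nu>"
proof -
  let ?i = "[(10 :: nat, H)]" and ?o = "[(18 :: nat, H)]"
  note [simp] = net_simps
  have t: "H \<in> Obj C" by simp
  have "net_eq ?i ?o [comul 10 11 12, counit 12, unit 17, mul 17 11 18]
      [idle H 10 11, unit 17, mul 17 11 18]"
    by (rule net_eq_step[OF net_eq_comult_counit[of 10 11 12],
        where p = "[]" and q = "[unit 17, mul 17 11 18]"]) auto
  also have "net_eq ?i ?o \<dots>
      [idle H 10 11, idle H 11 18]"
    by (rule net_eq_step[OF net_eq_unit_mult[of 11 18 17],
        where p = "[idle H 10 11]" and q = "[]"]) auto
  finally have "diagram_val [[Box \<mu> [(17, H), (11, H)] [(18, H)]], [Box \<nu> [] [(17, H)], Wires [(11, H)]],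
      [Cross [(11, H)] []], [Wires [(11, H)], Box \<epsilon> [(12, H)] []], [Box \<Delta> [(10, H)] [(11, H), (12, H)]]]
    = diagram_val [[Box (Id H) [(11, H)] [(18, H)]], [Box (Id H) [(10, H)] [(11, H)]]]"
    by (rule net_eqD) auto
  then have l: "\<mu> \<cdot> (\<nu> \<otimes> Id H) \<cdot> (Id H \<cdot> ((Id H \<otimes> \<epsilon>) \<cdot> \<Delta>)) = Id H" by simp
  have "net_eq ?i ?o [comul 10 11 12, unit 17, counit 11, mul 12 17 18]
      [idle H 10 12, unit 17, mul 12 17 18]"
    by (rule net_eq_step[OF net_eq_counit_comult[of 10 12 11],
        where p = "[]" and q = "[unit 17, mul 12 17 18]"]) auto
  also have "net_eq ?i ?o \<dots>
      [idle H 10 12, idle H 12 18]"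
    by (rule net_eq_step[OF net_eq_mult_unit[of 12 18 17],
        where p = "[idle H 10 12]" and q = "[]"]) auto
  finally have "diagram_val [[Box \<epsilon> [(11, H)] [], Box \<mu> [(12, H), (17, H)] [(18, H)]],
      [Wires [(11, H)], Cross [(12, H)] [], Wires [(17, H)]],
      [Box \<Delta> [(10, H)] [(11, H), (12, H)], Box \<nu> [] [(17, H)]]]
    = diagram_val [[Box (Id H) [(12, H)] [(18, H)]], [Box (Id H) [(10, H)] [(12, H)]]]"
    by (rule net_eqD) auto
  then have "(\<epsilon> \<otimes> \<mu>) \<cdot> ((Id H \<otimes> Id H \<otimes> Id H) \<cdot> (\<Delta> \<otimes> \<nu>)) = Id H" by simp
  with l show ?thesis
    using unit_left_module unit_right_comodule by (simp add: YD_module_def)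
qed

lemma tensor_module_hom:
  assumes M: "modl M lM" and N: "modl N lN" and M': "modl M' lM'" and N': "modl N' lN'"
    and f: "f \<in> hom M M'" "module_hom C H lM f lM'" and g: "g \<in> hom N N'" "module_hom C H lN g lN'"
  shows "module_hom C H (tact (M, lM) (N, lN)) (f \<otimes> g) (tact (M', lM') (N', lN'))"
proof -
  let ?L = "tact (M, lM) (N, lN)" and ?L' = "tact (M', lM') (N', lN')"
  let ?i = "[(10 :: nat, H), (0, M), (1, N)]" and ?o = "[(4 :: nat, M'), (5, N')]"
  note [simp] = net_simps
  note t [simp] = left_module_typed[OF M] left_module_typed[OF N] left_module_typed[OF M'] left_module_typed[OF N']
    left_module_typed(2-4)[OF tact_left_module[OF M N]] left_module_typed(2-4)[OF tact_left_module[OF M' N']]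
    f(1)[unfolded in_hom] g(1)[unfolded in_hom]
  have "net_eq ?i ?o [act2 ?L M N 10 0 1 2 3, mor f M M' 2 4, mor g N N' 3 5]
      [comul 10 11 12, act lM M 11 0 2, act lN N 12 1 3, mor f M M' 2 4, mor g N N' 3 5]"
    by (rule net_eq_step[OF net_eq_tact1[OF M N, of 10 11 12 0 1 2 3],
        where p = "[]" and q = "[mor f M M' 2 4, mor g N N' 3 5]"]) auto
  also have "net_eq ?i ?o \<dots>
      [comul 10 11 12, mor f M M' 0 6, act lM' M' 11 6 4, act lN N 12 1 3, mor g N N' 3 5]"
    by (rule net_eq_step[OF net_eq_module_hom[OF M M' f, of 11 0 2 4 6],
        where p = "[comul 10 11 12, act lN N 12 1 3]" and q = "[mor g N N' 3 5]"]) auto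
  also have "net_eq ?i ?o \<dots>
      [mor f M M' 0 6, mor g N N' 1 7, comul 10 11 12, act lM' M' 11 6 4, act lN' N' 12 7 5]"
    by (rule net_eq_step[OF net_eq_module_hom[OF N N' g, of 12 1 3 5 7],
        where p = "[comul 10 11 12, mor f M M' 0 6, act lM' M' 11 6 4]" and q = "[]"]) auto
  also have "net_eq ?i ?o \<dots>
      [mor f M M' 0 6, mor g N N' 1 7, act2 ?L' M' N' 10 6 7 4 5]"
    by (rule net_eq_step[OF net_eq_sym[OF net_eq_tact1[OF M' N', of 10 11 12 6 7 4 5]],
        where p = "[mor f M M' 0 6, mor g N N' 1 7]" and q = "[]"]) auto
  finally have "diagram_val [[Box f [(2, M)] [(4, M')], Box g [(3, N)] [(5, N')]],
      [Box ?L [(10, H), (0, M), (1, N)] [(2, M), (3, N)]]]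
    = diagram_val [[Box ?L' [(10, H), (6, M'), (7, N')] [(4, M'), (5, N')]],
      [Wires [(10, H)], Box f [(0, M)] [(6, M')], Box g [(1, N)] [(7, N')]]]"
    by (rule net_eqD) auto
  then show ?thesis by (simp add: module_hom_def)
qed

lemma tensor_comodule_hom:
  assumes M: "comodr M dM" and N: "comodr N dN" and M': "comodr M' dM'" and N': "comodr N' dN'"
    and f: "f \<in> hom M M'" "comodule_hom C H dM f dM'" and g: "g \<in> hom N N'" "comodule_hom C H dN g dN'"
  shows "comodule_hom C H (tcoact (M, dM) (N, dN)) (f \<otimes> g) (tcoact (M', dM') (N', dN'))"
proof -
  let ?D = "tcoact (M, dM) (N, dN)" and ?D' = "tcoact (M', dM') (N', dN')"
  let ?i = "[(0 :: nat, M), (1, N)]" and ?o = "[(4 :: nat, M'), (5, N'), (10, H)]"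
  note [simp] = net_simps
  note t [simp] = right_comodule_typed[OF M] right_comodule_typed[OF N] right_comodule_typed[OF M'] right_comodule_typed[OF N']
    right_comodule_typed(2-4)[OF tcoact_right_comodule[OF M N]] right_comodule_typed(2-4)[OF tcoact_right_comodule[OF M' N']]
    f(1)[unfolded in_hom] g(1)[unfolded in_hom]
  have "net_eq ?i ?o [mor f M M' 0 2, mor g N N' 1 3, coact2 ?D' M' N' 2 3 4 5 10]
      [mor f M M' 0 2, mor g N N' 1 3, coact dM' M' 2 4 11, coact dN' N' 3 5 12, mul 12 11 10]"
    by (rule net_eq_step[OF net_eq_tcoact1[OF M' N', of 10 11 12 2 3 4 5],
        where p = "[mor f M M' 0 2, mor g N N' 1 3]" and q = "[]"]) auto
  also have "net_eq ?i ?o \<dots>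
      [coact dM M 0 6 11, mor f M M' 6 4, mor g N N' 1 3, coact dN' N' 3 5 12, mul 12 11 10]"
    by (rule net_eq_step[OF net_eq_comodule_hom[OF M M' f, of 0 2 4 6 11],
        where p = "[]" and q = "[mor g N N' 1 3, coact dN' N' 3 5 12, mul 12 11 10]"]) auto
  also have "net_eq ?i ?o \<dots>
      [coact dM M 0 6 11, coact dN N 1 7 12, mul 12 11 10, mor f M M' 6 4, mor g N N' 7 5]"
    by (rule net_eq_step[OF net_eq_comodule_hom[OF N N' g, of 1 3 5 7 12],
        where p = "[coact dM M 0 6 11, mor f M M' 6 4]" and q = "[mul 12 11 10]"]) auto
  also have "net_eq ?i ?o \<dots>
      [coact2 ?D M N 0 1 6 7 10, mor f M M' 6 4, mor g N N' 7 5]"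
    by (rule net_eq_step[OF net_eq_sym[OF net_eq_tcoact1[OF M N, of 10 11 12 0 1 6 7]],
        where p = "[]" and q = "[mor f M M' 6 4, mor g N N' 7 5]"]) auto
  finally have "diagram_val [[Box ?D' [(2, M'), (3, N')] [(4, M'), (5, N'), (10, H)]],
      [Box f [(0, M)] [(2, M')], Box g [(1, N)] [(3, N')]]]
    = diagram_val [[Box f [(6, M)] [(4, M')], Box g [(7, N)] [(5, N')], Wires [(10, H)]],
      [Box ?D [(0, M), (1, N)] [(6, M), (7, N), (10, H)]]]"
    by (rule net_eqD) auto
  then show ?thesis using t by (simp add: comodule_hom_def)
qed

text \<open>
  Both sides are \<open>h\<^sub>1 m \<otimes> h\<^sub>2 n \<otimes> h\<^sub>3 p\<close>.
\<close>
lemma tact_assoc: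
  assumes M: "modl M lM" and N: "modl N lN" and P: "modl P lP"
  shows "tact (M \<otimes>\<^sub>o N, tact (M, lM) (N, lN)) (P, lP) = tact (M, lM) (N \<otimes>\<^sub>o P, tact (N, lN) (P, lP))"
proof -
  let ?MN = "tact (M, lM) (N, lN)" and ?NP = "tact (N, lN) (P, lP)"
  let ?K = "tact (M \<otimes>\<^sub>o N, ?MN) (P, lP)" and ?K' = "tact (M, lM) (N \<otimes>\<^sub>o P, ?NP)"
  let ?i = "[(10 :: nat, H), (0, M), (1, N), (2, P)]" and ?o = "[(3 :: nat, M), (4, N), (5, P)]"
  note MN = tact_left_module[OF M N] and NP = tact_left_module[OF N P]
  note [simp] = net_simps
  note t [simp] = left_module_typed[OF M] left_module_typed[OF N] left_module_typed[OF P]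
    left_module_typed(2-4)[OF MN] left_module_typed(2-4)[OF NP]
    left_module_typed(2-4)[OF tact_left_module[OF MN P]] left_module_typed(2-4)[OF tact_left_module[OF M NP]]
  have k: "net_eq ?i ?o [(?K, ?i, ?o)] [comul 10 11 12, act2 ?MN M N 11 0 1 3 4, act lP P 12 2 5]"
    using net_eq_tact[of ?MN "[(0, M), (1, N)]" lP "[(2, P)]" "[(3, M), (4, N)]" "[(5, P)]" 10 11 12] t
    by (simp add: wire_simps)
  have k': "net_eq ?i ?o [(?K', ?i, ?o)] [comul 10 13 15, act lM M 13 0 3, act2 ?NP N P 15 1 2 4 5]"
    using net_eq_tact[of lM "[(0, M)]" ?NP "[(1, N), (2, P)]" "[(3, M)]" "[(4, N), (5, P)]" 10 13 15] t
    by (simp add: wire_simps)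
  have "net_eq ?i ?o [(?K, ?i, ?o)]
      [comul 10 11 12, act2 ?MN M N 11 0 1 3 4, act lP P 12 2 5]"
    by (rule net_eq_step[OF k,
        where p = "[]" and q = "[]"]) auto
  also have "net_eq ?i ?o \<dots>
      [comul 10 11 12, comul 11 13 14, act lM M 13 0 3, act lN N 14 1 4, act lP P 12 2 5]"
    by (rule net_eq_step[OF net_eq_tact1[OF M N, of 11 13 14 0 1 3 4],
        where p = "[comul 10 11 12]" and q = "[act lP P 12 2 5]"]) auto
  also have "net_eq ?i ?o \<dots>
      [comul 10 13 15, comul 15 14 12, act lM M 13 0 3, act lN N 14 1 4, act lP P 12 2 5]"
    by (rule net_eq_step[OF net_eq_comult_coassoc[of 10 13 14 12 11 15],
        where p = "[]" and q = "[act lM M 13 0 3, act lN N 14 1 4, act lP P 12 2 5]"]) auto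
  also have "net_eq ?i ?o \<dots>
      [comul 10 13 15, act lM M 13 0 3, act2 ?NP N P 15 1 2 4 5]"
    by (rule net_eq_step[OF net_eq_sym[OF net_eq_tact1[OF N P, of 15 14 12 1 2 4 5]],
        where p = "[comul 10 13 15, act lM M 13 0 3]" and q = "[]"]) auto
  also have "net_eq ?i ?o \<dots>
      [(?K', ?i, ?o)]"
    by (rule net_eq_step[OF net_eq_sym[OF k'],
        where p = "[]" and q = "[]"]) auto
  finally have "diagram_val [[Box ?K ?i ?o]] = diagram_val [[Box ?K' ?i ?o]]"
    by (rule net_eqD) auto
  then show ?thesis by simp
qed

text \<open>
  Both sides are \<open>m\<^sub>0 \<otimes> n\<^sub>0 \<otimes> p\<^sub>0 \<otimes> p\<^sub>1 n\<^sub>1 m\<^sub>1\<close>.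
\<close>
lemma tcoact_assoc:
  assumes M: "comodr M dM" and N: "comodr N dN" and P: "comodr P dP"
  shows "tcoact (M \<otimes>\<^sub>o N, tcoact (M, dM) (N, dN)) (P, dP) = tcoact (M, dM) (N \<otimes>\<^sub>o P, tcoact (N, dN) (P, dP))"
proof -
  let ?MN = "tcoact (M, dM) (N, dN)" and ?NP = "tcoact (N, dN) (P, dP)"
  let ?K = "tcoact (M \<otimes>\<^sub>o N, ?MN) (P, dP)" and ?K' = "tcoact (M, dM) (N \<otimes>\<^sub>o P, ?NP)"
  let ?i = "[(0 :: nat, M), (1, N), (2, P)]" and ?o = "[(3 :: nat, M), (4, N), (5, P), (10, H)]"
  note MN = tcoact_right_comodule[OF M N] and NP = tcoact_right_comodule[OF N P]
  note [simp] = net_simps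
  note t [simp] = right_comodule_typed[OF M] right_comodule_typed[OF N] right_comodule_typed[OF P]
    right_comodule_typed(2-4)[OF MN] right_comodule_typed(2-4)[OF NP]
    right_comodule_typed(2-4)[OF tcoact_right_comodule[OF MN P]] right_comodule_typed(2-4)[OF tcoact_right_comodule[OF M NP]]
  have k: "net_eq ?i ?o [(?K, ?i, ?o)] [coact2 ?MN M N 0 1 3 4 11, coact dP P 2 5 12, mul 12 11 10]"
    using net_eq_tcoact[of ?MN "[(0, M), (1, N)]" dP "[(2, P)]" "[(3, M), (4, N)]" "[(5, P)]" 10 11 12] t
    by (simp add: wire_simps)
  have k': "net_eq ?i ?o [(?K', ?i, ?o)] [coact dM M 0 3 13, coact2 ?NP N P 1 2 4 5 15, mul 15 13 10]"
    using net_eq_tcoact[of dM "[(0, M)]" ?NP "[(1, N), (2, P)]" "[(3, M)]" "[(4, N), (5, P)]" 10 13 15] t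
    by (simp add: wire_simps)
  have "net_eq ?i ?o [(?K, ?i, ?o)]
      [coact2 ?MN M N 0 1 3 4 11, coact dP P 2 5 12, mul 12 11 10]"
    by (rule net_eq_step[OF k,
        where p = "[]" and q = "[]"]) auto
  also have "net_eq ?i ?o \<dots>
      [coact dM M 0 3 13, coact dN N 1 4 14, mul 14 13 11, coact dP P 2 5 12, mul 12 11 10]"
    by (rule net_eq_step[OF net_eq_tcoact1[OF M N, of 11 13 14 0 1 3 4],
        where p = "[]" and q = "[coact dP P 2 5 12, mul 12 11 10]"]) auto
  also have "net_eq ?i ?o \<dots>
      [coact dM M 0 3 13, coact dN N 1 4 14, coact dP P 2 5 12, mul 12 14 15, mul 15 13 10]"
    by (rule net_eq_step[OF net_eq_sym[OF net_eq_mult_assoc[of 12 14 13 15 11 10]],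
        where p = "[coact dM M 0 3 13, coact dN N 1 4 14, coact dP P 2 5 12]" and q = "[]"]) auto
  also have "net_eq ?i ?o \<dots>
      [coact dM M 0 3 13, coact2 ?NP N P 1 2 4 5 15, mul 15 13 10]"
    by (rule net_eq_step[OF net_eq_sym[OF net_eq_tcoact1[OF N P, of 15 14 12 1 2 4 5]],
        where p = "[coact dM M 0 3 13]" and q = "[mul 15 13 10]"]) auto
  also have "net_eq ?i ?o \<dots>
      [(?K', ?i, ?o)]"
    by (rule net_eq_step[OF net_eq_sym[OF k'],
        where p = "[]" and q = "[]"]) auto
  finally have "diagram_val [[Box ?K ?i ?o]] = diagram_val [[Box ?K' ?i ?o]]"
    by (rule net_eqD) auto
  then show ?thesis by simp
qed

lemma tact_unit_left:
  assumes M: "modl M l"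
  shows "tact (\<one>, \<epsilon>) (M, l) = l"
proof -
  let ?K = "tact (\<one>, \<epsilon>) (M, l)"
  let ?i = "[(10 :: nat, H), (0, M)]" and ?o = "[(3 :: nat, M)]"
  note K = tact_left_module[OF unit_left_module M]
  note [simp] = net_simps
  note t [simp] = left_module_typed[OF M] left_module_typed(2-4)[OF K]
  have k: "net_eq ?i ?o [(?K, ?i, ?o)] [comul 10 11 12, counit 11, act l M 12 0 3]"
    using net_eq_tact[of \<epsilon> "[]" l "[(0, M)]" "[]" "[(3, M)]" 10 11 12] t by (simp add: wire_simps)
  have "net_eq ?i ?o [(?K, ?i, ?o)]
      [comul 10 11 12, counit 11, act l M 12 0 3]"
    by (rule net_eq_step[OF k,
        where p = "[]" and q = "[]"]) auto
  also have "net_eq ?i ?o \<dots>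
      [idle H 10 12, act l M 12 0 3]"
    by (rule net_eq_step[OF net_eq_counit_comult[of 10 12 11],
        where p = "[]" and q = "[act l M 12 0 3]"]) auto
  finally have "diagram_val [[Box ?K ?i ?o]]
    = diagram_val [[Box l [(12, H), (0, M)] [(3, M)]], [Box (Id H) [(10, H)] [(12, H)], Wires [(0, M)]]]"
    by (rule net_eqD) auto
  then show ?thesis using t by (simp add: TensorA_Id)
qed

lemma tact_unit_right:
  assumes M: "modl M l"
  shows "tact (M, l) (\<one>, \<epsilon>) = l"
proof -
  let ?K = "tact (M, l) (\<one>, \<epsilon>)"
  let ?i = "[(10 :: nat, H), (0, M)]" and ?o = "[(3 :: nat, M)]"
  note K = tact_left_module[OF M unit_left_module]
  note [simp] = net_simps
  note t [simp] = left_module_typed[OF M] left_module_typed(2-4)[OF K]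
  have k: "net_eq ?i ?o [(?K, ?i, ?o)] [comul 10 11 12, act l M 11 0 3, counit 12]"
    using net_eq_tact[of l "[(0, M)]" \<epsilon> "[]" "[(3, M)]" "[]" 10 11 12] t by (simp add: wire_simps)
  have "net_eq ?i ?o [(?K, ?i, ?o)]
      [comul 10 11 12, act l M 11 0 3, counit 12]"
    by (rule net_eq_step[OF k,
        where p = "[]" and q = "[]"]) auto
  also have "net_eq ?i ?o \<dots>
      [idle H 10 11, act l M 11 0 3]"
    by (rule net_eq_step[OF net_eq_comult_counit[of 10 11 12],
        where p = "[]" and q = "[act l M 11 0 3]"]) auto
  finally have "diagram_val [[Box ?K ?i ?o]]
    = diagram_val [[Box l [(11, H), (0, M)] [(3, M)]], [Box (Id H) [(10, H)] [(11, H)], Wires [(0, M)]]]"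
    by (rule net_eqD) auto
  then show ?thesis using t by (simp add: TensorA_Id)
qed

lemma tcoact_unit_left:
  assumes M: "comodr M d"
  shows "tcoact (\<one>, \<nu>) (M, d) = d"
proof -
  let ?K = "tcoact (\<one>, \<nu>) (M, d)"
  let ?i = "[(0 :: nat, M)]" and ?o = "[(3 :: nat, M), (10, H)]"
  note K = tcoact_right_comodule[OF unit_right_comodule M]
  note [simp] = net_simps
  note t [simp] = right_comodule_typed[OF M] right_comodule_typed(2-4)[OF K]
  have k: "net_eq ?i ?o [(?K, ?i, ?o)] [unit 11, coact d M 0 3 12, mul 12 11 10]"
    using net_eq_tcoact[of \<nu> "[]" d "[(0, M)]" "[]" "[(3, M)]" 10 11 12] t by (simp add: wire_simps)
  have "net_eq ?i ?o [(?K, ?i, ?o)]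
      [unit 11, coact d M 0 3 12, mul 12 11 10]"
    by (rule net_eq_step[OF k,
        where p = "[]" and q = "[]"]) auto
  also have "net_eq ?i ?o \<dots>
      [coact d M 0 3 12, idle H 12 10]"
    by (rule net_eq_step[OF net_eq_mult_unit[of 12 10 11],
        where p = "[coact d M 0 3 12]" and q = "[]"]) auto
  finally have "diagram_val [[Box ?K ?i ?o]]
    = diagram_val [[Wires [(3, M)], Box (Id H) [(12, H)] [(10, H)]], [Box d [(0, M)] [(3, M), (12, H)]]]"
    by (rule net_eqD) auto
  then show ?thesis using t by (simp add: TensorA_Id)
qed

lemma tcoact_unit_right:
  assumes M: "comodr M d"
  shows "tcoact (M, d) (\<one>, \<nu>) = d"
proof -
  let ?K = "tcoact (M, d) (\<one>, \<nu>)"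
  let ?i = "[(0 :: nat, M)]" and ?o = "[(3 :: nat, M), (10, H)]"
  note K = tcoact_right_comodule[OF M unit_right_comodule]
  note [simp] = net_simps
  note t [simp] = right_comodule_typed[OF M] right_comodule_typed(2-4)[OF K]
  have k: "net_eq ?i ?o [(?K, ?i, ?o)] [coact d M 0 3 11, unit 12, mul 12 11 10]"
    using net_eq_tcoact[of d "[(0, M)]" \<nu> "[]" "[(3, M)]" "[]" 10 11 12] t by (simp add: wire_simps)
  have "net_eq ?i ?o [(?K, ?i, ?o)]
      [coact d M 0 3 11, unit 12, mul 12 11 10]"
    by (rule net_eq_step[OF k,
        where p = "[]" and q = "[]"]) auto
  also have "net_eq ?i ?o \<dots>
      [coact d M 0 3 11, idle H 11 10]"
    by (rule net_eq_step[OF net_eq_unit_mult[of 11 10 12],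
        where p = "[coact d M 0 3 11]" and q = "[]"]) auto
  finally have "diagram_val [[Box ?K ?i ?o]]
    = diagram_val [[Wires [(3, M)], Box (Id H) [(11, H)] [(10, H)]], [Box d [(0, M)] [(3, M), (11, H)]]]"
    by (rule net_eqD) auto
  then show ?thesis using t by (simp add: TensorA_Id)
qed

end

section \<open>The braiding of Yetter-Drinfel'd modules\<close>

context bialgebra_object
begin

text \<open>
  The braiding acts on the first factor and coacts on the second, so it needs \<open>f\<close> to respect actions
  and \<open>g\<close> to respect coactions: \<open>(g n)\<^sub>0 \<otimes> (g n)\<^sub>1 (f m) = g n\<^sub>0 \<otimes> f (n\<^sub>1 m)\<close>.
\<close>
lemma braid_YD_natural:
  assumes M: "ydm M lM dM" and N: "ydm N lN dN" and M': "ydm M' lM' dM'" and N': "ydm N' lN' dN'"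
    and f: "f \<in> hom M M'" "module_hom C H lM f lM'" and g: "g \<in> hom N N'" "comodule_hom C H dN g dN'"
  shows "brYD (M', lM', dM') (N', lN', dN') \<cdot> (f \<otimes> g) = (g \<otimes> f) \<cdot> brYD (M, lM, dM) (N, lN, dN)"
proof -
  let ?s = "brYD (M, lM, dM) (N, lN, dN)" and ?s' = "brYD (M', lM', dM') (N', lN', dN')"
  let ?i = "[(0 :: nat, M), (1, N)]" and ?o = "[(4 :: nat, N'), (5, M')]"
  note [simp] = net_simps
  note t [simp] = left_module_typed[OF YD_module_D(1)[OF M]] left_module_typed[OF YD_module_D(1)[OF M']]
    right_comodule_typed[OF YD_module_D(2)[OF N]] right_comodule_typed[OF YD_module_D(2)[OF N']]
    braid_YD_typed[OF M N, unfolded in_hom] braid_YD_typed[OF M' N', unfolded in_hom]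
    f(1)[unfolded in_hom] g(1)[unfolded in_hom]
  have "net_eq ?i ?o [mor f M M' 0 2, mor g N N' 1 3, br ?s' M' N' 2 3 4 5]
      [mor f M M' 0 2, mor g N N' 1 3, coact dN' N' 3 4 10, act lM' M' 10 2 5]"
    by (rule net_eq_step[OF net_eq_braid_YD[OF M' N', of 2 3 5 4 10],
        where p = "[mor f M M' 0 2, mor g N N' 1 3]" and q = "[]"]) auto
  also have "net_eq ?i ?o \<dots>
      [mor f M M' 0 2, coact dN N 1 6 10, mor g N N' 6 4, act lM' M' 10 2 5]"
    by (rule net_eq_step[OF net_eq_comodule_hom[OF YD_module_D(2)[OF N] YD_module_D(2)[OF N'] g, of 1 3 4 6 10],
        where p = "[mor f M M' 0 2]" and q = "[act lM' M' 10 2 5]"]) auto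
  also have "net_eq ?i ?o \<dots>
      [coact dN N 1 6 10, act lM M 10 0 7, mor f M M' 7 5, mor g N N' 6 4]"
    by (rule net_eq_step[OF net_eq_sym[OF net_eq_module_hom[OF YD_module_D(1)[OF M] YD_module_D(1)[OF M'] f, of 10 0 7 5 2]],
        where p = "[coact dN N 1 6 10, mor g N N' 6 4]" and q = "[]"]) auto
  also have "net_eq ?i ?o \<dots>
      [br ?s M N 0 1 6 7, mor g N N' 6 4, mor f M M' 7 5]"
    by (rule net_eq_step[OF net_eq_sym[OF net_eq_braid_YD[OF M N, of 0 1 7 6 10]],
        where p = "[]" and q = "[mor f M M' 7 5, mor g N N' 6 4]"]) auto
  finally have "diagram_val [[Box ?s' [(2, M'), (3, N')] [(4, N'), (5, M')]],
      [Box f [(0, M)] [(2, M')], Box g [(1, N)] [(3, N')]]]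
    = diagram_val [[Box g [(6, N)] [(4, N')], Box f [(7, M)] [(5, M')]],
      [Box ?s [(0, M), (1, N)] [(6, N), (7, M)]]]"
    by (rule net_eqD) auto
  then show ?thesis by simp
qed

text \<open>
  The Yetter-Drinfel'd condition for \<open>N\<close>, with the component in \<open>H\<close> let act on \<open>m\<close>:
  \<open>(h\<^sub>2 n)\<^sub>0 \<otimes> ((h\<^sub>2 n)\<^sub>1 h\<^sub>1) m = h\<^sub>1 n\<^sub>0 \<otimes> (h\<^sub>2 n\<^sub>1) m\<close>.
\<close>
lemma braid_YD_module_hom:
  assumes M: "ydm M lM dM" and N: "ydm N lN dN"
  shows "module_hom C H (tact (M, lM) (N, lN)) (brYD (M, lM, dM) (N, lN, dN)) (tact (N, lN) (M, lM))"
proof -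
  let ?s = "brYD (M, lM, dM) (N, lN, dN)"
  let ?MN = "tact (M, lM) (N, lN)" and ?NM = "tact (N, lN) (M, lM)"
  let ?i = "[(10 :: nat, H), (0, M), (1, N)]" and ?o = "[(4 :: nat, N), (5, M)]"
  note mM = YD_module_D(1)[OF M] and mN = YD_module_D(1)[OF N] and cN = YD_module_D(2)[OF N]
  note [simp] = net_simps
  note t [simp] = left_module_typed[OF mM] left_module_typed[OF mN] right_comodule_typed[OF cN]
    left_module_typed(2-4)[OF tact_left_module[OF mM mN]] left_module_typed(2-4)[OF tact_left_module[OF mN mM]]
    braid_YD_typed[OF M N, unfolded in_hom]
  have "net_eq ?i ?o [act2 ?MN M N 10 0 1 2 3, br ?s M N 2 3 4 5]
      [comul 10 11 12, act lM M 11 0 2, act lN N 12 1 3, br ?s M N 2 3 4 5]"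
    by (rule net_eq_step[OF net_eq_tact1[OF mM mN, of 10 11 12 0 1 2 3],
        where p = "[]" and q = "[br ?s M N 2 3 4 5]"]) auto
  also have "net_eq ?i ?o \<dots>
      [comul 10 11 12, act lM M 11 0 2, act lN N 12 1 3, coact dN N 3 4 13, act lM M 13 2 5]"
    by (rule net_eq_step[OF net_eq_braid_YD[OF M N, of 2 3 5 4 13],
        where p = "[comul 10 11 12, act lM M 11 0 2, act lN N 12 1 3]" and q = "[]"]) auto
  also have "net_eq ?i ?o \<dots>
      [comul 10 11 12, act lN N 12 1 3, coact dN N 3 4 13, mul 13 11 14, act lM M 14 0 5]"
    by (rule net_eq_step[OF net_eq_sym[OF net_eq_action[OF mM, of 13 11 14 0 2 5]],
        where p = "[comul 10 11 12, act lN N 12 1 3, coact dN N 3 4 13]" and q = "[]"]) auto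
  also have "net_eq ?i ?o \<dots>
      [comul 10 15 16, coact dN N 1 6 17, act lN N 15 6 4, mul 16 17 14, act lM M 14 0 5]"
    by (rule net_eq_step[OF net_eq_YD[OF N, of 10 1 11 12 3 13 4 14 15 16 6 17],
        where p = "[]" and q = "[act lM M 14 0 5]"]) auto
  also have "net_eq ?i ?o \<dots>
      [comul 10 15 16, coact dN N 1 6 17, act lN N 15 6 4, act lM M 17 0 7, act lM M 16 7 5]"
    by (rule net_eq_step[OF net_eq_action[OF mM, of 16 17 14 0 7 5],
        where p = "[comul 10 15 16, coact dN N 1 6 17, act lN N 15 6 4]" and q = "[]"]) auto
  also have "net_eq ?i ?o \<dots>
      [br ?s M N 0 1 6 7, comul 10 15 16, act lN N 15 6 4, act lM M 16 7 5]"
    by (rule net_eq_step[OF net_eq_sym[OF net_eq_braid_YD[OF M N, of 0 1 7 6 17]],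
        where p = "[]" and q = "[comul 10 15 16, act lN N 15 6 4, act lM M 16 7 5]"]) auto
  also have "net_eq ?i ?o \<dots>
      [br ?s M N 0 1 6 7, act2 ?NM N M 10 6 7 4 5]"
    by (rule net_eq_step[OF net_eq_sym[OF net_eq_tact1[OF mN mM, of 10 15 16 6 7 4 5]],
        where p = "[br ?s M N 0 1 6 7]" and q = "[]"]) auto
  finally have "diagram_val [[Box ?s [(2, M), (3, N)] [(4, N), (5, M)]],
      [Box ?MN [(10, H), (0, M), (1, N)] [(2, M), (3, N)]]]
    = diagram_val [[Box ?NM [(10, H), (6, N), (7, M)] [(4, N), (5, M)]],
      [Wires [(10, H)], Box ?s [(0, M), (1, N)] [(6, N), (7, M)]]]"
    by (rule net_eqD) auto
  then show ?thesis by (simp add: module_hom_def)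
qed

text \<open>
  The Yetter-Drinfel'd condition for \<open>M\<close>, with \<open>n\<^sub>1\<close> in place of \<open>h\<close>:
  \<open>n\<^sub>0 \<otimes> (n\<^sub>2 m)\<^sub>0 \<otimes> (n\<^sub>2 m)\<^sub>1 n\<^sub>1 = n\<^sub>0 \<otimes> n\<^sub>1 m\<^sub>0 \<otimes> n\<^sub>2 m\<^sub>1\<close>.
\<close>
lemma braid_YD_comodule_hom:
  assumes M: "ydm M lM dM" and N: "ydm N lN dN"
  shows "comodule_hom C H (tcoact (M, dM) (N, dN)) (brYD (M, lM, dM) (N, lN, dN)) (tcoact (N, dN) (M, dM))"
proof -
  let ?s = "brYD (M, lM, dM) (N, lN, dN)"
  let ?MN = "tcoact (M, dM) (N, dN)" and ?NM = "tcoact (N, dN) (M, dM)"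
  let ?i = "[(0 :: nat, M), (1, N)]" and ?o = "[(4 :: nat, N), (5, M), (18, H)]"
  note mM = YD_module_D(1)[OF M] and cM = YD_module_D(2)[OF M] and cN = YD_module_D(2)[OF N]
  note [simp] = net_simps
  note t [simp] = left_module_typed[OF mM] right_comodule_typed[OF cM] right_comodule_typed[OF cN]
    right_comodule_typed(2-4)[OF tcoact_right_comodule[OF cM cN]] right_comodule_typed(2-4)[OF tcoact_right_comodule[OF cN cM]]
    braid_YD_typed[OF M N, unfolded in_hom]
  have "net_eq ?i ?o [br ?s M N 0 1 2 3, coact2 ?NM N M 2 3 4 5 18]
      [coact dN N 1 2 10, act lM M 10 0 3, coact2 ?NM N M 2 3 4 5 18]"
    by (rule net_eq_step[OF net_eq_braid_YD[OF M N, of 0 1 3 2 10],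
        where p = "[]" and q = "[coact2 ?NM N M 2 3 4 5 18]"]) auto
  also have "net_eq ?i ?o \<dots>
      [coact dN N 1 2 10, act lM M 10 0 3, coact dN N 2 4 11, coact dM M 3 5 12, mul 12 11 18]"
    by (rule net_eq_step[OF net_eq_tcoact1[OF cN cM, of 18 11 12 2 3 4 5],
        where p = "[coact dN N 1 2 10, act lM M 10 0 3]" and q = "[]"]) auto
  also have "net_eq ?i ?o \<dots>
      [coact dN N 1 4 13, comul 13 11 10, act lM M 10 0 3, coact dM M 3 5 12, mul 12 11 18]"
    by (rule net_eq_step[OF net_eq_coaction[OF cN, of 1 2 4 11 10 13],
        where p = "[]" and q = "[act lM M 10 0 3, coact dM M 3 5 12, mul 12 11 18]"]) auto
  also have "net_eq ?i ?o \<dots>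
      [coact dN N 1 4 13, comul 13 14 15, coact dM M 0 6 16, act lM M 14 6 5, mul 15 16 18]"
    by (rule net_eq_step[OF net_eq_YD[OF M, of 13 0 11 10 3 12 5 18 14 15 6 16],
        where p = "[coact dN N 1 4 13]" and q = "[]"]) auto
  also have "net_eq ?i ?o \<dots>
      [coact dN N 1 7 15, coact dN N 7 4 14, coact dM M 0 6 16, act lM M 14 6 5, mul 15 16 18]"
    by (rule net_eq_step[OF net_eq_sym[OF net_eq_coaction[OF cN, of 1 7 4 14 15 13]],
        where p = "[]" and q = "[coact dM M 0 6 16, act lM M 14 6 5, mul 15 16 18]"]) auto
  also have "net_eq ?i ?o \<dots>
      [coact dM M 0 6 16, coact dN N 1 7 15, mul 15 16 18, br ?s M N 6 7 4 5]"
    by (rule net_eq_step[OF net_eq_sym[OF net_eq_braid_YD[OF M N, of 6 7 5 4 14]],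
        where p = "[coact dN N 1 7 15, coact dM M 0 6 16]" and q = "[mul 15 16 18]"]) auto
  also have "net_eq ?i ?o \<dots>
      [coact2 ?MN M N 0 1 6 7 18, br ?s M N 6 7 4 5]"
    by (rule net_eq_step[OF net_eq_sym[OF net_eq_tcoact1[OF cM cN, of 18 16 15 0 1 6 7]],
        where p = "[]" and q = "[br ?s M N 6 7 4 5]"]) auto
  finally have "diagram_val [[Box ?NM [(2, N), (3, M)] [(4, N), (5, M), (18, H)]],
      [Box ?s [(0, M), (1, N)] [(2, N), (3, M)]]]
    = diagram_val [[Box ?s [(6, M), (7, N)] [(4, N), (5, M)], Wires [(18, H)]],
      [Box ?MN [(0, M), (1, N)] [(6, M), (7, N), (18, H)]]]"
    by (rule net_eqD) auto
  then show ?thesis by (simp add: comodule_hom_def)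
qed

text \<open>
  Both sides send \<open>m \<otimes> n \<otimes> p\<close> to \<open>n\<^sub>0 \<otimes> p\<^sub>0 \<otimes> (p\<^sub>1 n\<^sub>1) m\<close>.
\<close>
lemma braid_YD_hexagon_right:
  assumes M: "ydm M lM dM" and N: "ydm N lN dN" and P: "ydm P lP dP"
  shows "brYD (M, lM, dM) (N \<otimes>\<^sub>o P, tact (N, lN) (P, lP), tcoact (N, dN) (P, dP))
    = (Id N \<otimes> brYD (M, lM, dM) (P, lP, dP)) \<cdot> (brYD (M, lM, dM) (N, lN, dN) \<otimes> Id P)"
proof -
  let ?L = "tact (N, lN) (P, lP)" and ?D = "tcoact (N, dN) (P, dP)"
  let ?s = "brYD (M, lM, dM) (N \<otimes>\<^sub>o P, ?L, ?D)"
  let ?sP = "brYD (M, lM, dM) (P, lP, dP)" and ?sN = "brYD (M, lM, dM) (N, lN, dN)"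
  let ?i = "[(0 :: nat, M), (1, N), (2, P)]" and ?o = "[(4 :: nat, N), (5, P), (3, M)]"
  note mM = YD_module_D(1)[OF M] and cN = YD_module_D(2)[OF N] and cP = YD_module_D(2)[OF P]
  note NP = tensor_YD_module[OF N P]
  note [simp] = net_simps
  note t [simp] = left_module_typed[OF mM] right_comodule_typed[OF cN] right_comodule_typed[OF cP]
    right_comodule_typed(2-4)[OF YD_module_D(2)[OF NP]] braid_YD_typed[OF M NP, unfolded in_hom]
    braid_YD_typed[OF M N, unfolded in_hom] braid_YD_typed[OF M P, unfolded in_hom]
  have k: "net_eq ?i ?o [(?s, ?i, ?o)] [coact2 ?D N P 1 2 4 5 10, act lM M 10 0 3]"
    using net_eq_braid_YD_list[of lM "[(0, M)]" ?D "[(1, N), (2, P)]" "[(3, M)]" "[(4, N), (5, P)]" 10 dM ?L] t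
    by (simp add: wire_simps)
  have "net_eq ?i ?o [(?s, ?i, ?o)]
      [coact2 ?D N P 1 2 4 5 10, act lM M 10 0 3]"
    by (rule net_eq_step[OF k,
        where p = "[]" and q = "[]"]) auto
  also have "net_eq ?i ?o \<dots>
      [coact dN N 1 4 11, coact dP P 2 5 12, mul 12 11 10, act lM M 10 0 3]"
    by (rule net_eq_step[OF net_eq_tcoact1[OF cN cP, of 10 11 12 1 2 4 5],
        where p = "[]" and q = "[act lM M 10 0 3]"]) auto
  also have "net_eq ?i ?o \<dots>
      [coact dN N 1 4 11, coact dP P 2 5 12, act lM M 11 0 6, act lM M 12 6 3]"
    by (rule net_eq_step[OF net_eq_action[OF mM, of 12 11 10 0 6 3],
        where p = "[coact dN N 1 4 11, coact dP P 2 5 12]" and q = "[]"]) auto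
  also have "net_eq ?i ?o \<dots>
      [br ?sN M N 0 1 4 6, coact dP P 2 5 12, act lM M 12 6 3]"
    by (rule net_eq_step[OF net_eq_sym[OF net_eq_braid_YD[OF M N, of 0 1 6 4 11]],
        where p = "[]" and q = "[coact dP P 2 5 12, act lM M 12 6 3]"]) auto
  also have "net_eq ?i ?o \<dots>
      [br ?sN M N 0 1 4 6, br ?sP M P 6 2 5 3]"
    by (rule net_eq_step[OF net_eq_sym[OF net_eq_braid_YD[OF M P, of 6 2 3 5 12]],
        where p = "[br ?sN M N 0 1 4 6]" and q = "[]"]) auto
  finally have "diagram_val [[Box ?s ?i ?o]]
    = diagram_val [[Wires [(4, N)], Box ?sP [(6, M), (2, P)] [(5, P), (3, M)]],
      [Box ?sN [(0, M), (1, N)] [(4, N), (6, M)], Wires [(2, P)]]]"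
    by (rule net_eqD) auto
  then show ?thesis by simp
qed

text \<open>
  Both sides send \<open>m \<otimes> n \<otimes> p\<close> to \<open>p\<^sub>0 \<otimes> p\<^sub>1 m \<otimes> p\<^sub>2 n\<close>.
\<close>
lemma braid_YD_hexagon_left:
  assumes M: "ydm M lM dM" and N: "ydm N lN dN" and P: "ydm P lP dP"
  shows "brYD (M \<otimes>\<^sub>o N, tact (M, lM) (N, lN), tcoact (M, dM) (N, dN)) (P, lP, dP)
    = (brYD (M, lM, dM) (P, lP, dP) \<otimes> Id N) \<cdot> (Id M \<otimes> brYD (N, lN, dN) (P, lP, dP))"
proof -
  let ?L = "tact (M, lM) (N, lN)" and ?D = "tcoact (M, dM) (N, dN)"
  let ?s = "brYD (M \<otimes>\<^sub>o N, ?L, ?D) (P, lP, dP)"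
  let ?sM = "brYD (M, lM, dM) (P, lP, dP)" and ?sN = "brYD (N, lN, dN) (P, lP, dP)"
  let ?i = "[(0 :: nat, M), (1, N), (2, P)]" and ?o = "[(5 :: nat, P), (3, M), (4, N)]"
  note mM = YD_module_D(1)[OF M] and mN = YD_module_D(1)[OF N] and cP = YD_module_D(2)[OF P]
  note MN = tensor_YD_module[OF M N]
  note [simp] = net_simps
  note t [simp] = left_module_typed[OF mM] left_module_typed[OF mN] right_comodule_typed[OF cP]
    left_module_typed(2-4)[OF YD_module_D(1)[OF MN]] braid_YD_typed[OF MN P, unfolded in_hom]
    braid_YD_typed[OF M P, unfolded in_hom] braid_YD_typed[OF N P, unfolded in_hom]
  have k: "net_eq ?i ?o [(?s, ?i, ?o)] [coact dP P 2 5 10, act2 ?L M N 10 0 1 3 4]"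
    using net_eq_braid_YD_list[of ?L "[(0, M), (1, N)]" dP "[(2, P)]" "[(3, M), (4, N)]" "[(5, P)]" 10 ?D lP] t
    by (simp add: wire_simps)
  have "net_eq ?i ?o [(?s, ?i, ?o)]
      [coact dP P 2 5 10, act2 ?L M N 10 0 1 3 4]"
    by (rule net_eq_step[OF k,
        where p = "[]" and q = "[]"]) auto
  also have "net_eq ?i ?o \<dots>
      [coact dP P 2 5 10, comul 10 11 12, act lM M 11 0 3, act lN N 12 1 4]"
    by (rule net_eq_step[OF net_eq_tact1[OF mM mN, of 10 11 12 0 1 3 4],
        where p = "[coact dP P 2 5 10]" and q = "[]"]) auto
  also have "net_eq ?i ?o \<dots>
      [coact dP P 2 6 12, coact dP P 6 5 11, act lM M 11 0 3, act lN N 12 1 4]"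
    by (rule net_eq_step[OF net_eq_sym[OF net_eq_coaction[OF cP, of 2 6 5 11 12 10]],
        where p = "[]" and q = "[act lM M 11 0 3, act lN N 12 1 4]"]) auto
  also have "net_eq ?i ?o \<dots>
      [br ?sN N P 1 2 6 4, coact dP P 6 5 11, act lM M 11 0 3]"
    by (rule net_eq_step[OF net_eq_sym[OF net_eq_braid_YD[OF N P, of 1 2 4 6 12]],
        where p = "[]" and q = "[coact dP P 6 5 11, act lM M 11 0 3]"]) auto
  also have "net_eq ?i ?o \<dots>
      [br ?sN N P 1 2 6 4, br ?sM M P 0 6 5 3]"
    by (rule net_eq_step[OF net_eq_sym[OF net_eq_braid_YD[OF M P, of 0 6 3 5 11]],
        where p = "[br ?sN N P 1 2 6 4]" and q = "[]"]) auto
  finally have "diagram_val [[Box ?s ?i ?o]]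
    = diagram_val [[Box ?sM [(0, M), (6, P)] [(5, P), (3, M)], Wires [(4, N)]],
      [Wires [(0, M)], Box ?sN [(1, N), (2, P)] [(6, P), (4, N)]]]"
    by (rule net_eqD) auto
  then show ?thesis by simp
qed

end

section \<open>Strong R-matrices\<close>

locale quasitriangular_bialgebra =
  bialgebra_object C c H \<mu> \<nu> \<Delta> \<epsilon> + weakly_quasitriangular C c H \<mu> \<nu> \<Delta> \<epsilon> R
  for C :: "('o, 'a, 'm) monoidal_category_scheme" (structure)
    and c :: "'o \<Rightarrow> 'o \<Rightarrow> 'a" and H :: 'o and \<mu> \<nu> \<Delta> \<epsilon> R :: 'a +
  assumes strong: "strong_R_matrix C c H \<mu> \<nu> \<Delta> \<epsilon> R"
begin

lemma net_eq_R_comult_right: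
  assumes "distinct [x, y, y1, y2, x1, x2]"
  shows "net_eq [] [(x, H), (y1, H), (y2, H)] [rmat x y, comul y y1 y2] [rmat x1 y1, rmat x2 y2, mul x2 x1 x]"
proof -
  have "(Id H \<otimes> \<Delta>) \<cdot> R = (\<mu> \<otimes> Id (H \<otimes>\<^sub>o H)) \<cdot> ((c H H \<otimes> Id (H \<otimes>\<^sub>o H)) \<cdot> (c_sq C c H \<cdot> (R \<otimes> R)))"
    using strong by (simp add: strong_R_matrix_def mult_op_def c_sq_def tensor_IdR comp_assoc)
  then show ?thesis
    by (intro net_eqI[of
      "[[Wires [(x, H)], Box \<Delta> [(y, H)] [(y1, H), (y2, H)]], [Box R [] [(x, H), (y, H)]]]" _ _ _
      "[[Box \<mu> [(x2, H), (x1, H)] [(x, H)], Wires [(y1, H), (y2, H)]],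
        [Cross [(x1, H)] [(x2, H)], Wires [(y1, H), (y2, H)]],
        [Wires [(x1, H)], Cross [(y1, H)] [(x2, H)], Wires [(y2, H)]],
        [Box R [] [(x1, H), (y1, H)], Box R [] [(x2, H), (y2, H)]]]"])
      (use assms in \<open>auto simp: net_simps c_sq_def\<close>)
qed

text \<open>
  The coaction of \<open>R\<close> on \<open>m \<otimes> n\<close> is \<open>s\<^sub>1 m \<otimes> s\<^sub>2 n \<otimes> r\<close>.  Splitting the second leg of \<open>R\<close> yields two copies
  \<open>r \<otimes> s\<close> and \<open>r' \<otimes> s'\<close> and the element \<open>s m \<otimes> s' n \<otimes> r' r\<close>, which is the coaction of the tensor
  product.  So a strong R-matrix makes the inclusion strictly monoidal.
\<close>
lemma coaR_tensor:
  assumes M: "modl M lM" and N: "modl N lN"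
  shows "coaR (M \<otimes>\<^sub>o N) (tact (M, lM) (N, lN)) = tcoact (M, coaR M lM) (N, coaR N lN)"
proof -
  let ?L = "tact (M, lM) (N, lN)" and ?D = "tcoact (M, coaR M lM) (N, coaR N lN)"
  let ?E = "coaR (M \<otimes>\<^sub>o N) ?L"
  let ?i = "[(0 :: nat, M), (1, N)]" and ?o = "[(4 :: nat, M), (5, N), (10, H)]"
  note L = tact_left_module[OF M N]
  note cM = coaR_comodule[OF M] and cN = coaR_comodule[OF N]
  note [simp] = net_simps
  note t [simp] = left_module_typed[OF M] left_module_typed[OF N] left_module_typed(2-4)[OF L] coaR_typed[OF M]
    coaR_typed[OF N] coaR_typed[OF L] right_comodule_typed(2-4)[OF tcoact_right_comodule[OF cM cN]]
  have k: "net_eq ?i ?o [(?E, ?i, ?o)] [rmat 10 11, act2 ?L M N 11 0 1 4 5]"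
    by (rule net_eqI[of "[[Box ?E ?i ?o]]" _ _ _
       "[[Cross [(10, H)] [(4, M), (5, N)]], [Wires [(10, H)], Box ?L [(11, H), (0, M), (1, N)] [(4, M), (5, N)]],
         [Box R [] [(10, H), (11, H)], Wires [(0, M), (1, N)]]]"])
      (use t in \<open>auto simp: coaction_R_def\<close>)
  have "net_eq ?i ?o [(?E, ?i, ?o)]
      [rmat 10 11, act2 ?L M N 11 0 1 4 5]"
    by (rule net_eq_step[OF k,
        where p = "[]" and q = "[]"]) auto
  also have "net_eq ?i ?o \<dots>
      [rmat 10 11, comul 11 12 13, act lM M 12 0 4, act lN N 13 1 5]"
    by (rule net_eq_step[OF net_eq_tact1[OF M N, of 11 12 13 0 1 4 5],
        where p = "[rmat 10 11]" and q = "[]"]) auto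
  also have "net_eq ?i ?o \<dots>
      [rmat 14 12, rmat 15 13, mul 15 14 10, act lM M 12 0 4, act lN N 13 1 5]"
    by (rule net_eq_step[OF net_eq_R_comult_right[of 10 11 12 13 14 15],
        where p = "[]" and q = "[act lM M 12 0 4, act lN N 13 1 5]"]) auto
  also have "net_eq ?i ?o \<dots>
      [coact (coaR M lM) M 0 4 14, rmat 15 13, act lN N 13 1 5, mul 15 14 10]"
    by (rule net_eq_step[OF net_eq_sym[OF net_eq_coaR[OF M, of 0 4 14 12]],
        where p = "[]" and q = "[rmat 15 13, act lN N 13 1 5, mul 15 14 10]"]) auto
  also have "net_eq ?i ?o \<dots>
      [coact (coaR M lM) M 0 4 14, coact (coaR N lN) N 1 5 15, mul 15 14 10]"
    by (rule net_eq_step[OF net_eq_sym[OF net_eq_coaR[OF N, of 1 5 15 13]],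
        where p = "[coact (coaR M lM) M 0 4 14]" and q = "[mul 15 14 10]"]) auto
  also have "net_eq ?i ?o \<dots>
      [coact2 ?D M N 0 1 4 5 10]"
    by (rule net_eq_step[OF net_eq_sym[OF net_eq_tcoact1[OF cM cN, of 10 14 15 0 1 4 5]],
        where p = "[]" and q = "[]"]) auto
  finally have "diagram_val [[Box ?E ?i ?o]] = diagram_val [[Box ?D ?i ?o]]"
    by (rule net_eqD) auto
  then show ?thesis by simp
qed

lemma coaR_unit: "coaR \<one> \<epsilon> = \<nu>"
  using strong by (simp add: coaction_R_def strong_R_matrix_def)

end

section \<open>Categories of objects with structure\<close>

context strict_monoidal_category
begin

lemma structured_simps:
  "Obj (structured_category C S mor tens unt) = S"
  "UnitO (structured_category C S mor tens unt) = unt"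
  "TensorO (structured_category C S mor tens unt) = tens"
  "Ident (structured_category C S mor tens unt) X = (X, Id (fst X), X)"
  "Comp (structured_category C S mor tens unt) (Y', g, Z) (X, f, Y) = (X, g \<cdot> f, Z)"
  "TensorA (structured_category C S mor tens unt) (X, f, Y) (X', f', Y') = (tens X X', f \<otimes> f', tens Y Y')"
  "Dom (structured_category C S mor tens unt) (X, f, Y) = X"
  "Cod (structured_category C S mor tens unt) (X, f, Y) = Y"
  "(X, f, Y) \<in> Arr (structured_category C S mor tens unt) \<longleftrightarrow>
     X \<in> S \<and> Y \<in> S \<and> f \<in> hom (fst X) (fst Y) \<and> mor X f Y"
  by (simp_all add: structured_category_def)

lemma hom_structured:
  "F \<in> hom\<^bsub>structured_category C S mor tens unt\<^esub> X Y \<longleftrightarrow>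
    (\<exists>f. F = (X, f, Y) \<and> X \<in> S \<and> Y \<in> S \<and> f \<in> hom (fst X) (fst Y) \<and> mor X f Y)"
  by (cases F) (auto simp: Hom_def structured_category_def)

lemma Arr_structured:
  "F \<in> Arr (structured_category C S mor tens unt) \<longleftrightarrow>
    (\<exists>X f Y. F = (X, f, Y) \<and> X \<in> S \<and> Y \<in> S \<and> f \<in> hom (fst X) (fst Y) \<and> mor X f Y)"
  by (cases F) (auto simp: structured_category_def)

text \<open>
  Composition of arrows with structure is composition in \<open>C\<close>, so the equations between arrows are
  inherited, and only closure of the structure preserving arrows is at stake.
\<close>
lemma category_structured:
  assumes obj: "\<And>X. X \<in> S \<Longrightarrow> fst X \<in> Obj C"
    and ident: "\<And>X. X \<in> S \<Longrightarrow> mor X (Id (fst X)) X"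
    and comp: "\<And>X Y Z f g. X \<in> S \<Longrightarrow> Y \<in> S \<Longrightarrow> Z \<in> S \<Longrightarrow> f \<in> hom (fst X) (fst Y) \<Longrightarrow> mor X f Y \<Longrightarrow>
      g \<in> hom (fst Y) (fst Z) \<Longrightarrow> mor Y g Z \<Longrightarrow> mor X (g \<cdot> f) Z"
  shows "category (structured_category C S mor tens unt)"
proof unfold_locales
  fix X assume "X \<in> Obj (structured_category C S mor tens unt)"
  then show "Ident (structured_category C S mor tens unt) X \<in> hom\<^bsub>structured_category C S mor tens unt\<^esub> X X"
    using obj ident Id_hom by (simp add: structured_simps hom_structured)
qed (auto simp: structured_simps hom_structured Arr_structured Comp_Id Id_Comp
    intro: comp Comp_hom Comp_assoc)

text \<open>
  Again the equations between arrows are inherited.  Strictness, however, is also a statement about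
  objects: their structures must satisfy associativity and the unit laws on the nose.
\<close>
lemma strict_monoidal_structured:
  assumes cat: "category (structured_category C S mor tens unt)"
    and obj: "\<And>X. X \<in> S \<Longrightarrow> fst X \<in> Obj C"
    and tens: "\<And>X Y. X \<in> S \<Longrightarrow> Y \<in> S \<Longrightarrow> tens X Y \<in> S \<and> fst (tens X Y) = fst X \<otimes>\<^sub>o fst Y"
    and mor: "\<And>X Y X' Y' f g. X \<in> S \<Longrightarrow> Y \<in> S \<Longrightarrow> X' \<in> S \<Longrightarrow> Y' \<in> S \<Longrightarrow>
      f \<in> hom (fst X) (fst X') \<Longrightarrow> mor X f X' \<Longrightarrow> g \<in> hom (fst Y) (fst Y') \<Longrightarrow> mor Y g Y' \<Longrightarrow>
      mor (tens X Y) (f \<otimes> g) (tens X' Y')"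
    and assoc: "\<And>X Y Z. X \<in> S \<Longrightarrow> Y \<in> S \<Longrightarrow> Z \<in> S \<Longrightarrow> tens (tens X Y) Z = tens X (tens Y Z)"
    and unit: "unt \<in> S" "fst unt = \<one>" "\<And>X. X \<in> S \<Longrightarrow> tens unt X = X" "\<And>X. X \<in> S \<Longrightarrow> tens X unt = X"
  shows "strict_monoidal_category (structured_category C S mor tens unt)"
proof -
  interpret D: category "structured_category C S mor tens unt" by (rule cat)
  show ?thesis
  proof unfold_locales
    fix F G X Y X' Y'
    assume "F \<in> hom\<^bsub>structured_category C S mor tens unt\<^esub> X Y" "G \<in> hom\<^bsub>structured_category C S mor tens unt\<^esub> X' Y'"
    then show "TensorA (structured_category C S mor tens unt) F G \<in> hom\<^bsub>structured_category C S mor tens unt\<^esub>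
        (TensorO (structured_category C S mor tens unt) X X') (TensorO (structured_category C S mor tens unt) Y Y')"
      by (auto simp: hom_structured structured_simps tens intro!: mor TensorA_hom)
  qed (auto simp: structured_simps hom_structured Arr_structured in_hom tens assoc unit obj TensorA_Id interchange)
qed

lemma braided_structured:
  assumes mon: "strict_monoidal_category (structured_category C S mor tens unt)"
    and tens: "\<And>X Y. X \<in> S \<Longrightarrow> Y \<in> S \<Longrightarrow> tens X Y \<in> S \<and> fst (tens X Y) = fst X \<otimes>\<^sub>o fst Y"
    and \<beta>: "\<And>X Y. X \<in> S \<Longrightarrow> Y \<in> S \<Longrightarrow> \<beta> X Y \<in> hom (fst X \<otimes>\<^sub>o fst Y) (fst Y \<otimes>\<^sub>o fst X) \<and> mor (tens X Y) (\<beta> X Y) (tens Y X)"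
    and natural: "\<And>X Y X' Y' f g. X \<in> S \<Longrightarrow> Y \<in> S \<Longrightarrow> X' \<in> S \<Longrightarrow> Y' \<in> S \<Longrightarrow>
      f \<in> hom (fst X) (fst X') \<Longrightarrow> mor X f X' \<Longrightarrow> g \<in> hom (fst Y) (fst Y') \<Longrightarrow> mor Y g Y' \<Longrightarrow>
      \<beta> X' Y' \<cdot> (f \<otimes> g) = (g \<otimes> f) \<cdot> \<beta> X Y"
    and right: "\<And>X Y Z. X \<in> S \<Longrightarrow> Y \<in> S \<Longrightarrow> Z \<in> S \<Longrightarrow>
      \<beta> X (tens Y Z) = (Id (fst Y) \<otimes> \<beta> X Z) \<cdot> (\<beta> X Y \<otimes> Id (fst Z))"
    and left: "\<And>X Y Z. X \<in> S \<Longrightarrow> Y \<in> S \<Longrightarrow> Z \<in> S \<Longrightarrow>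
      \<beta> (tens X Y) Z = (\<beta> X Z \<otimes> Id (fst Y)) \<cdot> (Id (fst X) \<otimes> \<beta> Y Z)"
  shows "braided_category (structured_category C S mor tens unt) (\<lambda>X Y. (tens X Y, \<beta> X Y, tens Y X))"
proof -
  interpret D: strict_monoidal_category "structured_category C S mor tens unt" by (rule mon)
  have assoc: "tens (tens X Y) Z = tens X (tens Y Z)" if "X \<in> S" "Y \<in> S" "Z \<in> S" for X Y Z
    using D.TensorO_assoc[of X Y Z] that by (simp add: structured_simps)
  show ?thesis
    by unfold_locales
      (auto simp: structured_simps hom_structured tens \<beta> natural right left assoc)
qed

end

section \<open>Modules inside Yetter-Drinfel'd modules\<close>

context algebra_coalgebra
begin

lemma module_hom_Id: "modl M l \<Longrightarrow> module_hom C H l (Id M) l"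
  using left_module_typed[of M l] by (simp add: module_hom_def TensorA_Id)

lemma comodule_hom_Id: "comodr M d \<Longrightarrow> comodule_hom C H d (Id M) d"
  using right_comodule_typed[of M d] by (simp add: comodule_hom_def TensorA_Id)

lemma module_hom_comp:
  assumes "modl M lM" "modl N lN" "modl P lP"
    and "f \<in> hom M N" "g \<in> hom N P" "module_hom C H lM f lN" "module_hom C H lN g lP"
  shows "module_hom C H lM (g \<cdot> f) lP"
proof -
  note t = left_module_typed[OF assms(1)] left_module_typed[OF assms(2)] left_module_typed[OF assms(3)]
    assms(4,5)[unfolded in_hom]
  have "(g \<cdot> f) \<cdot> lM = g \<cdot> (f \<cdot> lM)" using t by (simp add: comp_assoc)
  also have "\<dots> = (g \<cdot> lN) \<cdot> (Id H \<otimes> f)" using t assms(6) by (simp add: comp_assoc module_hom_def)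
  also have "\<dots> = lP \<cdot> (Id H \<otimes> (g \<cdot> f))" using t assms(7) by (simp add: comp_assoc module_hom_def tensor_IdL)
  finally show ?thesis by (simp add: module_hom_def)
qed

lemma comodule_hom_comp:
  assumes "comodr M dM" "comodr N dN" "comodr P dP"
    and "f \<in> hom M N" "g \<in> hom N P" "comodule_hom C H dM f dN" "comodule_hom C H dN g dP"
  shows "comodule_hom C H dM (g \<cdot> f) dP"
proof -
  note t = right_comodule_typed[OF assms(1)] right_comodule_typed[OF assms(2)] right_comodule_typed[OF assms(3)]
    assms(4,5)[unfolded in_hom]
  have "dP \<cdot> (g \<cdot> f) = (dP \<cdot> g) \<cdot> f" using t by (simp add: comp_assoc)
  also have "\<dots> = (g \<otimes> Id H) \<cdot> (dN \<cdot> f)" using t assms(7) by (simp add: comp_assoc comodule_hom_def)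
  also have "\<dots> = ((g \<cdot> f) \<otimes> Id H) \<cdot> dM" using t assms(6) by (simp add: comp_assoc comodule_hom_def tensor_IdR)
  finally show ?thesis by (simp add: comodule_hom_def)
qed

lemma Mod_category: "category (Mod C c H \<mu> \<nu> \<Delta> \<epsilon>)"
  unfolding Mod_def
  by (rule category_structured)
    (auto simp: left_module_typed(1) module_hom_Id intro: module_hom_comp)

lemma YD_module_parts:
  "ydm M l d \<Longrightarrow> modl M l \<and> comodr M d"
  by (simp add: YD_module_def)

lemma YD_category: "category (YD C c H \<mu> \<nu> \<Delta> \<epsilon>)"
  unfolding YD_def
  by (rule category_structured)
    (auto simp: left_module_typed(1) module_hom_Id comodule_hom_Id
      dest!: YD_module_parts intro: module_hom_comp comodule_hom_comp)

end

context weakly_quasitriangular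
begin

lemma i_R_functor:
  "cat_functor (Mod C c H \<mu> \<nu> \<Delta> \<epsilon>) (YD C c H \<mu> \<nu> \<Delta> \<epsilon>) (i_obj C c H R) (i_arr C c H R)"
proof -
  interpret Mod: category "Mod C c H \<mu> \<nu> \<Delta> \<epsilon>" by (rule Mod_category)
  interpret YD: category "YD C c H \<mu> \<nu> \<Delta> \<epsilon>" by (rule YD_category)
  show ?thesis
    by unfold_locales
      (auto simp: Mod_def YD_def hom_structured structured_simps i_obj_def i_arr_def
        intro: YD_module_R module_hom_comodule_hom)
qed

theorem i_R_full_subcategory:
  "full_subcategory_inclusion (Mod C c H \<mu> \<nu> \<Delta> \<epsilon>) (YD C c H \<mu> \<nu> \<Delta> \<epsilon>) (i_obj C c H R) (i_arr C c H R)"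
proof -
  interpret cat_functor "Mod C c H \<mu> \<nu> \<Delta> \<epsilon>" "YD C c H \<mu> \<nu> \<Delta> \<epsilon>" "i_obj C c H R" "i_arr C c H R"
    by (rule i_R_functor)
  show ?thesis
  proof unfold_locales
    show "inj_on (i_obj C c H R) (Obj (Mod C c H \<mu> \<nu> \<Delta> \<epsilon>))"
      by (auto simp: inj_on_def i_obj_def)
  next
    fix X Y
    assume "X \<in> Obj (Mod C c H \<mu> \<nu> \<Delta> \<epsilon>)" "Y \<in> Obj (Mod C c H \<mu> \<nu> \<Delta> \<epsilon>)"
    then show "bij_betw (i_arr C c H R) (hom\<^bsub>Mod C c H \<mu> \<nu> \<Delta> \<epsilon>\<^esub> X Y)
        (hom\<^bsub>YD C c H \<mu> \<nu> \<Delta> \<epsilon>\<^esub> (i_obj C c H R X) (i_obj C c H R Y))"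
      by (intro bij_betw_byWitness[where f' = "\<lambda>(_, f, _). (X, f, Y)"])
        (auto simp: Mod_def YD_def hom_structured structured_simps i_obj_def i_arr_def
          intro: YD_module_R module_hom_comodule_hom)
  qed
qed

end

context bialgebra_object
begin

lemma Mod_strict_monoidal: "strict_monoidal_category (Mod C c H \<mu> \<nu> \<Delta> \<epsilon>)"
  unfolding Mod_def
  by (rule strict_monoidal_structured)
    (use Mod_category in \<open>auto simp: Mod_def left_module_typed(1) tact_left_module unit_left_module tact_assoc
      tact_unit_left tact_unit_right intro: tensor_module_hom\<close>)

lemma YD_strict_monoidal: "strict_monoidal_category (YD C c H \<mu> \<nu> \<Delta> \<epsilon>)"
  unfolding YD_def
  by (rule strict_monoidal_structured)
    (use YD_category in \<open>auto simp: YD_def left_module_typed(1)[OF YD_module_D(1)] tensor_YD_module unit_YD_module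
      YD_module_D tact_assoc tcoact_assoc tact_unit_left tact_unit_right tcoact_unit_left tcoact_unit_right
      intro!: tensor_module_hom tensor_comodule_hom\<close>)

lemma YD_braided: "braided_category (YD C c H \<mu> \<nu> \<Delta> \<epsilon>) (braiding_YD C c H \<mu> \<nu> \<Delta> \<epsilon>)"
proof -
  have eq: "braiding_YD C c H \<mu> \<nu> \<Delta> \<epsilon> = (\<lambda>X Y. (TensorO (YD C c H \<mu> \<nu> \<Delta> \<epsilon>) X Y, brYD X Y, TensorO (YD C c H \<mu> \<nu> \<Delta> \<epsilon>) Y X))"
    by (intro ext) (simp add: braiding_YD_def)
  show ?thesis
    unfolding eq unfolding YD_def structured_simps
    by (rule braided_structured)
      (use YD_strict_monoidal in \<open>auto simp: YD_def tensor_YD_module braid_YD_typed braid_YD_module_hom braid_YD_comodule_hom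
      braid_YD_hexagon_left braid_YD_hexagon_right intro: braid_YD_natural\<close>)
qed

end

context quasitriangular_bialgebra
begin

lemma braid_YD_coaR_natural:
  assumes "modl M lM" "modl N lN" "modl M' lM'" "modl N' lN'"
    and "f \<in> hom M M'" "module_hom C H lM f lM'" "g \<in> hom N N'" "module_hom C H lN g lN'"
  shows "brYD (M', lM', coaR M' lM') (N', lN', coaR N' lN') \<cdot> (f \<otimes> g)
    = (g \<otimes> f) \<cdot> brYD (M, lM, coaR M lM) (N, lN, coaR N lN)"
  using assms by (intro braid_YD_natural YD_module_R module_hom_comodule_hom)

text \<open>
  The inclusion is faithful, preserves tensor products strictly and carries \<open>c\<^sup>R\<close> to \<open>c\<^sup>Y\<^sup>D\<close>, so the braiding
  axioms for modules are instances of those for Yetter-Drinfel'd modules.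
\<close>
lemma Mod_braided: "braided_category (Mod C c H \<mu> \<nu> \<Delta> \<epsilon>) (braiding_Mod C c H \<mu> \<nu> \<Delta> \<epsilon> R)"
proof -
  have eq: "braiding_Mod C c H \<mu> \<nu> \<Delta> \<epsilon> R = (\<lambda>X Y. (TensorO (Mod C c H \<mu> \<nu> \<Delta> \<epsilon>) X Y, braid_R C c H R X Y, TensorO (Mod C c H \<mu> \<nu> \<Delta> \<epsilon>) Y X))"
    by (intro ext) (simp add: braiding_Mod_def)
  show ?thesis
    unfolding eq unfolding Mod_def structured_simps
    by (rule braided_structured)
      (use Mod_strict_monoidal in \<open>auto simp: Mod_def tact_left_module coaR_tensor braid_R_eq_braid_YD
      braid_YD_typed YD_module_R braid_YD_module_hom braid_YD_hexagon_left braid_YD_hexagon_right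
      intro: braid_YD_coaR_natural\<close>)
qed

theorem i_R_braided_monoidal:
  "braided_monoidal_functor (Mod C c H \<mu> \<nu> \<Delta> \<epsilon>) (braiding_Mod C c H \<mu> \<nu> \<Delta> \<epsilon> R)
     (YD C c H \<mu> \<nu> \<Delta> \<epsilon>) (braiding_YD C c H \<mu> \<nu> \<Delta> \<epsilon>) (i_obj C c H R) (i_arr C c H R)"
proof -
  interpret cat_functor "Mod C c H \<mu> \<nu> \<Delta> \<epsilon>" "YD C c H \<mu> \<nu> \<Delta> \<epsilon>" "i_obj C c H R" "i_arr C c H R"
    by (rule i_R_functor)
  interpret Mod: braided_category "Mod C c H \<mu> \<nu> \<Delta> \<epsilon>" "braiding_Mod C c H \<mu> \<nu> \<Delta> \<epsilon> R" by (rule Mod_braided)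
  interpret YD: braided_category "YD C c H \<mu> \<nu> \<Delta> \<epsilon>" "braiding_YD C c H \<mu> \<nu> \<Delta> \<epsilon>" by (rule YD_braided)
  show ?thesis
    by unfold_locales
      (auto simp: Mod_def YD_def structured_simps Arr_structured i_obj_def i_arr_def braiding_Mod_def braiding_YD_def
        coaR_unit coaR_tensor braid_R_eq_braid_YD)
qed

end

theorem theorem3:
  fixes C :: "('o, 'a, 'm) monoidal_category_scheme"
    and c :: "'o \<Rightarrow> 'o \<Rightarrow> 'a"
    and H :: 'o and \<mu> \<nu> \<Delta> \<epsilon> R :: 'a
  assumes "symmetric_category C c"
    and "unital_algebra C H \<mu> \<nu>"
    and "counital_coalgebra C H \<Delta> \<epsilon>"
    and "weak_R_matrix C c H \<mu> \<nu> \<Delta> \<epsilon> R"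
  shows
    "(\<forall>M l\<^sub>M. left_module C H \<mu> \<nu> M l\<^sub>M \<longrightarrow>
        YD_module C c H \<mu> \<nu> \<Delta> \<epsilon> M l\<^sub>M (coaction_R C c H R M l\<^sub>M))
   \<and> (\<forall>M l\<^sub>M N l\<^sub>N. left_module C H \<mu> \<nu> M l\<^sub>M \<longrightarrow> left_module C H \<mu> \<nu> N l\<^sub>N \<longrightarrow>
        braid_R C c H R (M, l\<^sub>M) (N, l\<^sub>N) =
        braid_YD C c (M, l\<^sub>M, coaction_R C c H R M l\<^sub>M) (N, l\<^sub>N, coaction_R C c H R N l\<^sub>N))
   \<and> (\<forall>M l\<^sub>M. left_module C H \<mu> \<nu> M l\<^sub>M \<longrightarrow>
        braiding_for_object C M (braid_R C c H R (M, l\<^sub>M) (M, l\<^sub>M)))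
   \<and> full_subcategory_inclusion
        (Mod C c H \<mu> \<nu> \<Delta> \<epsilon>) (YD C c H \<mu> \<nu> \<Delta> \<epsilon>) (i_obj C c H R) (i_arr C c H R)
   \<and> (bialgebra C c H \<mu> \<nu> \<Delta> \<epsilon> \<longrightarrow> strong_R_matrix C c H \<mu> \<nu> \<Delta> \<epsilon> R \<longrightarrow>
        braided_monoidal_functor
          (Mod C c H \<mu> \<nu> \<Delta> \<epsilon>) (braiding_Mod C c H \<mu> \<nu> \<Delta> \<epsilon> R)
          (YD C c H \<mu> \<nu> \<Delta> \<epsilon>) (braiding_YD C c H \<mu> \<nu> \<Delta> \<epsilon>)
          (i_obj C c H R) (i_arr C c H R))"
proof -
  interpret symmetric_category C c by fact
  interpret weakly_quasitriangular C c H \<mu> \<nu> \<Delta> \<epsilon> R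
    using assms(2-4) by unfold_locales
  have "braided_monoidal_functor
          (Mod C c H \<mu> \<nu> \<Delta> \<epsilon>) (braiding_Mod C c H \<mu> \<nu> \<Delta> \<epsilon> R)
          (YD C c H \<mu> \<nu> \<Delta> \<epsilon>) (braiding_YD C c H \<mu> \<nu> \<Delta> \<epsilon>)
          (i_obj C c H R) (i_arr C c H R)"
    if "bialgebra C c H \<mu> \<nu> \<Delta> \<epsilon>" "strong_R_matrix C c H \<mu> \<nu> \<Delta> \<epsilon> R"
  proof -
    interpret quasitriangular_bialgebra C c H \<mu> \<nu> \<Delta> \<epsilon> R
      using that by unfold_locales
    show ?thesis by (rule i_R_braided_monoidal)
  qed
  then show ?thesis
    using YD_module_R braid_R_eq_braid_YD i_R_full_subcategory
    by (simp add: braid_YD_YB[OF YD_module_R])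
qed

end
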